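(* Let $\mathbf{w}$ be a $k$-automatic word, and let $\gamma_\mathbf{w}(n)$ be the size of the smallest string attractor of $\mathbf{w}[0..n-1]$. Then: (i) $\gamma_\mathbf{w}(n)$ is either $\Theta(1)$ or $\Theta(\log n)$; (ii) it is decidable (given an automaton for $\mathbf{w}$) which of these two cases holds; (iii) if $\gamma_\mathbf{w}(n)=\Theta(1)$, then the sequence $\gamma_\mathbf{w}(1)\gamma_\mathbf{w}(2)\cdots$ is $k$-automatic and an automaton generating it can be computed.
   Context: $k\ge2$. An infinite word $\mathbf{w}$ over a finite alphabet is $k$-automatic if there is a finite automaton that, on input the base-$k$ representation of $n$, outputs $\mathbf{w}[n]$; words are indexed from $0$. A string attractor of a finite word $x=x[0..n-1]$ is a set $S\subseteq\{0,\ldots,n-1\}$ such that every nonempty factor of $x$ has an occurrence $x[p..q]$ with $p\le i\le q$ for some $i\in S$. *)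

theory Defs
  imports Complex_Main "HOL-Library.Landau_Symbols" "HOL-Library.Nat_Bijection"
begin

function base_digits :: "nat \<Rightarrow> nat \<Rightarrow> nat list" where
  "base_digits k n = (if n = 0 \<or> k < 2 then [] else base_digits k (n div k) @ [n mod k])"
  by auto
termination by (relation "measure snd") auto

declare base_digits.simps [simp del]

text \<open>A DFAO is a pair (D, Out): states are 0 ..< length Out, the initial state is 0,
  D ! s ! d is the successor of state s on digit d, and Out ! s is the output of state s
  (output letters are natural numbers).\<close>

type_synonym dfao = "nat list list \<times> nat list"

definition wf_dfao :: "nat \<Rightarrow> dfao \<Rightarrow> bool" where
  "wf_dfao k A = (case A of (D, Out) \<Rightarrow>
     0 < length Out \<and> length D = length Out \<and>
     (\<forall>s < length Out. length (D ! s) = k \<and> (\<forall>d < k. D ! s ! d < length Out)))"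

definition dfao_run :: "dfao \<Rightarrow> nat list \<Rightarrow> nat" where
  "dfao_run A ds = (case A of (D, Out) \<Rightarrow> Out ! foldl (\<lambda>s d. D ! s ! d) 0 ds)"

definition dfao_word :: "nat \<Rightarrow> dfao \<Rightarrow> nat \<Rightarrow> nat" where
  "dfao_word k A n = dfao_run A (base_digits k n)"

definition k_automatic :: "nat \<Rightarrow> (nat \<Rightarrow> nat) \<Rightarrow> bool" where
  "k_automatic k w = (\<exists>A. wf_dfao k A \<and> (\<forall>n. w n = dfao_word k A n))"

definition enc_dfao :: "dfao \<Rightarrow> nat" where
  "enc_dfao A = (case A of (D, Out) \<Rightarrow> prod_encode (list_encode (map list_encode D), list_encode Out))"

definition factor :: "'a list \<Rightarrow> nat \<Rightarrow> nat \<Rightarrow> 'a list" where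
  "factor x i j = take (Suc j - i) (drop i x)"

definition string_attractor :: "'a list \<Rightarrow> nat set \<Rightarrow> bool" where
  "string_attractor x S =
     (S \<subseteq> {..<length x} \<and>
      (\<forall>i j. i \<le> j \<and> j < length x \<longrightarrow>
         (\<exists>p q s. p \<le> s \<and> s \<le> q \<and> q < length x \<and> s \<in> S \<and> factor x p q = factor x i j)))"

definition min_attractor_size :: "'a list \<Rightarrow> nat" where
  "min_attractor_size x = (LEAST c. \<exists>S. string_attractor x S \<and> card S = c)"

definition gamma :: "(nat \<Rightarrow> 'a) \<Rightarrow> nat \<Rightarrow> nat" where
  "gamma w n = min_attractor_size (map w [0..<n])"

datatype recf = Z | Sc | Proj nat | Cn recf "recf list" | Pr recf recf | Mn recf

inductive eval :: "recf \<Rightarrow> nat list \<Rightarrow> nat \<Rightarrow> bool" where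
  zero: "eval Z xs 0"
| suc: "eval Sc (x # xs) (Suc x)"
| proj: "i < length xs \<Longrightarrow> eval (Proj i) xs (xs ! i)"
| comp: "length ys = length gs \<Longrightarrow> (\<forall>i < length gs. eval (gs ! i) xs (ys ! i))
          \<Longrightarrow> eval f ys z \<Longrightarrow> eval (Cn f gs) xs z"
| pr0: "eval f xs z \<Longrightarrow> eval (Pr f g) (0 # xs) z"
| prS: "eval (Pr f g) (n # xs) y \<Longrightarrow> eval g (n # y # xs) z \<Longrightarrow> eval (Pr f g) (Suc n # xs) z"
| mn: "eval f (n # xs) 0 \<Longrightarrow> (\<forall>m < n. \<exists>y. eval f (m # xs) (Suc y)) \<Longrightarrow> eval (Mn f) xs n"

definition computable :: "(nat \<Rightarrow> nat) \<Rightarrow> bool" where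
  "computable F = (\<exists>r. \<forall>x. eval r [x] (F x))"

end

theory Submission
  imports Defs
begin

text \<open>
  Call a predicate on tuples of numbers recognizable if a finite automaton decides it, reading the
  base-\<open>k\<close> digits of all components in parallel, most significant first. Such predicates
  are closed under Boolean operations and quantifiers, with an explicit bound on the number of
  states; the factors of \<open>w\<close>, their occurrences and their periods are recognizable.

  For every block length \<open>k^j\<close>, marking the end points of the first full block of each state gives
  an attractor of size \<open>O(log n)\<close>. For the converse, a family of factors whose ends grow at most
  geometrically and of which each position serves boundedly many forces logarithmic growth.

  If some finite maximal run has a large exponent, pumping yields runs of one fixed period and
  growing length, each position serves at most two of them, and \<open>\<gamma>\<close> grows like \<open>log n\<close>; if a run of
  large exponent is infinite, \<open>w\<close> is ultimately periodic. Otherwise all exponents are bounded. Then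
  every factor contains a single letter or a critical word all of whose occurrences extend to the
  factor, and a critical word of length about \<open>k^j\<close> is determined by the position of its witnesses on a grid of
  width \<open>k^(j-g)\<close>. There are finitely many such grid cells \<open>\<kappa>\<close>. If for some \<open>\<kappa>\<close> no position serves
  many levels \<open>j\<close> in one residue class, \<open>\<gamma>\<close> grows like \<open>log n\<close>. Otherwise the digits of a position serving many levels can be
  pumped, so that one position serves the whole residue class below any given level, and \<open>\<gamma>\<close> is
  bounded by a number depending only on \<open>k\<close> and the number of states.

  Since this bound is explicit, and \<open>\<gamma> \<le> c\<close> is recognizable with explicitly many states, boundedness
  and the correctness of an automaton for \<open>\<gamma>\<close> can be checked on an explicit initial segment.
\<close>

subsection \<open>Attractors of infinite words\<close>

text \<open>Everything has to be effective uniformly in the automaton, and this dictates the form of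
  the argument: recognizability always carries a number of states that is an explicit function of
  \<open>k\<close> and \<open>s\<close>, so that every existing bound becomes a formula that a
  recursive function can evaluate. Critical words enter because boundedly many positions have to
  serve all factors of all scales: a critical word is pinned down by the mismatches at its two ends,
  so its coordinates need only be known up to a fixed fraction of its length. This rigidity fails
  inside long repetitions, where a text can be shifted by its period; hence large exponents are
  treated separately. Pumping yields a loop length that depends on the cell; a factorial divisible
  by all admissible loop lengths gives one modulus for the residue classes of levels. A pumped
  position is also kept in the first half of the prefix, since an occurrence in the infinite word
  helps only if it ends inside the prefix.\<close>

definition occ :: "(nat \<Rightarrow> 'a) \<Rightarrow> nat \<Rightarrow> nat \<Rightarrow> nat \<Rightarrow> bool" where
  "occ w a b q \<longleftrightarrow> (\<forall>u \<le> b - a. w (q + u) = w (a + u))"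

text \<open>Positions in the infinite word replace lists, so that \<open>w\<close> stays fixed while
  \<open>n\<close> varies and every clause is a statement about numbers that an automaton can
  read.\<close>

definition attr :: "(nat \<Rightarrow> 'a) \<Rightarrow> nat \<Rightarrow> nat set \<Rightarrow> bool" where
  "attr w n S \<longleftrightarrow> S \<subseteq> {..<n} \<and>
     (\<forall>i e. i \<le> e \<longrightarrow> e < n \<longrightarrow>
        (\<exists>q p. p \<in> S \<and> q \<le> p \<and> p \<le> q + (e - i) \<and> q + (e - i) < n \<and> occ w i e q))"

lemma factor_map_upt:
  assumes "p \<le> q" "q < n"
  shows "factor (map w [0..<n]) p q = map w [p..<Suc q]"
  using assms by (simp add: factor_def drop_map take_map del: upt_Suc)

lemma map_upt_eq_iff_occ:
  assumes "p \<le> q" "i \<le> j"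
  shows "map w [p..<Suc q] = map w [i..<Suc j] \<longleftrightarrow> q - p = j - i \<and> occ w i j p"
proof -
  have "map w [p..<Suc q] = map w [i..<Suc j] \<longleftrightarrow>
      Suc q - p = Suc j - i \<and> (\<forall>u < Suc q - p. w (p + u) = w (i + u))"
    by (auto simp: list_eq_iff_nth_eq simp del: upt_Suc)
  also have "\<dots> \<longleftrightarrow> q - p = j - i \<and> occ w i j p"
    using assms by (auto simp: occ_def Suc_diff_le less_Suc_eq_le)
  finally show ?thesis .
qed

lemma string_attractor_iff_attr:
  "string_attractor (map w [0..<n]) S \<longleftrightarrow> attr w n S"
proof -
  have "(\<exists>p q s. p \<le> s \<and> s \<le> q \<and> q < n \<and> s \<in> S \<and>
           factor (map w [0..<n]) p q = factor (map w [0..<n]) i j) \<longleftrightarrow>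
        (\<exists>q p. p \<in> S \<and> q \<le> p \<and> p \<le> q + (j - i) \<and> q + (j - i) < n \<and> occ w i j q)"
    if "i \<le> j" "j < n" for i j
  proof
    assume "\<exists>p q s. p \<le> s \<and> s \<le> q \<and> q < n \<and> s \<in> S \<and>
           factor (map w [0..<n]) p q = factor (map w [0..<n]) i j"
    then obtain p q s where *: "p \<le> s" "s \<le> q" "q < n" "s \<in> S"
      "factor (map w [0..<n]) p q = factor (map w [0..<n]) i j" by blast
    then have "q - p = j - i" "occ w i j p"
      using that map_upt_eq_iff_occ[of p q i j w] by (simp_all add: factor_map_upt del: upt_Suc)
    then show "\<exists>q p. p \<in> S \<and> q \<le> p \<and> p \<le> q + (j - i) \<and> q + (j - i) < n \<and> occ w i j q"
      using * by (intro exI[of _ p] exI[of _ s]) auto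
  next
    assume "\<exists>q p. p \<in> S \<and> q \<le> p \<and> p \<le> q + (j - i) \<and> q + (j - i) < n \<and> occ w i j q"
    then obtain q p where *: "p \<in> S" "q \<le> p" "p \<le> q + (j - i)" "q + (j - i) < n" "occ w i j q" by blast
    then have "factor (map w [0..<n]) q (q + (j - i)) = factor (map w [0..<n]) i j"
      using that map_upt_eq_iff_occ[of q "q + (j - i)" i j w] by (simp add: factor_map_upt del: upt_Suc)
    then show "\<exists>p q s. p \<le> s \<and> s \<le> q \<and> q < n \<and> s \<in> S \<and>
           factor (map w [0..<n]) p q = factor (map w [0..<n]) i j"
      using * by blast
  qed
  then show ?thesis
    unfolding string_attractor_def attr_def by auto
qed

lemma gamma_alt: "gamma w n = (LEAST c. \<exists>S. attr w n S \<and> card S = c)"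
  by (simp add: gamma_def min_attractor_size_def string_attractor_iff_attr)

lemma attr_finite: "attr w n S \<Longrightarrow> finite S"
  unfolding attr_def using finite_subset by blast

lemma attr_lessThan: "attr w n {..<n}"
proof -
  have "\<exists>q p. p \<in> {..<n} \<and> q \<le> p \<and> p \<le> q + (e - i) \<and> q + (e - i) < n \<and> occ w i e q"
    if "i \<le> e" "e < n" for i e
    using that by (intro exI[of _ i]) (auto simp: occ_def)
  then show ?thesis unfolding attr_def by blast
qed

lemma gamma_le_card: "attr w n S \<Longrightarrow> gamma w n \<le> card S"
  unfolding gamma_alt by (intro Least_le) blast

lemma gamma_attained: "\<exists>S. attr w n S \<and> card S = gamma w n"
  unfolding gamma_alt by (rule LeastI_ex) (use attr_lessThan in blast)

lemma gamma_le: "gamma w n \<le> n"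
  using gamma_le_card[OF attr_lessThan, of w n] by simp

lemma gamma_pos:
  assumes "0 < n" shows "0 < gamma w n"
proof -
  obtain S where S: "attr w n S" "card S = gamma w n" using gamma_attained by blast
  then have "S \<noteq> {}" using assms unfolding attr_def by blast
  then show ?thesis using S attr_finite card_gt_0_iff by metis
qed

lemma pigeonhole_seq:
  fixes f :: "nat \<Rightarrow> 'a"
  assumes "finite A" "\<And>i. i \<in> I \<Longrightarrow> f i \<in> A" "card A < card I"
  obtains i j where "i \<in> I" "j \<in> I" "i < j" "f i = f j"
proof -
  have "\<not> inj_on f I"
  proof
    assume "inj_on f I"
    then have "card I = card (f ` I)" by (simp add: card_image)
    also have "\<dots> \<le> card A" using assms by (intro card_mono) auto
    finally show False using assms by simp
  qed
  then obtain x y where "x \<in> I" "y \<in> I" "x \<noteq> y" "f x = f y" unfolding inj_on_def by blast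
  then show thesis using that by (metis linorder_neqE_nat)
qed

locale radix =
  fixes k :: nat
  assumes k2: "2 \<le> k"
begin

lemma kpos[simp]: "0 < k" "k \<noteq> 0" "Suc 0 < k" "Suc 0 \<le> k" using k2 by auto

lemma less_kpow: "n < k ^ n"
  using k2 by (meson less_exp less_le_trans power_mono zero_le)

lemma kpow_pos[simp]: "0 < k ^ n" by simp

lemma kpow_le_iff[simp]: "k ^ a \<le> k ^ b \<longleftrightarrow> a \<le> b" using k2 by simp
lemma kpow_less_iff[simp]: "k ^ a < k ^ b \<longleftrightarrow> a < b" using k2 by simp

lemma mult_add_less_pow:
  assumes "u < k ^ a" "v < k ^ b" shows "u * k ^ b + v < k ^ (a + b)"
proof -
  have "u * k ^ b + v < (u + 1) * k ^ b" using assms by simp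
  also have "\<dots> \<le> k ^ a * k ^ b" using assms by (intro mult_right_mono) auto
  finally show ?thesis by (simp add: power_add)
qed

lemma klog:
  assumes "0 < n" obtains j where "k ^ j \<le> n" "n < k ^ Suc j"
proof -
  define j where "j = (LEAST j. n < k ^ Suc j)"
  have ex: "\<exists>j. n < k ^ Suc j" using less_kpow[of n] less_kpow[of "Suc n"] by (metis Suc_lessD)
  have 1: "n < k ^ Suc j" unfolding j_def using ex by (rule LeastI_ex)
  have "k ^ j \<le> n"
  proof (cases j)
    case 0 then show ?thesis using assms by simp
  next
    case (Suc i)
    then have "\<not> n < k ^ Suc i" using not_less_Least[of i "\<lambda>j. n < k ^ Suc j"] unfolding j_def by auto
    then show ?thesis using Suc by simp
  qed
  with 1 show thesis using that by blast
qed

subsection \<open>Recognizable predicates\<close>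

text \<open>The map \<open>T\<close> sends an environment to the state of the automaton; appending one digit to
  every variable turns \<open>e\<close> into \<open>\<lambda>v. k * e v + d v\<close>. The initial state is the state of
  the zero environment, so leading zeros need no separate treatment.\<close>

definition cong_fun :: "((nat \<Rightarrow> nat) \<Rightarrow> 'a) \<Rightarrow> bool" where
  "cong_fun T \<longleftrightarrow> (\<forall>e e' d. T e = T e' \<longrightarrow> (\<forall>v. d v < k) \<longrightarrow>
     T (\<lambda>v. k * e v + d v) = T (\<lambda>v. k * e' v + d v))"

text \<open>Environments assign a value to every variable, so no arity has to be tracked when
  predicates are combined.\<close>

definition recog :: "nat \<Rightarrow> ((nat \<Rightarrow> nat) \<Rightarrow> bool) \<Rightarrow> bool" where
  "recog N P \<longleftrightarrow> (\<exists>T :: (nat \<Rightarrow> nat) \<Rightarrow> nat. cong_fun T \<and> (\<forall>e. T e < N) \<and>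
     (\<forall>e e'. T e = T e' \<longrightarrow> P e = P e'))"

lemma cong_funD:
  "cong_fun T \<Longrightarrow> T e = T e' \<Longrightarrow> (\<And>v. d v < k) \<Longrightarrow>
     T (\<lambda>v. k * e v + d v) = T (\<lambda>v. k * e' v + d v)"
  unfolding cong_fun_def by blast

text \<open>States may come from any finite set, such as pairs or sets of states; a bijection onto
  an initial segment renumbers them.\<close>

lemma recogI:
  fixes T :: "(nat \<Rightarrow> nat) \<Rightarrow> 'a"
  assumes "\<And>e e' d. T e = T e' \<Longrightarrow> (\<And>v. d v < k) \<Longrightarrow>
             T (\<lambda>v. k * e v + d v) = T (\<lambda>v. k * e' v + d v)"
    and "\<And>e. T e \<in> X" "finite X" "card X \<le> N"
    and "\<And>e e'. T e = T e' \<Longrightarrow> P e \<Longrightarrow> P e'"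
  shows "recog N P"
proof -
  obtain h where h: "bij_betw h X {0..<card X}" using ex_bij_betw_finite_nat assms(3) by blast
  have inj: "h (T e) = h (T e') \<longleftrightarrow> T e = T e'" for e e'
    using h assms(2) by (auto simp: bij_betw_def inj_on_def)
  have "h (T e) < N" for e
  proof -
    have "h (T e) \<in> h ` X" using assms(2) by blast
    then show ?thesis using h assms(4) unfolding bij_betw_def by simp
  qed
  moreover have "cong_fun (\<lambda>e. h (T e))"
    unfolding cong_fun_def inj using assms(1) by blast
  moreover have "\<forall>e e'. h (T e) = h (T e') \<longrightarrow> P e = P e'"
    unfolding inj using assms(5) by metis
  ultimately show ?thesis unfolding recog_def by blast
qed

lemma recog_mono: "recog N P \<Longrightarrow> N \<le> M \<Longrightarrow> recog M P"
  unfolding recog_def by (meson less_le_trans)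

lemma recog_not: "recog N P \<Longrightarrow> recog N (\<lambda>e. \<not> P e)"
  unfolding recog_def by metis

lemma recog_binop:
  assumes "recog N P" "recog M Q"
  shows "recog (N * M) (\<lambda>e. f (P e) (Q e))"
proof -
  obtain T where T: "cong_fun T" "\<forall>e. T e < N" "\<forall>e e'. T e = T e' \<longrightarrow> P e = P e'"
    using assms(1) unfolding recog_def by blast
  obtain U where U: "cong_fun U" "\<forall>e. U e < M" "\<forall>e e'. U e = U e' \<longrightarrow> Q e = Q e'"
    using assms(2) unfolding recog_def by blast
  show ?thesis
  proof (rule recogI[where T = "\<lambda>e. (T e, U e)" and X = "{..<N} \<times> {..<M}"])
    fix e e' and d :: "nat \<Rightarrow> nat" assume "(T e, U e) = (T e', U e')" "\<And>v. d v < k"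
    then show "(T (\<lambda>v. k * e v + d v), U (\<lambda>v. k * e v + d v)) =
               (T (\<lambda>v. k * e' v + d v), U (\<lambda>v. k * e' v + d v))"
      using cong_funD[OF T(1), of e e' d] cong_funD[OF U(1), of e e' d] by simp
  next
    fix e e' assume "(T e, U e) = (T e', U e')" "f (P e) (Q e)"
    moreover from this have "P e = P e'" "Q e = Q e'" using T(3) U(3) by blast+
    ultimately show "f (P e') (Q e')" by simp
  next
    fix e show "(T e, U e) \<in> {..<N} \<times> {..<M}" using T(2) U(2) by simp
  qed (simp_all add: card_cartesian_product)
qed

lemma recog_and: "recog N P \<Longrightarrow> recog M Q \<Longrightarrow> recog (N * M) (\<lambda>e. P e \<and> Q e)"
  by (rule recog_binop[where f = "(\<and>)"])
lemma recog_or: "recog N P \<Longrightarrow> recog M Q \<Longrightarrow> recog (N * M) (\<lambda>e. P e \<or> Q e)"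
  by (rule recog_binop[where f = "(\<or>)"])
lemma recog_imp: "recog N P \<Longrightarrow> recog M Q \<Longrightarrow> recog (N * M) (\<lambda>e. P e \<longrightarrow> Q e)"
  by (rule recog_binop[where f = "(\<longrightarrow>)"])

lemma recog_const: "recog 1 (\<lambda>e. b)"
  by (rule recogI[where T = "\<lambda>_. ()" and X = UNIV]) auto

lemma recog_Bex_less:
  "(\<And>t. t < c \<Longrightarrow> recog N (P t)) \<Longrightarrow> recog (N ^ c) (\<lambda>e. \<exists>t < c. P t e)"
proof (induction c)
  case 0
  then show ?case using recog_const[of False] by simp
next
  case (Suc c)
  have "recog (N * N ^ c) (\<lambda>e. P c e \<or> (\<exists>t < c. P t e))"
    by (intro recog_or Suc) auto
  moreover have "(\<lambda>e. P c e \<or> (\<exists>t < c. P t e)) = (\<lambda>e. \<exists>t < Suc c. P t e)"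
    using less_Suc_eq by auto
  ultimately show ?case by simp
qed

lemma recog_rename:
  assumes "recog N P" shows "recog N (\<lambda>e. P (\<lambda>v. e (f v)))"
proof -
  obtain T where T: "cong_fun T" "\<forall>e. T e < N" "\<forall>e e'. T e = T e' \<longrightarrow> P e = P e'"
    using assms unfolding recog_def by blast
  show ?thesis
  proof (rule recogI[where T = "\<lambda>e. T (\<lambda>v. e (f v))" and X = "{..<N}"])
    fix e e' d :: "nat \<Rightarrow> nat"
    assume eq: "T (\<lambda>v. e (f v)) = T (\<lambda>v. e' (f v))" and d: "\<And>v. d v < k"
    show "T (\<lambda>v. k * e (f v) + d (f v)) = T (\<lambda>v. k * e' (f v) + d (f v))"
      using cong_funD[OF T(1), of "\<lambda>v. e (f v)" "\<lambda>v. e' (f v)" "\<lambda>v. d (f v)", OF eq d] .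
  next
    fix e e' assume "T (\<lambda>v. e (f v)) = T (\<lambda>v. e' (f v))" "P (\<lambda>v. e (f v))"
    then show "P (\<lambda>v. e' (f v))"
      using T(3)[rule_format, of "\<lambda>v. e (f v)" "\<lambda>v. e' (f v)"] by simp
  qed (use T(2) in simp_all)
qed

text \<open>Subset construction: the new state of \<open>e\<close> is the set of states reachable by
  altering the variables in \<open>X\<close>. Witnesses with more digits than \<open>e\<close> cause
  no trouble, as \<open>R\<close> ranges over all values. A whole set of variables costs a single
  exponential, which keeps the height of the tower in \<open>Ngam_of\<close> independent of the
  number of attractor positions.\<close>

lemma recog_exists_set:
  assumes "recog N P"
  shows "recog (2 ^ N) (\<lambda>e. \<exists>e'. (\<forall>v. v \<notin> X \<longrightarrow> e' v = e v) \<and> P e')"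
proof -
  obtain T where T: "cong_fun T" "\<forall>e. T e < N" "\<forall>e e'. T e = T e' \<longrightarrow> P e = P e'"
    using assms unfolding recog_def by blast
  define R where "R e = {T e' | e'. \<forall>v. v \<notin> X \<longrightarrow> e' v = e v}" for e
  have step: "R (\<lambda>v. k * e v + d v) \<subseteq> R (\<lambda>v. k * f v + d v)"
    if eq: "R e = R f" and d: "\<And>v. d v < k" for e f and d :: "nat \<Rightarrow> nat"
  proof
    fix \<sigma> assume "\<sigma> \<in> R (\<lambda>v. k * e v + d v)"
    then obtain e' where e': "\<sigma> = T e'" "\<forall>v. v \<notin> X \<longrightarrow> e' v = k * e v + d v" unfolding R_def by blast
    \<comment> \<open>The witness is split into its last digits \<open>c\<close> and the rest
      \<open>g\<close>; the hypothesis on \<open>R e\<close> applies to the rest.\<close>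
    define g where "g v = e' v div k" for v
    define c where "c v = e' v mod k" for v
    have c: "c v < k" for v by (simp add: c_def)
    have e'_eq: "e' = (\<lambda>v. k * g v + c v)" by (simp add: g_def c_def)
    have off: "g v = e v" "c v = d v" if "v \<notin> X" for v
      using e'(2) that d[of v] by (auto simp: g_def c_def)
    have "T g \<in> R f" unfolding eq[symmetric] unfolding R_def
      by (intro CollectI exI[of _ g]) (simp add: off)
    then obtain h where h: "T g = T h" "\<forall>v. v \<notin> X \<longrightarrow> h v = f v" unfolding R_def by (elim CollectE exE conjE)
    have "\<sigma> = T (\<lambda>v. k * h v + c v)" using e'(1) cong_funD[OF T(1), of g h c] h(1) c unfolding e'_eq by simp
    then show "\<sigma> \<in> R (\<lambda>v. k * f v + d v)" unfolding R_def
      by (intro CollectI exI[of _ "\<lambda>v. k * h v + c v"]) (simp add: h(2) off)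
  qed
  show ?thesis
  proof (rule recogI[where T = R and X = "Pow {..<N}"])
    fix e e' and d :: "nat \<Rightarrow> nat" assume "R e = R e'" "\<And>v. d v < k"
    then show "R (\<lambda>v. k * e v + d v) = R (\<lambda>v. k * e' v + d v)"
      using step[of e e' d] step[of e' e d] by auto
  next
    fix e show "R e \<in> Pow {..<N}" using T(2) unfolding R_def by auto
  next
    fix e f assume "R e = R f" and ex: "\<exists>e'. (\<forall>v. v \<notin> X \<longrightarrow> e' v = e v) \<and> P e'"
    then obtain e' where e': "\<forall>v. v \<notin> X \<longrightarrow> e' v = e v" "P e'" by blast
    have "T e' \<in> R f" unfolding \<open>R e = R f\<close>[symmetric] unfolding R_def
      by (intro CollectI exI[of _ e']) (simp add: e'(1))
    then obtain f' where f': "T e' = T f'" "\<forall>v. v \<notin> X \<longrightarrow> f' v = f v" unfolding R_def by (elim CollectE exE conjE)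
    have "P f'" using T(3)[rule_format, OF f'(1)] e'(2) by simp
    then show "\<exists>e'. (\<forall>v. v \<notin> X \<longrightarrow> e' v = f v) \<and> P e'" using f'(2) by (intro exI[of _ f']) simp
  qed (simp_all add: card_Pow)
qed

lemma recog_exists:
  assumes "recog N P" shows "recog (2 ^ N) (\<lambda>e. \<exists>y. P (e(x := y)))"
proof -
  have "(\<exists>e'. (\<forall>v. v \<notin> {x} \<longrightarrow> e' v = e v) \<and> P e') \<longleftrightarrow> (\<exists>y. P (e(x := y)))" for e
  proof
    assume "\<exists>e'. (\<forall>v. v \<notin> {x} \<longrightarrow> e' v = e v) \<and> P e'"
    then obtain e' where e': "\<forall>v. v \<notin> {x} \<longrightarrow> e' v = e v" "P e'" by blast
    then have "e' = e(x := e' x)" by auto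
    then show "\<exists>y. P (e(x := y))" using e'(2) by metis
  next
    assume "\<exists>y. P (e(x := y))"
    then obtain y where "P (e(x := y))" by blast
    then show "\<exists>e'. (\<forall>v. v \<notin> {x} \<longrightarrow> e' v = e v) \<and> P e'" by (intro exI[of _ "e(x := y)"]) simp
  qed
  then show ?thesis using recog_exists_set[OF assms, of "{x}"] by simp
qed

lemma recog_all:
  assumes "recog N P" shows "recog (2 ^ N) (\<lambda>e. \<forall>y. P (e(x := y)))"
proof -
  have "recog (2 ^ N) (\<lambda>e. \<not> (\<exists>y. \<not> P (e(x := y))))"
    by (intro recog_not recog_exists assms)
  then show ?thesis by (simp only: not_ex not_not)
qed

text \<open>A form of \<open>recog_exists\<close> for formulas with a named bound variable:
  \<open>x\<close> is a fresh slot, and the second premise says that \<open>P\<close> does not read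
  it.\<close>

lemma recog_ex_var:
  assumes "recog N (\<lambda>e. P e (e x))" "\<And>e y z. P (e(x := y)) z = P e z"
  shows "recog (2 ^ N) (\<lambda>e. \<exists>y. P e y)"
  using recog_exists[OF assms(1), of x] by (simp add: assms(2))

lemma recog_all_var:
  assumes "recog N (\<lambda>e. P e (e x))" "\<And>e y z. P (e(x := y)) z = P e z"
  shows "recog (2 ^ N) (\<lambda>e. \<forall>y. P e y)"
  using recog_all[OF assms(1), of x] by (simp add: assms(2))

text \<open>A difference of at least 2 in absolute value keeps its sign whatever digits follow, so it may be clipped.\<close>

definition clip :: "int \<Rightarrow> int" where "clip x = max (-2) (min 2 x)"

text \<open>The bound on \<open>c\<close> is what two digits can contribute:
  \<open>x \<ge> 2\<close> gives \<open>k * x + c \<ge> 2 * k - 2 * (k - 1) = 2\<close>, so both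
  extremes are absorbing.\<close>

lemma clip_step:
  assumes "clip x = clip y" "\<bar>c\<bar> \<le> 2 * (int k - 1)"
  shows "clip (int k * x + c) = clip (int k * y + c)"
proof (cases "x = y")
  case False
  have *: "clip (int k * z + c) = 2" if "z \<ge> 2" for z
  proof -
    have "int k * z \<ge> int k * 2" using that by (intro mult_left_mono) auto
    moreover have "- (2 * (int k - 1)) \<le> c" using assms(2) by (simp add: abs_le_iff)
    ultimately have "int k * 2 + - (2 * (int k - 1)) \<le> int k * z + c" by (rule add_mono)
    then have "int k * z + c \<ge> 2" by simp
    then show ?thesis by (simp add: clip_def)
  qed
  have **: "clip (int k * z + c) = -2" if "z \<le> -2" for z
  proof -
    have "int k * z \<le> int k * (-2)" using that by (intro mult_left_mono) auto
    moreover have "c \<le> 2 * (int k - 1)" using assms(2) by (simp add: abs_le_iff)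
    ultimately have "int k * z + c \<le> int k * (-2) + 2 * (int k - 1)" by (rule add_mono)
    then have "int k * z + c \<le> -2" by simp
    then show ?thesis by (simp add: clip_def)
  qed
  consider "x \<ge> 2" "y \<ge> 2" | "x \<le> -2" "y \<le> -2"
    using assms(1) False unfolding clip_def by linarith
  then show ?thesis using * ** by cases auto
qed simp

text \<open>One automaton with states -2, ..., 2 for all linear comparisons below; \<open>R\<close>
  may test the sign or equality with -1, 0 or 1, the values that clipping leaves exact.\<close>

lemma recog_lin:
  assumes R: "\<And>x y. clip x = clip y \<Longrightarrow> R x \<Longrightarrow> R y" and len: "length as \<le> 2" "length bs \<le> 2"
  shows "recog 5 (\<lambda>e. R (int (\<Sum>v\<leftarrow>as. e v) - int (\<Sum>v\<leftarrow>bs. e v)))"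
proof (rule recogI[where T = "\<lambda>e. clip (int (\<Sum>v\<leftarrow>as. e v) - int (\<Sum>v\<leftarrow>bs. e v))" and X = "{-2..2}"])
  fix e e' f :: "nat \<Rightarrow> nat" assume eq: "clip (int (\<Sum>v\<leftarrow>as. e v) - int (\<Sum>v\<leftarrow>bs. e v)) =
      clip (int (\<Sum>v\<leftarrow>as. e' v) - int (\<Sum>v\<leftarrow>bs. e' v))" and f: "\<And>v. f v < k"
  have *: "(\<Sum>v\<leftarrow>vs. k * e v + f v) = k * (\<Sum>v\<leftarrow>vs. e v) + (\<Sum>v\<leftarrow>vs. f v)" for e :: "nat \<Rightarrow> nat" and vs
    by (simp add: sum_list_addf sum_list_const_mult)
  have fk: "f v \<le> k - 1" for v using f[of v] by linarith
  have bd: "(\<Sum>v\<leftarrow>vs. f v) \<le> 2 * (k - 1)" if "length vs \<le> 2" for vs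
  proof -
    have "(\<Sum>v\<leftarrow>vs. f v) \<le> (\<Sum>v\<leftarrow>vs. k - 1)" by (intro sum_list_mono fk)
    also have "\<dots> = length vs * (k - 1)" by (simp add: sum_list_triv)
    also have "\<dots> \<le> 2 * (k - 1)" using that by (intro mult_right_mono) auto
    finally show ?thesis .
  qed
  have bd': "0 \<le> int (\<Sum>v\<leftarrow>vs. f v) \<and> int (\<Sum>v\<leftarrow>vs. f v) \<le> 2 * (int k - 1)" if "length vs \<le> 2" for vs
  proof -
    have "int (\<Sum>v\<leftarrow>vs. f v) \<le> int (2 * (k - 1))" using bd[OF that] by (simp only: of_nat_le_iff)
    also have "\<dots> = 2 * (int k - 1)" by (simp add: of_nat_diff)
    finally show ?thesis by simp
  qed
  have r: "int (\<Sum>v\<leftarrow>as. k * e v + f v) - int (\<Sum>v\<leftarrow>bs. k * e v + f v)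
      = int k * (int (\<Sum>v\<leftarrow>as. e v) - int (\<Sum>v\<leftarrow>bs. e v)) + (int (\<Sum>v\<leftarrow>as. f v) - int (\<Sum>v\<leftarrow>bs. f v))"
    for e :: "nat \<Rightarrow> nat" unfolding * of_nat_add of_nat_mult right_diff_distrib by linarith
  show "clip (int (\<Sum>v\<leftarrow>as. k * e v + f v) - int (\<Sum>v\<leftarrow>bs. k * e v + f v)) =
    clip (int (\<Sum>v\<leftarrow>as. k * e' v + f v) - int (\<Sum>v\<leftarrow>bs. k * e' v + f v))"
    unfolding r by (rule clip_step[OF eq], unfold abs_le_iff) (use bd'[OF len(1)] bd'[OF len(2)] in linarith)
next
  fix e e' :: "nat \<Rightarrow> nat" assume "clip (int (\<Sum>v\<leftarrow>as. e v) - int (\<Sum>v\<leftarrow>bs. e v)) =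
      clip (int (\<Sum>v\<leftarrow>as. e' v) - int (\<Sum>v\<leftarrow>bs. e' v))"
    "R (int (\<Sum>v\<leftarrow>as. e v) - int (\<Sum>v\<leftarrow>bs. e v))"
  then show "R (int (\<Sum>v\<leftarrow>as. e' v) - int (\<Sum>v\<leftarrow>bs. e' v))" by (rule R)
qed (auto simp: clip_def)

lemma recog_sum_eq: "recog 5 (\<lambda>e. e a + e b = e c + e d)"
proof -
  have *: "int a + int b - (int c + int d) = 0 \<longleftrightarrow> a + b = c + d" for a b c d
    by linarith
  have 1: "y = 0" if "clip x = clip y" "x = 0" for x y :: int
    using that by (cases "2 \<le> x"; cases "2 \<le> y"; cases "x \<le> -2"; cases "y \<le> -2"; simp add: clip_def)
  have "recog 5 (\<lambda>e. int (\<Sum>v\<leftarrow>[a, b]. e v) - int (\<Sum>v\<leftarrow>[c, d]. e v) = 0)"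
    by (rule recog_lin[of "\<lambda>x. x = 0" "[a, b]" "[c, d]"], rule 1, assumption, assumption, simp, simp)
  then show ?thesis by (simp only: list.map sum_list.Cons sum_list.Nil add_0_right of_nat_add *)
qed

lemma recog_add_eq: "recog 5 (\<lambda>e. e a + e b = e c)"
proof -
  have *: "int a + int b - int c = 0 \<longleftrightarrow> a + b = c" for a b c
    by linarith
  have 1: "y = 0" if "clip x = clip y" "x = 0" for x y :: int
    using that by (cases "2 \<le> x"; cases "2 \<le> y"; cases "x \<le> -2"; cases "y \<le> -2"; simp add: clip_def)
  have "recog 5 (\<lambda>e. int (\<Sum>v\<leftarrow>[a, b]. e v) - int (\<Sum>v\<leftarrow>[c]. e v) = 0)"
    by (rule recog_lin[of "\<lambda>x. x = 0" "[a, b]" "[c]"], rule 1, assumption, assumption, simp, simp)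
  then show ?thesis by (simp only: list.map sum_list.Cons sum_list.Nil add_0_right of_nat_add *)
qed

lemma recog_sum_eq_Suc: "recog 5 (\<lambda>e. e a + e b = Suc (e c + e d))"
proof -
  have *: "int a + int b - (int c + int d) = 1 \<longleftrightarrow> a + b = Suc (c + d)" for a b c d
    by linarith
  have 1: "y = 1" if "clip x = clip y" "x = 1" for x y :: int
    using that by (cases "2 \<le> x"; cases "2 \<le> y"; cases "x \<le> -2"; cases "y \<le> -2"; simp add: clip_def)
  have "recog 5 (\<lambda>e. int (\<Sum>v\<leftarrow>[a, b]. e v) - int (\<Sum>v\<leftarrow>[c, d]. e v) = 1)"
    by (rule recog_lin[of "\<lambda>x. x = 1" "[a, b]" "[c, d]"], rule 1, assumption, assumption, simp, simp)
  then show ?thesis by (simp only: list.map sum_list.Cons sum_list.Nil add_0_right of_nat_add *)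
qed

lemma recog_Suc_eq: "recog 5 (\<lambda>e. Suc (e a) = e b)"
proof -
  have *: "int a - int b = -1 \<longleftrightarrow> Suc (a) = b" for a b
    by linarith
  have 1: "y = -1" if "clip x = clip y" "x = -1" for x y :: int
    using that by (cases "2 \<le> x"; cases "2 \<le> y"; cases "x \<le> -2"; cases "y \<le> -2"; simp add: clip_def)
  have "recog 5 (\<lambda>e. int (\<Sum>v\<leftarrow>[a]. e v) - int (\<Sum>v\<leftarrow>[b]. e v) = -1)"
    by (rule recog_lin[of "\<lambda>x. x = -1" "[a]" "[b]"], rule 1, assumption, assumption, simp, simp)
  then show ?thesis by (simp only: list.map sum_list.Cons sum_list.Nil add_0_right of_nat_add *)
qed

lemma recog_sum_le: "recog 5 (\<lambda>e. e a + e b \<le> e c + e d)"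
proof -
  have *: "int a + int b - (int c + int d) \<le> 0 \<longleftrightarrow> a + b \<le> c + d" for a b c d
    by linarith
  have 1: "y \<le> 0" if "clip x = clip y" "x \<le> 0" for x y :: int
    using that by (cases "2 \<le> x"; cases "2 \<le> y"; cases "x \<le> -2"; cases "y \<le> -2"; simp add: clip_def)
  have "recog 5 (\<lambda>e. int (\<Sum>v\<leftarrow>[a, b]. e v) - int (\<Sum>v\<leftarrow>[c, d]. e v) \<le> 0)"
    by (rule recog_lin[of "\<lambda>x. x \<le> 0" "[a, b]" "[c, d]"], rule 1, assumption, assumption, simp, simp)
  then show ?thesis by (simp only: list.map sum_list.Cons sum_list.Nil add_0_right of_nat_add *)
qed

lemma recog_le: "recog 5 (\<lambda>e. e a \<le> e b)"
proof -
  have *: "int a - int b \<le> 0 \<longleftrightarrow> a \<le> b" for a b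
    by linarith
  have 1: "y \<le> 0" if "clip x = clip y" "x \<le> 0" for x y :: int
    using that by (cases "2 \<le> x"; cases "2 \<le> y"; cases "x \<le> -2"; cases "y \<le> -2"; simp add: clip_def)
  have "recog 5 (\<lambda>e. int (\<Sum>v\<leftarrow>[a]. e v) - int (\<Sum>v\<leftarrow>[b]. e v) \<le> 0)"
    by (rule recog_lin[of "\<lambda>x. x \<le> 0" "[a]" "[b]"], rule 1, assumption, assumption, simp, simp)
  then show ?thesis by (simp only: list.map sum_list.Cons sum_list.Nil add_0_right of_nat_add *)
qed

lemma recog_less: "recog 5 (\<lambda>e. e a < e b)"
proof -
  have *: "int a - int b < 0 \<longleftrightarrow> a < b" for a b
    by linarith
  have 1: "y < 0" if "clip x = clip y" "x < 0" for x y :: int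
    using that by (cases "2 \<le> x"; cases "2 \<le> y"; cases "x \<le> -2"; cases "y \<le> -2"; simp add: clip_def)
  have "recog 5 (\<lambda>e. int (\<Sum>v\<leftarrow>[a]. e v) - int (\<Sum>v\<leftarrow>[b]. e v) < 0)"
    by (rule recog_lin[of "\<lambda>x. x < 0" "[a]" "[b]"], rule 1, assumption, assumption, simp, simp)
  then show ?thesis by (simp only: list.map sum_list.Cons sum_list.Nil add_0_right of_nat_add *)
qed

lemma recog_eq0: "recog 5 (\<lambda>e. e a = 0)"
proof -
  have "recog 2 (\<lambda>e. e a = 0)"
    by (rule recogI[where T = "\<lambda>e. e a = 0" and X = UNIV]) simp_all
  then show ?thesis by (rule recog_mono) simp
qed

end

subsection \<open>Pumping in finitely many classes\<close>

text \<open>A shortest list in the class of \<open>xs\<close> has pairwise inequivalent prefixes,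
  since the part between two equivalent ones could be cut out.\<close>

lemma pump_prefix:
  fixes A :: "'d list \<Rightarrow> 'a"
  assumes cong: "\<And>xs ys us. A xs = A ys \<Longrightarrow> A (xs @ us) = A (ys @ us)"
    and fin: "finite (range A)" and xs: "xs \<in> lists D"
  obtains x' where "A x' = A xs" "x' \<in> lists D" "length x' < card (range A)"
proof -
  define Q where "Q l \<longleftrightarrow> (\<exists>x. A x = A xs \<and> x \<in> lists D \<and> length x = l)" for l
  have ex: "Q (length xs)" using xs unfolding Q_def by blast
  define l where "l = (LEAST l. Q l)"
  have "Q l" unfolding l_def by (rule LeastI[of Q, OF ex])
  then obtain x where x: "A x = A xs" "x \<in> lists D" "length x = l" unfolding Q_def by blast
  have "l < card (range A)"
  proof (rule ccontr)
    assume "\<not> l < card (range A)"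
    then have "card (range A) < card {0..l}" by simp
    then obtain i j where ij: "i \<in> {0..l}" "j \<in> {0..l}" "i < j" "A (take i x) = A (take j x)"
      using pigeonhole_seq[OF fin, of "{0..l}" "\<lambda>i. A (take i x)"] by blast
    let ?y = "take i x @ drop j x"
    have "A ?y = A (take j x @ drop j x)" by (rule cong[OF ij(4)])
    then have "A ?y = A xs" using x by simp
    moreover have "?y \<in> lists D" using x(2) by (auto dest: in_set_takeD in_set_dropD)
    moreover have "length ?y < l" using ij x(3) by auto
    ultimately show False using not_less_Least[of "length ?y" Q] unfolding l_def Q_def by blast
  qed
  then show thesis using that x by blast
qed

text \<open>The dual of \<open>pump_prefix\<close>, with the length modulo \<open>P\<close> added to
  the class: the length of the suffix will be a level, whose residue must survive the
  shortening.\<close>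

lemma pump_suffix:
  fixes B :: "'d list \<Rightarrow> 'b"
  assumes cong: "\<And>xs ys us. B xs = B ys \<Longrightarrow> B (us @ xs) = B (us @ ys)"
    and fin: "finite (range B)" and xs: "xs \<in> lists D" and P: "0 < P"
  obtains x' where "B x' = B xs" "x' \<in> lists D" "length x' < card (range B) * P"
    "length x' mod P = length xs mod P"
proof -
  define Q where "Q l \<longleftrightarrow> (\<exists>x. B x = B xs \<and> x \<in> lists D \<and> length x mod P = length xs mod P \<and> length x = l)" for l
  have ex: "Q (length xs)" using xs unfolding Q_def by blast
  define l where "l = (LEAST l. Q l)"
  have "Q l" unfolding l_def by (rule LeastI[of Q, OF ex])
  then obtain x where x: "B x = B xs" "x \<in> lists D" "length x mod P = length xs mod P" "length x = l"
    unfolding Q_def by blast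
  have "l < card (range B) * P"
  proof (rule ccontr)
    assume "\<not> l < card (range B) * P"
    then have "card (range B \<times> {..<P}) < card {0..l}" by (simp add: card_cartesian_product)
    then obtain i j where ij: "i \<in> {0..l}" "j \<in> {0..l}" "i < j"
      "(B (drop i x), (l - i) mod P) = (B (drop j x), (l - j) mod P)"
      using pigeonhole_seq[of "range B \<times> {..<P}" "{0..l}" "\<lambda>i. (B (drop i x), (l - i) mod P)"] fin P
      by (auto simp del: Pair_inject)
    let ?y = "take i x @ drop j x"
    have "B ?y = B (take i x @ drop i x)" by (rule cong) (use ij in simp)
    then have "B ?y = B xs" using x by simp
    moreover have "?y \<in> lists D" using x(2) by (auto dest: in_set_takeD in_set_dropD)
    moreover have "length ?y mod P = length xs mod P"
    proof -
      have "length ?y = i + (l - j)" using ij x(4) by auto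
      moreover have "(i + (l - j)) mod P = (i + (l - i)) mod P" using ij(4) by (metis mod_add_right_eq Pair_inject)
      moreover have "i + (l - i) = length x" using ij x(4) by auto
      ultimately show ?thesis using x(3) by simp
    qed
    moreover have "length ?y < l" using ij x(4) by auto
    ultimately show False using not_less_Least[of "length ?y" Q] unfolding l_def Q_def by blast
  qed
  then show thesis using that x by blast
qed

text \<open>A cut inside the loop is described by the classes of what stands to its left and to its
  right. Cuts start at 1, so that the shortened loop is not empty.\<close>

lemma pump_infix:
  fixes A :: "'d list \<Rightarrow> 'a" and B :: "'d list \<Rightarrow> 'b"
  assumes congA: "\<And>xs ys us. A xs = A ys \<Longrightarrow> A (xs @ us) = A (ys @ us)"
    and congB: "\<And>xs ys us. B xs = B ys \<Longrightarrow> B (us @ xs) = B (us @ ys)"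
    and finA: "finite (range A)" and finB: "finite (range B)"
    and u: "u \<in> lists D" "u \<noteq> []" "A (x @ u) = A x" "B (u @ v) = B v"
  obtains u' where "u' \<in> lists D" "u' \<noteq> []" "A (x @ u') = A x" "B (u' @ v) = B v"
    "length u' \<le> card (range A) * card (range B)"
proof -
  define Q where "Q l \<longleftrightarrow> (\<exists>u \<in> lists D. u \<noteq> [] \<and> A (x @ u) = A x \<and> B (u @ v) = B v \<and> length u = l)" for l
  have ex: "Q (length u)" using u unfolding Q_def by blast
  define l where "l = (LEAST l. Q l)"
  have "Q l" unfolding l_def by (rule LeastI[of Q, OF ex])
  then obtain y where y: "y \<in> lists D" "y \<noteq> []" "A (x @ y) = A x" "B (y @ v) = B v" "length y = l"
    unfolding Q_def by blast
  have "l \<le> card (range A) * card (range B)"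
  proof (rule ccontr)
    assume "\<not> l \<le> card (range A) * card (range B)"
    then have "card (range A \<times> range B) < card {1..l}" by (simp add: card_cartesian_product)
    then obtain i j where ij: "i \<in> {1..l}" "j \<in> {1..l}" "i < j"
      "(A (x @ take i y), B (drop i y @ v)) = (A (x @ take j y), B (drop j y @ v))"
      using pigeonhole_seq[of "range A \<times> range B" "{1..l}" "\<lambda>i. (A (x @ take i y), B (drop i y @ v))"] finA finB
      by (auto simp del: Pair_inject)
    let ?y = "take i y @ drop j y"
    have "A ((x @ take i y) @ drop j y) = A ((x @ take j y) @ drop j y)" by (rule congA) (use ij in simp)
    then have "A (x @ ?y) = A x" using y by simp
    moreover have "B (take i y @ (drop j y @ v)) = B (take i y @ (drop i y @ v))" by (rule congB) (use ij in simp)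
    then have "B (?y @ v) = B v" using y by (metis append_assoc append_take_drop_id)
    moreover have "?y \<in> lists D" using y(1) by (auto dest: in_set_takeD in_set_dropD)
    moreover have "?y \<noteq> []" using ij y(2) by auto
    moreover have "length ?y < l" using ij y(5) by auto
    ultimately show False using not_less_Least[of "length ?y" Q] unfolding l_def Q_def by blast
  qed
  then show thesis using that y by blast
qed

text \<open>The elements of \<open>J\<close> are cuts of \<open>z\<close>, measured from its right
  end. Two cuts with equal pairs of classes enclose a loop. All three parts are shortened, so that
  their lengths are bounded independently of \<open>z\<close>; the explicit bound on the attractor
  rests on this.\<close>

lemma pump_factorization:
  fixes A :: "'d list \<Rightarrow> 'a" and B :: "'d list \<Rightarrow> 'b"
  assumes congA: "\<And>xs ys us. A xs = A ys \<Longrightarrow> A (xs @ us) = A (ys @ us)"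
    and congB: "\<And>xs ys us. B xs = B ys \<Longrightarrow> B (us @ xs) = B (us @ ys)"
    and finA: "finite (range A)" and finB: "finite (range B)" and P: "0 < P"
    and z: "z \<in> lists D" and J: "J \<subseteq> {..length z}" "card (range A) * card (range B) < card J"
    and S: "\<And>j. j \<in> J \<Longrightarrow> S (A (take (length z - j) z)) (B (drop (length z - j) z)) \<and> j mod P = \<rho>"
  obtains x u v where "x \<in> lists D" "u \<in> lists D" "v \<in> lists D" "u \<noteq> []"
    "A (x @ u) = A x" "B (u @ v) = B v" "S (A x) (B v)" "length v mod P = \<rho>"
    "length x < card (range A)" "length u \<le> card (range A) * card (range B)" "length v < card (range B) * P"
proof -
  let ?f = "\<lambda>j. (A (take (length z - j) z), B (drop (length z - j) z))"
  have "card (range A \<times> range B) < card J" using J by (simp add: card_cartesian_product)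
  then obtain i j where ij: "i \<in> J" "j \<in> J" "i < j" "?f i = ?f j"
    using pigeonhole_seq[of "range A \<times> range B" J ?f] finA finB by (auto simp del: Pair_inject)
  let ?x = "take (length z - j) z" and ?v = "drop (length z - i) z"
  let ?u = "drop (length z - j) (take (length z - i) z)"
  have le: "i \<le> length z" "j \<le> length z" using ij J by auto
  have xu: "?x @ ?u = take (length z - i) z"
    using append_take_drop_id[of "length z - j" "take (length z - i) z"] ij le by simp
  have uv: "?u @ ?v = drop (length z - j) z"
    using drop_append[of "length z - j" "take (length z - i) z" "drop (length z - i) z"] ij le by simp
  have lists: "?x \<in> lists D" "?u \<in> lists D" "?v \<in> lists D" using z by (auto dest: in_set_takeD in_set_dropD)
  have une: "?u \<noteq> []" using ij le by simp
  have Au: "A (?x @ ?u) = A ?x" "B (?u @ ?v) = B ?v" unfolding xu uv using ij(4) by simp_all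
  have Sx: "S (A ?x) (B ?v)" "length ?v mod P = \<rho>" using S[OF ij(1)] ij(4) le by auto
  obtain x where x: "A x = A ?x" "x \<in> lists D" "length x < card (range A)"
    using pump_prefix[OF congA finA lists(1)] by blast
  obtain v where v: "B v = B ?v" "v \<in> lists D" "length v < card (range B) * P" "length v mod P = length ?v mod P"
    using pump_suffix[OF congB finB lists(3) P] by blast
  have Axu: "A (x @ ?u) = A x" using congA[OF x(1), of ?u] Au x by simp
  have Buv: "B (?u @ v) = B v" using congB[OF v(1), of ?u] Au v by simp
  \<comment> \<open>The loop is shortened last, relative to the new \<open>x\<close> and
    \<open>v\<close>, which still admit the old loop.\<close>
  obtain u where u: "u \<in> lists D" "u \<noteq> []" "A (x @ u) = A x" "B (u @ v) = B v"
    "length u \<le> card (range A) * card (range B)"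
    using pump_infix[OF congA congB finA finB lists(2) une Axu Buv] by blast
  show thesis by (rule that[OF x(2) u(1) v(2) u(2,3,4)]) (use x v u Sx in simp_all)
qed

lemma pump_iterate:
  assumes congA: "\<And>xs ys us. A xs = A ys \<Longrightarrow> A (xs @ us) = A (ys @ us)"
    and congB: "\<And>xs ys us. B xs = B ys \<Longrightarrow> B (us @ xs) = B (us @ ys)"
    and "A (x @ u) = A x" "B (u @ v) = B v"
  shows "A (x @ concat (replicate n u)) = A x" "B (concat (replicate n u) @ v) = B v"
proof -
  show "A (x @ concat (replicate n u)) = A x"
  proof (induction n)
    case (Suc n)
    have "A ((x @ u) @ concat (replicate n u)) = A (x @ concat (replicate n u))" by (rule congA) (rule assms)
    then show ?case using Suc by simp
  qed simp
  show "B (concat (replicate n u) @ v) = B v"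
  proof (induction n)
    case (Suc n)
    have "B (u @ (concat (replicate n u) @ v)) = B (u @ v)" by (rule congB) (rule Suc)
    then show ?case using assms(4) by simp
  qed simp
qed

section \<open>Small representatives and values of digit lists\<close>

context radix begin

text \<open>Two of the numbers \<open>n div k ^ i\<close> with \<open>i \<le> N\<close> have the
  same class, and deleting the digits between them gives a smaller number in the class of
  \<open>n\<close>. That the representative does not exceed \<open>n\<close> keeps relocated
  occurrences inside the prefix.\<close>

lemma finite_rep:
  fixes t :: "nat \<Rightarrow> 'a"
  assumes cong: "\<And>x y d. t x = t y \<Longrightarrow> d < k \<Longrightarrow> t (k * x + d) = t (k * y + d)"
    and fin: "finite X" "\<And>n. t n \<in> X" "card X \<le> N"
  shows "\<exists>m < k ^ N. m \<le> n \<and> t m = t n"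
proof -
  have step: "t (x * k ^ m + v) = t (y * k ^ m + v)" if "t x = t y" "v < k ^ m" for x y m v
    using that(2)
  proof (induction m arbitrary: v)
    case 0 then show ?case using that by simp
  next
    case (Suc m)
    have "v div k < k ^ m" using Suc.prems by (simp add: less_mult_imp_div_less mult.commute)
    then have "t (x * k ^ m + v div k) = t (y * k ^ m + v div k)" by (rule Suc.IH)
    then have "t (k * (x * k ^ m + v div k) + v mod k) = t (k * (y * k ^ m + v div k) + v mod k)"
      by (rule cong) simp
    moreover have "k * (z * k ^ m + v div k) + v mod k = z * k ^ Suc m + v" for z
      by (simp add: algebra_simps)
    ultimately show ?case by simp
  qed
  show ?thesis
  proof (induction n rule: less_induct)
    case (less n)
    show ?case
    proof (cases "n < k ^ N")
      case False
      have "card X < card {0..N}" using fin by simp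
      then obtain i j where ij: "i \<in> {0..N}" "j \<in> {0..N}" "i < j" "t (n div k ^ i) = t (n div k ^ j)"
        using pigeonhole_seq[of X "{0..N}" "\<lambda>i. t (n div k ^ i)"] fin by blast
      define m where "m = (n div k ^ j) * k ^ i + n mod k ^ i"
      have "t m = t ((n div k ^ i) * k ^ i + n mod k ^ i)"
        unfolding m_def by (rule step) (use ij in simp_all)
      then have tm: "t m = t n" unfolding div_mult_mod_eq .
      have "k ^ i \<le> n" using False ij
        by (metis atLeastAtMost_iff kpow_le_iff le_trans linorder_not_less)
      have "n div k ^ j < n div k ^ i"
      proof -
        have "n div k ^ j = n div k ^ i div k ^ (j - i)"
          using ij by (metis div_mult2_eq le_add_diff_inverse less_imp_le power_add)
        moreover have "0 < n div k ^ i" using \<open>k ^ i \<le> n\<close> by (simp add: div_greater_zero_iff)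
        moreover have "1 < k ^ (j - i)" using ij by (intro one_less_power) auto
        ultimately show ?thesis by simp
      qed
      then have "m < (n div k ^ i) * k ^ i + n mod k ^ i" unfolding m_def by simp
      then have "m < n" unfolding div_mult_mod_eq .
      then show ?thesis using less[of m] tm by fastforce
    qed auto
  qed
qed

definition kval :: "nat list \<Rightarrow> nat" where "kval ds = foldl (\<lambda>x d. k * x + d) 0 ds"

lemma kval_Nil[simp]: "kval [] = 0" by (simp add: kval_def)
lemma kval_snoc[simp]: "kval (ds @ [d]) = k * kval ds + d" by (simp add: kval_def)

lemma kval_append: "kval (xs @ ys) = kval xs * k ^ length ys + kval ys"
proof (induction ys rule: rev_induct)
  case (snoc y ys)
  have "kval (xs @ ys @ [y]) = k * kval (xs @ ys) + y" using kval_snoc[of "xs @ ys" y] by simp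
  then show ?case using snoc by (simp add: algebra_simps)
qed simp

lemma kval_less: "ds \<in> lists {..<k} \<Longrightarrow> kval ds < k ^ length ds"
proof (induction ds rule: rev_induct)
  case (snoc d ds)
  then have "kval ds * k ^ 1 + d < k ^ (length ds + 1)" by (intro mult_add_less_pow) auto
  then show ?case by (simp add: mult.commute)
qed simp

lemma kval_surj:
  assumes "n < k ^ l" obtains ds where "ds \<in> lists {..<k}" "length ds = l" "kval ds = n"
  using assms
proof (induction l arbitrary: n thesis)
  case 0 then show ?case by simp
next
  case (Suc l)
  have "n div k < k ^ l" using Suc.prems by (simp add: less_mult_imp_div_less mult.commute)
  then obtain ds where "ds \<in> lists {..<k}" "length ds = l" "kval ds = n div k" using Suc.IH by blast
  then show ?case using Suc.prems(1)[of "ds @ [n mod k]"] by simp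
qed

end

subsection \<open>Growth of attractors of automatic words\<close>

text \<open>The occurrence need not end inside a prefix: a weaker notion of service is harmless for
  lower bounds, and it does not depend on \<open>n\<close>.\<close>

definition cov :: "(nat \<Rightarrow> 'a) \<Rightarrow> nat \<Rightarrow> nat \<Rightarrow> nat \<Rightarrow> bool" where
  "cov w p i e \<longleftrightarrow> (\<exists>q \<le> p. p \<le> q + (e - i) \<and> occ w i e q)"

definition log_growth :: "(nat \<Rightarrow> 'a) \<Rightarrow> bool" where
  "log_growth w \<longleftrightarrow> (\<exists>c > 0. \<exists>n0. \<forall>n \<ge> n0. c * ln (real n) \<le> real (gamma w n))"

context radix begin

text \<open>Double counting: each of the \<open>M\<close> factors needs a position of the attractor,
  and one position serves at most \<open>h\<close> of them.\<close>

lemma tasks_le_gamma: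
  assumes "\<And>m. m < M \<Longrightarrow> i m \<le> e m \<and> e m < n"
    and fin: "\<And>p. finite {m. cov w p (i m) (e m)}" and h: "\<And>p. card {m. cov w p (i m) (e m)} \<le> h"
  shows "M \<le> h * gamma w n"
proof -
  obtain S where S: "attr w n S" "card S = gamma w n" using gamma_attained by blast
  have finS: "finite S" using S(1) by (rule attr_finite)
  have "{..<M} \<subseteq> (\<Union>p\<in>S. {m. cov w p (i m) (e m)})"
  proof
    fix m assume "m \<in> {..<M}"
    then have "i m \<le> e m" "e m < n" using assms(1) by auto
    then show "m \<in> (\<Union>p\<in>S. {m. cov w p (i m) (e m)})"
      using S(1) unfolding attr_def cov_def by blast
  qed
  then have "card {..<M} \<le> card (\<Union>p\<in>S. {m. cov w p (i m) (e m)})"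
    using finS fin by (intro card_mono) auto
  also have "\<dots> \<le> (\<Sum>p\<in>S. card {m. cov w p (i m) (e m)})" by (rule card_UN_le[OF finS])
  also have "\<dots> \<le> (\<Sum>p\<in>S. h)" by (intro sum_mono h)
  finally show ?thesis using S(2) by (simp add: mult.commute)
qed

text \<open>About \<open>log n / B\<close> of the tasks, with the logarithm to base
  \<open>k\<close>, end inside a prefix of length \<open>n\<close>.\<close>

lemma log_growth_tasks:
  fixes i e :: "nat \<Rightarrow> nat"
  assumes task: "\<And>m. i m \<le> e m" "\<And>m. e m < k ^ (A + B * m)" and B: "0 < B" and h: "0 < h"
    and fin: "\<And>p. finite {m. cov w p (i m) (e m)}" and card: "\<And>p. card {m. cov w p (i m) (e m)} \<le> h"
  shows "log_growth w"
proof -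
  define D where "D = A + B + 1"
  define c where "c = 1 / (2 * real B * real h * ln (real k))"
  have lnk: "0 < ln (real k)" using k2 by simp
  \<comment> \<open>The threshold \<open>2 * D\<close> makes the additive loss
    \<open>D * ln k\<close> at most half of \<open>ln n\<close>; hence the factor 2 in
    \<open>c\<close>.\<close>
  have "c * ln (real n) \<le> real (gamma w n)" if n: "k ^ (2 * D) \<le> n" for n
  proof -
    have n0: "0 < n" using n kpow_pos[of "2 * D"] by linarith
    obtain J where J: "k ^ J \<le> n" "n < k ^ Suc J" using klog[OF n0] by blast
    have "k ^ (2 * D) < k ^ Suc J" using n J(2) by (rule le_less_trans)
    then have JD: "2 * D \<le> J" unfolding kpow_less_iff by simp
    define M where "M = (J - A) div B"
    have "M \<le> h * gamma w n"
    proof (rule tasks_le_gamma[OF _ fin card])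
      fix m assume "m < M"
      then have "B * m \<le> J - A" unfolding M_def
        by (metis div_le_dividend le_trans less_imp_le mult.commute mult_le_mono1 div_times_less_eq_dividend)
      then have "A + B * m \<le> J" using JD unfolding D_def by (simp add: le_diff_conv2)
      then have "k ^ (A + B * m) \<le> n" using J(1) by (meson kpow_le_iff le_trans)
      then show "i m \<le> e m \<and> e m < n" using task by (meson less_le_trans)
    qed
    then have Mg: "real M \<le> real h * real (gamma w n)" by (metis of_nat_le_iff of_nat_mult)
    have "J - A < B * (M + 1)" unfolding M_def using B
      by (metis Suc_eq_plus1 dividend_less_times_div mult_Suc_right)
    then have "J < B * M + (A + B)" by (simp add: algebra_simps)
    then have "real J < real B * real M + real (A + B)"
      unfolding of_nat_less_iff[where 'a = real, symmetric] by simp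
    moreover have "ln (real n) < real (Suc J) * ln (real k)"
    proof -
      have "real n < real k ^ Suc J" using J(2) by (metis of_nat_less_iff of_nat_power)
      then have "ln (real n) < ln (real k ^ Suc J)" using n0 by (subst ln_less_cancel_iff) auto
      then show ?thesis using ln_realpow[of "real k" "Suc J"] k2 by (simp del: power_Suc of_nat_Suc)
    qed
    moreover have "real (2 * D) * ln (real k) \<le> ln (real n)"
    proof -
      have "real k ^ (2 * D) \<le> real n" using n by (metis of_nat_le_iff of_nat_power)
      then have "ln (real k ^ (2 * D)) \<le> ln (real n)" using k2 n0 by (subst ln_le_cancel_iff) auto
      then show ?thesis using ln_realpow[of "real k" "2 * D"] k2 by (simp del: power_Suc)
    qed
    ultimately have L: "real (Suc J) \<le> real B * real M + real D" "ln (real n) \<le> real (Suc J) * ln (real k)"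
        "real (2 * D) * ln (real k) \<le> ln (real n)"
      unfolding D_def by auto
    have "ln (real n) \<le> (real B * real M + real D) * ln (real k)"
      using L(1,2) lnk by (meson mult_right_mono less_imp_le order_trans)
    then have "ln (real n) \<le> 2 * (real B * real M * ln (real k))" using L(3) by (simp add: algebra_simps)
    also have "\<dots> \<le> 2 * (real B * (real h * real (gamma w n)) * ln (real k))"
      using Mg lnk B by (intro mult_left_mono mult_right_mono) auto
    finally show ?thesis unfolding c_def using lnk B h by (simp add: field_simps)
  qed
  moreover have "0 < c" unfolding c_def using lnk B h by simp
  ultimately show ?thesis unfolding log_growth_def by blast
qed

end

text \<open>A digitwise congruence on numbers replaces the automaton, so that neither an initial
  state nor leading zeros have to be considered.\<close>

locale autword = radix k for k :: nat +
  fixes st :: "nat \<Rightarrow> nat" and s :: nat and w :: "nat \<Rightarrow> nat"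
  assumes st_less: "st n < s"
    and st_cong: "st m = st n \<Longrightarrow> d < k \<Longrightarrow> st (k * m + d) = st (k * n + d)"
    and w_st: "st m = st n \<Longrightarrow> w m = w n"
begin

lemma st_block:
  assumes "st m = st n" "v < k ^ j" shows "st (m * k ^ j + v) = st (n * k ^ j + v)"
  using assms(2)
proof (induction j arbitrary: v)
  case 0 then show ?case using assms by simp
next
  case (Suc j)
  have "v div k < k ^ j" using Suc.prems by (simp add: less_mult_imp_div_less mult.commute)
  then have "st (k * (m * k ^ j + v div k) + v mod k) = st (k * (n * k ^ j + v div k) + v mod k)"
    by (intro st_cong Suc.IH) auto
  moreover have "k * (z * k ^ j + v div k) + v mod k = z * k ^ Suc j + v" for z
    by (simp add: algebra_simps)
  ultimately show ?case by simp
qed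

lemma w_block: "st m = st n \<Longrightarrow> v < k ^ j \<Longrightarrow> w (m * k ^ j + v) = w (n * k ^ j + v)"
  by (intro w_st st_block)

lemma recog_w_eq: "recog (s * s) (\<lambda>e. w (e a) = w (e b))"
proof (rule recogI[where T = "\<lambda>e. (st (e a), st (e b))" and X = "{..<s} \<times> {..<s}"])
  fix e e' :: "nat \<Rightarrow> nat" assume "(st (e a), st (e b)) = (st (e' a), st (e' b))" "w (e a) = w (e b)"
  then show "w (e' a) = w (e' b)" using w_st[of "e a" "e' a"] w_st[of "e b" "e' b"] by simp
next
  fix e e' d :: "nat \<Rightarrow> nat" assume "(st (e a), st (e b)) = (st (e' a), st (e' b))" "\<And>v. d v < k"
  then show "(st (k * e a + d a), st (k * e b + d b)) = (st (k * e' a + d a), st (k * e' b + d b))"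
    using st_cong[of "e a" "e' a" "d a"] st_cong[of "e b" "e' b" "d b"] by simp
qed (simp_all add: st_less card_cartesian_product)

text \<open>A window of length \<open>k ^ j + 1\<close> meets at most two adjacent blocks of length
  \<open>k ^ j\<close>; its content is determined by their states and its offset. The pair of states
  at \<open>m\<close> and \<open>Suc m\<close> is again a digitwise congruence, with at most
  \<open>s * s\<close> classes.\<close>

lemma appear:
  obtains i' where "i' \<le> i" "i' < k ^ (s * s + j)" "\<And>u. u \<le> k ^ j \<Longrightarrow> w (i' + u) = w (i + u)"
proof -
  have "\<exists>m < k ^ (s * s). m \<le> i div k ^ j \<and> (st m, st (Suc m)) = (st (i div k ^ j), st (Suc (i div k ^ j)))"
  proof (rule finite_rep[where t = "\<lambda>m. (st m, st (Suc m))" and X = "{..<s} \<times> {..<s}"])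
    fix x y d assume eq: "(st x, st (Suc x)) = (st y, st (Suc y))" and d: "d < k"
    have "st (Suc (k * x + d)) = st (Suc (k * y + d))"
    \<comment> \<open>On the last digit the successor carries: \<open>Suc x\<close> is then
      continued with the digit 0.\<close>
    proof (cases "Suc d < k")
      case True then show ?thesis using st_cong[of x y "Suc d"] eq by simp
    next
      case False
      then have "Suc d = k" using d by simp
      then have *: "Suc (k * z + d) = k * Suc z + 0" for z by simp
      show ?thesis unfolding * by (rule st_cong) (use eq in simp_all)
    qed
    then show "(st (k * x + d), st (Suc (k * x + d))) = (st (k * y + d), st (Suc (k * y + d)))"
      using eq st_cong[of x y d] d by simp
  qed (simp_all add: st_less card_cartesian_product)
  then obtain m where m: "m < k ^ (s * s)" "m \<le> i div k ^ j" "st m = st (i div k ^ j)" "st (Suc m) = st (Suc (i div k ^ j))"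
    by auto
  define r where "r = i mod k ^ j"
  have r: "r < k ^ j" by (simp add: r_def)
  have i: "i = (i div k ^ j) * k ^ j + r" unfolding r_def by (rule div_mult_mod_eq[symmetric])
  show thesis
  proof (rule that[of "m * k ^ j + r"])
    have "m * k ^ j \<le> (i div k ^ j) * k ^ j" using m by (intro mult_right_mono) auto
    then show "m * k ^ j + r \<le> i" using i by linarith
    show "m * k ^ j + r < k ^ (s * s + j)" using m r by (intro mult_add_less_pow)
    fix u assume u: "u \<le> k ^ j"
    show "w (m * k ^ j + r + u) = w (i + u)"
    proof (cases "r + u < k ^ j")
      case True
      then show ?thesis using w_block[OF m(3) True] i by (metis add.assoc)
    next
      case False
      then obtain v where v: "r + u = k ^ j + v" using le_Suc_ex linorder_not_less by blast
      then have "v < k ^ j" using r u by linarith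
      have "z * k ^ j + r + u = Suc z * k ^ j + v" for z using v by simp
      then show ?thesis using w_block[OF m(4) \<open>v < k ^ j\<close>] i by metis
    qed
  qed
qed

text \<open>A factor is assigned to the largest \<open>j\<close> for which it contains a multiple of
  \<open>k ^ j\<close>. Containing no multiple of \<open>k ^ Suc j\<close>, it lies in one block of
  that length and can be moved to the chosen full block with the same state, where the multiples of
  \<open>k ^ j\<close> are marked.\<close>

lemma gamma_log_upper:
  assumes n: "0 < n" "n \<le> k ^ J" shows "gamma w n \<le> 1 + J * ((s + 1) * k)"
proof -
  define rep where "rep j q = (SOME m. st m = q \<and> (m + 1) * k ^ Suc j \<le> n)" for j q
  \<comment> \<open>Besides a full block for each state, the last block, which may be incomplete, is
    marked in place.\<close>
  define M where "M j = insert (n div k ^ Suc j) (rep j ` {..<s})" for j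
  define S where "S = ({0} \<union> (\<Union>j<J. (\<lambda>(m, t). m * k ^ Suc j + t * k ^ j) ` (M j \<times> {..<k}))) \<inter> {..<n}"
  have cM: "card (M j) \<le> s + 1" for j
    unfolding M_def using card_image_le[of "{..<s}" "rep j"] by (simp add: card_insert_if)
  have fM: "finite (M j)" for j by (simp add: M_def)
  have "attr w n S"
    unfolding attr_def
  proof (intro conjI allI impI)
    show "S \<subseteq> {..<n}" by (auto simp: S_def)
    fix i e assume ie: "i \<le> e" "e < n"
    show "\<exists>q p. p \<in> S \<and> q \<le> p \<and> p \<le> q + (e - i) \<and> q + (e - i) < n \<and> occ w i e q"
    \<comment> \<open>The position 0 is a multiple of every power, so there is no largest
      \<open>j\<close>; factors starting there are served by the mark 0.\<close>
    proof (cases "i = 0")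
      case True
      then show ?thesis using ie n by (intro exI[of _ 0]) (simp add: S_def occ_def)
    next
      case False
      define Q where "Q j \<longleftrightarrow> (\<exists>y. i \<le> y * k ^ j \<and> y * k ^ j \<le> e)" for j
      have Qb: "k ^ j \<le> e" if "Q j" for j
      proof -
        obtain y where "i \<le> y * k ^ j" "y * k ^ j \<le> e" using \<open>Q j\<close> unfolding Q_def by blast
        then show ?thesis using False by (cases y) auto
      qed
      then have Qle: "j \<le> e" if "Q j" for j using less_kpow[of j] Qb[OF that] by linarith
      have Q0: "Q 0" unfolding Q_def using ie by (intro exI[of _ i]) simp
      define j where "j = (GREATEST j. Q j)"
      have Qj: "Q j" unfolding j_def using GreatestI_nat[of Q 0 e] Q0 Qle by blast
      have nQ: "\<not> Q (Suc j)" unfolding j_def using Greatest_le_nat[of Q _ e] Qle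
        by (metis not_less_eq_eq order_refl)
      obtain y where y: "i \<le> y * k ^ j" "y * k ^ j \<le> e" using Qj unfolding Q_def by blast
      define m where "m = y div k"
      define t where "t = y mod k"
      define K where "K = k ^ Suc j"
      have t: "t < k" by (simp add: t_def)
      have "y = m * k + t" by (simp add: m_def t_def)
      then have yK: "y * k ^ j = m * K + t * k ^ j" by (simp add: K_def algebra_simps)
      have "t * k ^ j < K" using t by (simp add: K_def)
      have mi: "m * K < i"
      proof (rule ccontr)
        assume "\<not> m * K < i"
        then have "i \<le> m * K" "m * K \<le> e" using yK y by linarith+
        then show False using nQ unfolding Q_def K_def by blast
      qed
      have em: "e < (m + 1) * K"
      proof (rule ccontr)
        assume "\<not> e < (m + 1) * K"
        then have "i \<le> (m + 1) * K" "(m + 1) * K \<le> e" using yK y \<open>t * k ^ j < K\<close> by (auto simp: algebra_simps)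
        then show False using nQ unfolding Q_def K_def by blast
      qed
      have "k ^ j < k ^ J" using Qb[OF Qj] ie n by linarith
      then have jJ: "j < J" by simp
      have inS: "m' * K + t * k ^ j \<in> S" if "m' \<in> M j" "m' * K + t * k ^ j < n" for m'
        unfolding S_def using that jJ t K_def by auto
      show ?thesis
      proof (cases "(m + 1) * K \<le> n")
        case True
        define m' where "m' = rep j (st m)"
        have "st m' = st m \<and> (m' + 1) * k ^ Suc j \<le> n"
          unfolding m'_def rep_def by (rule someI[of _ m]) (use True K_def in simp)
        then have m': "st m' = st m" "(m' + 1) * K \<le> n" unfolding K_def by auto
        have "m' \<in> M j" unfolding M_def m'_def using st_less by simp
        define q where "q = m' * K + (i - m * K)"
        have "occ w i e q" unfolding occ_def
        proof (intro allI impI)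
          fix u assume u: "u \<le> e - i"
          then have "i - m * K + u < K" using mi em ie by (simp add: algebra_simps)
          then have "w (m' * K + (i - m * K + u)) = w (m * K + (i - m * K + u))"
            unfolding K_def by (intro w_block m')
          then show "w (q + u) = w (i + u)" unfolding q_def using mi by (simp add: add.assoc)
        qed
        moreover have "q + (e - i) < n" unfolding q_def using m'(2) mi em ie by (simp add: algebra_simps)
        moreover have "q \<le> m' * K + t * k ^ j" "m' * K + t * k ^ j \<le> q + (e - i)"
          unfolding q_def using y yK mi ie by linarith+
        ultimately show ?thesis using inS[OF \<open>m' \<in> M j\<close>]
          by (intro exI[of _ q] exI[of _ "m' * K + t * k ^ j"]) auto
      next
        case False
        have "n div K = m" using False mi ie
          by (intro div_nat_eqI) (auto simp: algebra_simps)
        then have "m \<in> M j" unfolding M_def K_def by simp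
        then have "y * k ^ j \<in> S" using inS[of m] y ie yK by simp
        then show ?thesis using y ie by (intro exI[of _ i] exI[of _ "y * k ^ j"]) (auto simp: occ_def)
      qed
    qed
  qed
  then have "gamma w n \<le> card S" by (rule gamma_le_card)
  also have "card S \<le> card ({0} \<union> (\<Union>j<J. (\<lambda>(m, t). m * k ^ Suc j + t * k ^ j) ` (M j \<times> {..<k})))"
    unfolding S_def by (intro card_mono) (use fM in auto)
  also have "\<dots> \<le> card {0::nat} + card (\<Union>j<J. (\<lambda>(m, t). m * k ^ Suc j + t * k ^ j) ` (M j \<times> {..<k}))"
    by (rule card_Un_le)
  also have "card (\<Union>j<J. (\<lambda>(m, t). m * k ^ Suc j + t * k ^ j) ` (M j \<times> {..<k}))
     \<le> (\<Sum>j<J. card ((\<lambda>(m, t). m * k ^ Suc j + t * k ^ j) ` (M j \<times> {..<k})))"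
    by (rule card_UN_le) simp
  also have "\<dots> \<le> (\<Sum>j<J. (s + 1) * k)"
  proof (rule sum_mono)
    fix j
    have "card ((\<lambda>(m, t). m * k ^ Suc j + t * k ^ j) ` (M j \<times> {..<k})) \<le> card (M j \<times> {..<k})"
      by (rule card_image_le) (use fM in simp)
    also have "\<dots> \<le> (s + 1) * k" using cM[of j] by (simp only: card_cartesian_product card_lessThan) (intro mult_right_mono, auto)
    finally show "card ((\<lambda>(m, t). m * k ^ Suc j + t * k ^ j) ` (M j \<times> {..<k})) \<le> (s + 1) * k" .
  qed
  finally show ?thesis by simp
qed

end

subsection \<open>Maximal runs\<close>

text \<open>The sum \<open>x + \<pi>\<close> has a name of its own because the atomic predicates
  compare letters at variables only.\<close>

definition per :: "(nat \<Rightarrow> 'a) \<Rightarrow> nat \<Rightarrow> nat \<Rightarrow> nat \<Rightarrow> bool" where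
  "per w i e \<pi> \<longleftrightarrow> (\<forall>x y. i \<le> x \<longrightarrow> y \<le> e \<longrightarrow> x + \<pi> = y \<longrightarrow> w x = w y)"

text \<open>The break on the right excludes infinite runs and also \<open>\<pi> = 0\<close>; on the
  left the beginning of the word is an admissible end.\<close>

definition maxrun :: "(nat \<Rightarrow> 'a) \<Rightarrow> nat \<Rightarrow> nat \<Rightarrow> nat \<Rightarrow> bool" where
  "maxrun w i e \<pi> \<longleftrightarrow> per w i e \<pi> \<and>
     (\<exists>x y. Suc e = y \<and> x + \<pi> = y \<and> w x \<noteq> w y) \<and>
     (i = 0 \<or> (\<exists>x y. Suc x = i \<and> x + \<pi> = y \<and> w x \<noteq> w y))"

text \<open>Explicit bounds that are computable from \<open>k\<close> and the number \<open>s\<close> of states of the word. The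
  towers of exponentials arise from the closure properties of \<open>recog\<close>, where every quantifier costs
  an exponential.\<close>

definition Nper_of :: "nat \<Rightarrow> nat" where
  "Nper_of s = 2 ^ (2 ^ (5 * (5 * (5 * (s * s)))))"

definition Nrun_of :: "nat \<Rightarrow> nat" where
  "Nrun_of s = Nper_of s * (2 ^ (2 ^ (5 * (5 * (s * s)))) * (5 * 2 ^ (2 ^ (5 * (5 * (s * s))))))"

definition Nup_of :: "nat \<Rightarrow> nat" where
  "Nup_of s = 5 * 2 ^ (2 ^ (5 * (5 * (s * s))))"

definition Nmatch_of :: "nat \<Rightarrow> nat" where
  "Nmatch_of s = 2 ^ (2 ^ (5 * (5 * (5 * (s * s)))))"

definition Nbreak_of :: "nat \<Rightarrow> nat" where
  "Nbreak_of s = 2 ^ (5 * (s * s))"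

definition Ncrit_of :: "nat \<Rightarrow> nat" where
  "Ncrit_of s = 5 * (Nmatch_of s * (Nbreak_of s * (Nmatch_of s * (5 * Nbreak_of s))))"

definition Ncov_of :: "nat \<Rightarrow> nat" where
  "Ncov_of s = 2 ^ (5 * (5 * Nmatch_of s))"

definition NTheta_of :: "nat \<Rightarrow> nat \<Rightarrow> nat" where
  "NTheta_of s M = 2 ^ (2 ^ (2 ^ (2 ^ (Ncrit_of s * (Ncov_of s * ((2 * M + 5) * ((2 * M + 5) * ((2 * M + 5) * (2 * M + 5)))))))))"

text \<open>The factor \<open>k ^ Nrun_of s\<close> leaves room for a repeated state; the remaining
  powers absorb the factor 4 in \<open>long_maxrun_log_growth\<close> and the rounding of the period
  to a power of \<open>k\<close>.\<close>

definition Eexp_of :: "nat \<Rightarrow> nat \<Rightarrow> nat" where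
  "Eexp_of k s = k ^ (Nrun_of s + 4)"

text \<open>The number of levels by which the grid is finer than a critical word:
  \<open>k ^ gcell_of s = k ^ 2 * Eexp_of k s\<close>, which is at least
  \<open>2 * Eexp_of k s + 7\<close> and thus meets the length condition of
  \<open>crit_unique\<close>.\<close>

definition gcell_of :: "nat \<Rightarrow> nat" where
  "gcell_of s = Nrun_of s + 6"

text \<open>Relocated coordinates of a word at scale \<open>k ^ j\<close> lie below
  \<open>2 * k ^ (s * s + Suc j)\<close>; division by the grid width
  \<open>k ^ (j - gcell_of s)\<close> leaves less than this number.\<close>

definition Mcell_of :: "nat \<Rightarrow> nat \<Rightarrow> nat" where
  "Mcell_of k s = k ^ (s * s + gcell_of s + 2)"

definition Nser_of :: "nat \<Rightarrow> nat \<Rightarrow> nat" where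
  "Nser_of k s = NTheta_of s (Mcell_of k s)"

text \<open>The number of pairs of classes in \<open>recog_pump_levels\<close>, hence a bound on
  loop lengths: two states describe the left side of a cut, a set of states its right side.\<close>

definition Rser_of :: "nat \<Rightarrow> nat \<Rightarrow> nat" where
  "Rser_of k s = Nser_of k s * Nser_of k s * 2 ^ (Nser_of k s)"

definition Pser_of :: "nat \<Rightarrow> nat \<Rightarrow> nat" where
  "Pser_of k s = fact (Rser_of k s)"

text \<open>Slack between a level and the size of \<open>n\<close>; it pays for the head of the
  pumped digit string and for keeping the position below \<open>n / 2\<close>.\<close>

definition Qser_of :: "nat \<Rightarrow> nat \<Rightarrow> nat" where
  "Qser_of k s = Nser_of k s * Nser_of k s + Rser_of k s + 1"

definition Lser_of :: "nat \<Rightarrow> nat \<Rightarrow> nat" where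
  "Lser_of k s = 2 ^ (Nser_of k s) * Pser_of k s"

definition gamma_cap_of :: "nat \<Rightarrow> nat \<Rightarrow> nat" where
  "gamma_cap_of k s = 2 * k ^ (Qser_of k s + 1) + k ^ (s * s + (gcell_of s + Lser_of k s)) + Mcell_of k s ^ 4 * Pser_of k s + 2 * k ^ (Nup_of s)"

text \<open>The number \<open>c\<close> of positions enters an exponent and not the height of the
  tower, so the function is built from finitely many powers and products.\<close>

definition Ngam_of :: "nat \<Rightarrow> nat \<Rightarrow> nat" where
  "Ngam_of s c = 2 ^ (2 ^ (2 ^ (5 * (5 * 2 ^ (5 * ((5 * 5) ^ c * Nmatch_of s))))))"

definition Nall_of :: "nat \<Rightarrow> nat \<Rightarrow> nat" where
  "Nall_of s C = Ngam_of s C ^ Suc C"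

lemma card_le_2I:
  assumes "\<And>x y z. x \<in> M \<Longrightarrow> y \<in> M \<Longrightarrow> z \<in> M \<Longrightarrow> x = y \<or> y = z \<or> x = z"
  shows "finite M \<and> card M \<le> 2"
proof (cases "\<exists>x y. x \<in> M \<and> y \<in> M \<and> x \<noteq> y")
  case True
  then obtain x y where "x \<in> M" "y \<in> M" "x \<noteq> y" by blast
  then have "M \<subseteq> {x, y}" using assms by blast
  moreover have "card {x, y} \<le> 2" by (simp add: card_insert_if)
  ultimately show ?thesis using card_mono[of "{x, y}" M] finite_subset[of M "{x, y}"] by fastforce
next
  case False
  show ?thesis
  proof (cases "M = {}")
    case False
    then obtain x where "x \<in> M" by blast
    then have "M = {x}" using \<open>\<not> (\<exists>x y. x \<in> M \<and> y \<in> M \<and> x \<noteq> y)\<close> by blast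
    then show ?thesis by simp
  qed simp
qed

text \<open>The letters that break the second run on its left are at distance \<open>\<pi>\<close>;
  if both lay in the first run, they would agree.\<close>

lemma maxrun_overlap:
  assumes "maxrun w a b \<pi>" "maxrun w a' b' \<pi>" "a < a'"
  shows "b + 1 < a' + \<pi>"
proof (rule ccontr)
  assume "\<not> b + 1 < a' + \<pi>"
  moreover obtain x y where "Suc x = a'" "x + \<pi> = y" "w x \<noteq> w y"
    using assms(2,3) unfolding maxrun_def by fastforce
  ultimately show False using assms(1,3) unfolding maxrun_def per_def by (metis add_Suc_right add.commute less_Suc_eq_le linorder_not_less Suc_eq_plus1 le_less_Suc_eq not_less_eq)
qed

lemma maxrun_start_inj:
  assumes "maxrun w a b \<pi>" "maxrun w a b' \<pi>" "\<pi> \<le> b - a" "\<pi> \<le> b' - a" "a \<le> b" "a \<le> b'"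
  shows "b = b'"
proof -
  have False if m: "maxrun w a b \<pi>" "maxrun w a b' \<pi>" "\<pi> \<le> b - a" "a \<le> b" "b < b'" for b b'
  proof -
    obtain x y where "Suc b = y" "x + \<pi> = y" "w x \<noteq> w y" using m(1) unfolding maxrun_def by auto
    moreover have "per w a b' \<pi>" using m(2) unfolding maxrun_def by blast
    moreover have "a \<le> x" using that calculation by linarith
    ultimately show False using that unfolding per_def by (metis Suc_leI)
  qed
  then show ?thesis using assms by (metis linorder_neqE_nat)
qed

text \<open>Consecutive runs overlap in fewer than \<open>\<pi>\<close> positions. If the first one
  reaches \<open>p - 1\<close> and the third one starts by \<open>p + 1\<close>, the middle one is
  too short to have length \<open>2 * \<pi>\<close>.\<close>

lemma maxrun_three:
  assumes "maxrun w a1 b1 \<pi>" "maxrun w a2 b2 \<pi>" "maxrun w a3 b3 \<pi>"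
    and "b1 + 1 \<ge> p" "a3 \<le> p + 1" "a1 < a2" "a2 < a3" "2 * \<pi> \<le> b2 - a2"
  shows False
  using maxrun_overlap[OF assms(1,2)] maxrun_overlap[OF assms(2,3)] assms by linarith

section \<open>Pumping and small witnesses for recognizable predicates\<close>

context radix begin

lemma env_step:
  assumes T: "cong_fun T" and eq: "T e = T e'" and f: "\<And>v. f v < k ^ m"
  shows "T (\<lambda>v. e v * k ^ m + f v) = T (\<lambda>v. e' v * k ^ m + f v)"
  using f
proof (induction m arbitrary: f)
  case 0 then show ?case using eq by simp
next
  case (Suc m)
  have "f v div k < k ^ m" for v using Suc.prems[of v] by (simp add: less_mult_imp_div_less mult.commute)
  then have "T (\<lambda>v. e v * k ^ m + f v div k) = T (\<lambda>v. e' v * k ^ m + f v div k)" by (rule Suc.IH)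
  then have "T (\<lambda>v. k * (e v * k ^ m + f v div k) + f v mod k) = T (\<lambda>v. k * (e' v * k ^ m + f v div k) + f v mod k)"
    by (rule cong_funD[OF T, of "\<lambda>v. e v * k ^ m + f v div k" "\<lambda>v. e' v * k ^ m + f v div k" "\<lambda>v. f v mod k"]) simp
  moreover have "k * (z * k ^ m + f v div k) + f v mod k = z * k ^ Suc m + f v" for z v
    by (simp add: algebra_simps)
  ultimately show ?case by simp
qed

text \<open>The offset \<open>t\<close> matters for pumping: variables with value below
  \<open>k ^ t\<close> have only zeros in the repeated part.\<close>

lemma env_pigeonhole:
  assumes N: "\<And>e. T e < (N :: nat)"
  obtains i j where "t \<le> i" "i < j" "j \<le> t + N" "T (\<lambda>v. e v div k ^ i) = T (\<lambda>v. e v div k ^ j)"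
proof -
  have "card {..<N} < card {t..t + N}" by simp
  then obtain i j where "i \<in> {t..t + N}" "j \<in> {t..t + N}" "i < j"
      "T (\<lambda>v. e v div k ^ i) = T (\<lambda>v. e v div k ^ j)"
    using pigeonhole_seq[of "{..<N}" "{t..t + N}" "\<lambda>i. T (\<lambda>v. e v div k ^ i)"] N by blast
  then show thesis using that[of i j] by simp
qed

text \<open>The digits between two equal states are deleted in all variables at once. A common
  length \<open>L\<close> is assumed because an environment has infinitely many variables.\<close>

lemma recog_small:
  assumes "recog N P" "P e" "\<And>v. e v < k ^ L"
  shows "\<exists>e'. P e' \<and> (\<forall>v. e' v < k ^ N)"
proof -
  obtain T where T: "cong_fun T" "\<forall>e. T e < N" "\<forall>e e'. T e = T e' \<longrightarrow> P e = P e'"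
    using assms(1) unfolding recog_def by blast
  show ?thesis
    using assms(2,3)
  proof (induction L arbitrary: e rule: less_induct)
    case (less L)
    show ?case
    proof (cases "L \<le> N")
      case True
      then have "k ^ L \<le> k ^ N" by simp
      then have "e v < k ^ N" for v using less.prems(2)[of v] by linarith
      then show ?thesis using less.prems(1) by (intro exI[of _ e]) simp
    next
      case False
      obtain i j where ij: "i < j" "j \<le> N" "T (\<lambda>v. e v div k ^ i) = T (\<lambda>v. e v div k ^ j)"
        using env_pigeonhole[of T N 0 e] T(2)[rule_format] by (metis add_0)
      define e' where "e' v = (e v div k ^ j) * k ^ i + e v mod k ^ i" for v
      have "T (\<lambda>v. e v div k ^ i * k ^ i + e v mod k ^ i) = T (\<lambda>v. e v div k ^ j * k ^ i + e v mod k ^ i)"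
        by (rule env_step[OF T(1), OF ij(3), of "\<lambda>v. e v mod k ^ i" i]) simp
      then have "T e = T e'" unfolding div_mult_mod_eq e'_def .
      then have "P e'" using T(3)[rule_format, of e e'] less.prems(1) by simp
      moreover have "e' v < k ^ (L - (j - i))" for v
      proof -
        have "e v < k ^ j * k ^ (L - j)" using less.prems(2)[of v] ij False by (simp flip: power_add)
        then have "e v div k ^ j < k ^ (L - j)" by (simp add: less_mult_imp_div_less mult.commute)
        then have "e' v < k ^ (L - j + i)" unfolding e'_def by (intro mult_add_less_pow) simp_all
        moreover have "L - j + i = L - (j - i)" using ij False by simp
        ultimately show ?thesis by simp
      qed
      moreover have "L - (j - i) < L" using ij False by simp
      ultimately show ?thesis by (intro less.IH[of "L - (j - i)" e'])
    qed
  qed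
qed

end

context autword begin

abbreviation "Nper \<equiv> Nper_of s"
abbreviation "Nrun \<equiv> Nrun_of s"
abbreviation "Nup \<equiv> Nup_of s"
abbreviation "Nmatch \<equiv> Nmatch_of s"
abbreviation "Nbreak \<equiv> Nbreak_of s"
abbreviation "Ncrit \<equiv> Ncrit_of s"
abbreviation "Ncov \<equiv> Ncov_of s"
abbreviation "NTheta \<equiv> NTheta_of s"
abbreviation "Eexp \<equiv> Eexp_of k s"
abbreviation "gcell \<equiv> gcell_of s"
abbreviation "Mcell \<equiv> Mcell_of k s"
abbreviation "Nser \<equiv> Nser_of k s"
abbreviation "Rser \<equiv> Rser_of k s"
abbreviation "Pser \<equiv> Pser_of k s"
abbreviation "Qser \<equiv> Qser_of k s"
abbreviation "Lser \<equiv> Lser_of k s"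
abbreviation "gamma_cap \<equiv> gamma_cap_of k s"
abbreviation "Ngam \<equiv> Ngam_of s"
abbreviation "Nall \<equiv> Nall_of s"

lemma recog_per: "recog Nper (\<lambda>e. per w (e 0) (e 1) (e 2))"
  unfolding per_def Nper_of_def
  by (rule recog_all_var[where x = 3], rule recog_all_var[where x = 4],
      intro recog_imp recog_le recog_add_eq recog_w_eq) simp_all

lemma recog_maxrun: "recog Nrun (\<lambda>e. maxrun w (e 0) (e 1) (e 2))"
proof -
  have 1: "recog (2 ^ (2 ^ (5 * (5 * (s * s))))) (\<lambda>e. \<exists>x y. Suc (e 1) = y \<and> x + e 2 = y \<and> w x \<noteq> w y)"
    by (rule recog_ex_var[where x = 3], rule recog_ex_var[where x = 4],
        intro recog_and recog_not recog_Suc_eq recog_add_eq recog_w_eq) simp_all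
  have 2: "recog (2 ^ (2 ^ (5 * (5 * (s * s))))) (\<lambda>e. \<exists>x y. Suc x = e 0 \<and> x + e 2 = y \<and> w x \<noteq> w y)"
    by (rule recog_ex_var[where x = 3], rule recog_ex_var[where x = 4],
        intro recog_and recog_not recog_Suc_eq recog_add_eq recog_w_eq) simp_all
  show ?thesis unfolding maxrun_def Nrun_of_def
    apply (rule recog_and[OF recog_per])
    apply (rule recog_and[OF 1])
    apply (rule recog_or[OF recog_eq0])
    apply (rule 2)
    done
qed

lemma recog_up: "recog Nup (\<lambda>e. e 1 \<noteq> 0 \<and> (\<forall>x y. e 0 \<le> x \<longrightarrow> x + e 1 = y \<longrightarrow> w x = w y))"
  unfolding Nup_of_def
  by (rule recog_and[OF recog_not[OF recog_eq0]], rule recog_all_var[where x = 3], rule recog_all_var[where x = 4],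
      intro recog_imp recog_le recog_add_eq recog_w_eq) simp_all

text \<open>Having a given preperiod and period is recognizable, so \<open>recog_small\<close>
  replaces both by small ones; the bound therefore does not depend on \<open>i\<close> and
  \<open>\<pi>\<close>. The positions below their sum form an attractor.\<close>

lemma gamma_ultimately_periodic:
  assumes "\<pi> \<noteq> 0" "\<forall>x y. i \<le> x \<longrightarrow> x + \<pi> = y \<longrightarrow> w x = w y"
  shows "gamma w n \<le> 2 * k ^ Nup"
proof -
  obtain L where L: "i < k ^ L" "\<pi> < k ^ L"
    using less_kpow[of "i + \<pi>"] by (meson le_add1 le_add2 le_less_trans)
  define e where "e v = (if v = 0 then i else \<pi>)" for v :: nat
  define Q where "Q e \<longleftrightarrow> e 1 \<noteq> 0 \<and> (\<forall>x y. e 0 \<le> x \<longrightarrow> x + e 1 = y \<longrightarrow> w x = w y)" for e :: "nat \<Rightarrow> nat"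
  have 1: "recog Nup Q" using recog_up unfolding Q_def .
  have e01: "e 0 = i" "e 1 = \<pi>" by (simp_all add: e_def)
  have 2: "Q e" unfolding Q_def e01 by (rule conjI[OF assms])
  have 3: "e v < k ^ L" for v using L by (simp add: e_def)
  obtain e' where Qe': "Q e'" and e'_less: "\<forall>v. e' v < k ^ Nup"
    using recog_small[of Nup Q e L, OF 1 2 3] by (elim exE conjE)
  define j where "j = e' 0"
  define \<rho> where "\<rho> = e' 1"
  have \<rho>: "0 < \<rho>" "\<And>x. j \<le> x \<Longrightarrow> w x = w (x + \<rho>)" using Qe' unfolding Q_def j_def \<rho>_def by blast+
  have shift: "w x = w (x + m * \<rho>)" if "j \<le> x" for x m
  proof (induction m)
    case (Suc m)
    have "w (x + m * \<rho>) = w (x + m * \<rho> + \<rho>)" using that by (intro \<rho>(2)) simp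
    then show ?case using Suc by (simp add: algebra_simps)
  qed simp
  define S where "S = {..<j + \<rho>} \<inter> {..<n}"
  have "attr w n S" unfolding attr_def
  proof (intro conjI allI impI)
    show "S \<subseteq> {..<n}" by (auto simp: S_def)
    fix a b assume ab: "a \<le> b" "b < n"
    show "\<exists>q p. p \<in> S \<and> q \<le> p \<and> p \<le> q + (b - a) \<and> q + (b - a) < n \<and> occ w a b q"
    proof (cases "a < j + \<rho>")
      case True
      then show ?thesis using ab by (intro exI[of _ a]) (auto simp: S_def occ_def)
    next
      case False
      define q where "q = j + (a - j) mod \<rho>"
      define m where "m = (a - j) div \<rho>"
      have "a - j = m * \<rho> + (a - j) mod \<rho>" unfolding m_def by (rule div_mult_mod_eq[symmetric])
      then have a: "a = q + m * \<rho>" unfolding q_def using False by linarith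
      have "q < j + \<rho>" unfolding q_def using \<rho>(1) by simp
      moreover have "occ w a b q" unfolding occ_def
      proof (intro allI impI)
        fix u
        have "w (q + u) = w (q + u + m * \<rho>)" by (rule shift) (simp add: q_def)
        then show "w (q + u) = w (a + u)" unfolding a by (simp add: algebra_simps)
      qed
      ultimately show ?thesis using ab a by (intro exI[of _ q]) (auto simp: S_def)
    qed
  qed
  then have "gamma w n \<le> card S" by (rule gamma_le_card)
  also have "\<dots> \<le> card {..<j + \<rho>}" unfolding S_def by (intro card_mono) auto
  also have "\<dots> \<le> 2 * k ^ Nup" using e'_less[rule_format, of 0] e'_less[rule_format, of 1] by (simp add: j_def \<rho>_def)
  finally show ?thesis .
qed

end

text \<open>The extra letter on each side carries the two breaks along, so a copy of the extended
  run is again maximal. This is why \<open>0 < i\<close> is assumed.\<close>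

lemma occ_maxrun:
  assumes run: "maxrun w i e \<pi>" and i: "0 < i" "i \<le> e" "\<pi> \<le> e - i" and occ: "occ w (i - 1) (e + 1) q"
  shows "maxrun w (q + 1) (q + 1 + (e - i)) \<pi>"
proof -
  have tr: "w (q + 1 + u) = w (i + u)" if "u \<le> e - i + 1" for u
    using occ[unfolded occ_def, rule_format, of "u + 1"] that i by simp
  have tr0: "w q = w (i - 1)" using occ[unfolded occ_def, rule_format, of 0] by simp
  have "per w (q + 1) (q + 1 + (e - i)) \<pi>" unfolding per_def
  proof (intro allI impI)
    fix x y assume xy: "q + 1 \<le> x" "y \<le> q + 1 + (e - i)" "x + \<pi> = y"
    have "w x = w (i + (x - (q + 1)))" using tr[of "x - (q + 1)"] xy by simp
    also have "\<dots> = w (i + (y - (q + 1)))"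
    proof -
      have "i \<le> i + (x - (q + 1))" "i + (y - (q + 1)) \<le> e" "i + (x - (q + 1)) + \<pi> = i + (y - (q + 1))"
        using xy i by linarith+
      then show ?thesis using run unfolding maxrun_def per_def by blast
    qed
    also have "\<dots> = w y" using tr[of "y - (q + 1)"] xy by simp
    finally show "w x = w y" .
  qed
  moreover have "w (q + 1 + (e - i) + 1 - \<pi>) \<noteq> w (q + 1 + (e - i) + 1)"
  proof -
    obtain x y where xy: "Suc e = y" "x + \<pi> = y" "w x \<noteq> w y" using run unfolding maxrun_def by auto
    have e1: "q + 1 + (e - i + 1) = q + 1 + (e - i) + 1" "i + (e - i + 1) = y"
      "q + 1 + (e - i + 1 - \<pi>) = q + 1 + (e - i) + 1 - \<pi>" "i + (e - i + 1 - \<pi>) = x"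
      using xy i by simp_all
    have "w (q + 1 + (e - i) + 1) = w y" using tr[of "e - i + 1"] unfolding e1 by simp
    moreover have "w (q + 1 + (e - i) + 1 - \<pi>) = w x" using tr[of "e - i + 1 - \<pi>"] unfolding e1 by simp
    ultimately show ?thesis using xy(3) by simp
  qed
  then have "\<exists>x y. Suc (q + 1 + (e - i)) = y \<and> x + \<pi> = y \<and> w x \<noteq> w y"
    using i by (intro exI[of _ "q + 1 + (e - i) + 1 - \<pi>"] exI[of _ "q + 1 + (e - i) + 1"]) simp
  moreover have "\<exists>x y. Suc x = q + 1 \<and> x + \<pi> = y \<and> w x \<noteq> w y"
  proof -
    obtain x y where xy: "Suc x = i" "x + \<pi> = y" "w x \<noteq> w y" using run i unfolding maxrun_def by auto
    show ?thesis
    proof (cases "\<pi> = 0")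
      case True then show ?thesis using xy by simp
    next
      case False
      have "w (q + 1 + (\<pi> - 1)) = w (i + (\<pi> - 1))" by (rule tr) (use i in simp)
      moreover have "i + (\<pi> - 1) = y" "q + 1 + (\<pi> - 1) = q + \<pi>" using xy False by simp_all
      moreover have "w q = w x" using tr0 xy by auto
      ultimately show ?thesis using xy by (intro exI[of _ q] exI[of _ "q + \<pi>"]) simp
    qed
  qed
  ultimately show ?thesis unfolding maxrun_def by blast
qed

lemma maxrun_three_distinct:
  assumes "\<And>a b. (a, b) \<in> {(a1, b1), (a2, b2), (a3, b3)} \<Longrightarrow>
      maxrun w a b \<pi> \<and> b + 1 \<ge> p \<and> a \<le> p + 1 \<and> 2 * \<pi> \<le> b - a"
    and "a1 \<noteq> a2" "a2 \<noteq> a3" "a1 \<noteq> a3"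
  shows False
proof -
  have *: False if "(a, b) \<in> {(a1, b1), (a2, b2), (a3, b3)}" "(a', b') \<in> {(a1, b1), (a2, b2), (a3, b3)}"
    "(a'', b'') \<in> {(a1, b1), (a2, b2), (a3, b3)}" "a < a'" "a' < a''" for a b a' b' a'' b''
    using maxrun_three[of w a b \<pi> a' b' a'' b'' p] assms(1)[OF that(1)] assms(1)[OF that(2)] assms(1)[OF that(3)] that(4,5)
    by blast
  consider "a1 < a2 \<and> a2 < a3" | "a1 < a3 \<and> a3 < a2" | "a2 < a1 \<and> a1 < a3" | "a2 < a3 \<and> a3 < a1"
    | "a3 < a1 \<and> a1 < a2" | "a3 < a2 \<and> a2 < a1" using assms(2-) by linarith
  then show False
    by cases (use *[of a1 b1 a2 b2 a3 b3] *[of a1 b1 a3 b3 a2 b2] *[of a2 b2 a1 b1 a3 b3]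
      *[of a2 b2 a3 b3 a1 b1] *[of a3 b3 a1 b1 a2 b2] *[of a3 b3 a2 b2 a1 b1] in simp_all)
qed

context autword begin

text \<open>The digits between two equal states are repeated in \<open>i\<close>, \<open>e\<close>
  and \<open>\<pi>\<close> at once. They lie above position \<open>t\<close>, where
  \<open>\<pi>\<close> has only zeros, so the period stays fixed while the run grows.\<close>

lemma maxrun_pump:
  assumes run: "maxrun w i e \<pi>" and \<pi>: "\<pi> < k ^ t" and len: "4 * k ^ (t + Nrun) \<le> e - i"
  obtains I E A B where "\<And>m. maxrun w (I m) (E m) \<pi>" "\<And>m. i \<le> I m" "0 < B"
    "\<And>m. E m < k ^ (A + B * m)" "\<And>m. I m \<le> E m" "\<And>m. 3 * \<pi> \<le> E m - I m"
    "\<And>m m'. m < m' \<Longrightarrow> E m - I m < E m' - I m'" "\<And>m. i = 0 \<Longrightarrow> I m = 0"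
proof -
  define P where "P e \<longleftrightarrow> maxrun w (e 0) (e 1) (e 2)" for e :: "nat \<Rightarrow> nat"
  obtain T where T: "cong_fun T" "\<forall>e. T e < Nrun" "\<forall>e e'. T e = T e' \<longrightarrow> P e = P e'"
    using recog_maxrun unfolding recog_def P_def[abs_def] by (elim exE conjE)
  define F where "F v = (if v = 0 then i else if v = 1 then e else \<pi>)" for v :: nat
  have F012[simp]: "F 0 = i" "F (Suc 0) = e" "F 2 = \<pi>" by (simp_all add: F_def)
  obtain a b where ab: "t \<le> a" "a < b" "b \<le> t + Nrun" "T (\<lambda>v. F v div k ^ a) = T (\<lambda>v. F v div k ^ b)"
    by (rule env_pigeonhole[of T Nrun t F, OF T(2)[rule_format]])
  define l where "l = b - a"
  define K where "K = k ^ l"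
  define U where "U v = F v div k ^ b" for v
  define f where "f v = F v div k ^ a mod K" for v
  have f_less: "f v < k ^ l" for v by (simp add: f_def K_def)
  have Fa: "F v div k ^ a = U v * K + f v" for v
  proof -
    have "k ^ b = k ^ a * K" using ab by (simp add: K_def l_def flip: power_add)
    then have "U v = F v div k ^ a div K" by (simp add: U_def div_mult2_eq)
    then show ?thesis unfolding f_def by (simp only: div_mult_mod_eq)
  qed
  \<comment> \<open>\<open>X m\<close> holds the digits above position \<open>a\<close> after
    \<open>m\<close> further copies of the loop; \<open>Y m\<close> restores the lower
    digits.\<close>
  define X where "X = rec_nat (\<lambda>v. F v div k ^ a) (\<lambda>_ x v. x v * K + f v)"
  have X0: "X 0 = (\<lambda>v. F v div k ^ a)" and XS: "\<And>m. X (Suc m) = (\<lambda>v. X m v * K + f v)"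
    by (simp_all add: X_def)
  have TX: "T (X m) = T U" for m
  proof (induction m)
    case 0 then show ?case using ab(4) unfolding X0 U_def by simp
  next
    case (Suc m)
    have "T (\<lambda>v. X m v * k ^ l + f v) = T (\<lambda>v. U v * k ^ l + f v)"
      by (rule env_step[OF T(1), of "X m" U f l, OF Suc f_less])
    then have "T (X (Suc m)) = T (X 0)" unfolding XS X0 K_def[symmetric] Fa .
    then show ?case using ab(4) unfolding X0 U_def[symmetric] by simp
  qed
  define Y where "Y m v = X m v * k ^ a + F v mod k ^ a" for m v
  have Y0: "Y 0 = F" unfolding Y_def X0 by (simp only: div_mult_mod_eq)
  have PY: "P (Y m)" for m
  proof -
    have "T (\<lambda>v. X m v * k ^ a + F v mod k ^ a) = T (\<lambda>v. X 0 v * k ^ a + F v mod k ^ a)"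
      by (rule env_step[OF T(1), of "X m" "X 0" "\<lambda>v. F v mod k ^ a" a]) (simp_all add: TX)
    then have "T (Y m) = T (Y 0)" unfolding Y_def .
    then have "P (Y m) = P F" using T(3) unfolding Y0 by blast
    moreover have "P F" using run unfolding P_def by (simp add: F_def)
    ultimately show ?thesis by simp
  qed
  have \<pi>a: "\<pi> < k ^ a" using \<pi> ab(1) by (meson kpow_le_iff less_le_trans)
  have X2: "X m 2 = 0" for m
    by (induction m) (use \<pi>a in \<open>simp_all add: X0 XS f_def\<close>)
  have Y2: "Y m 2 = \<pi>" for m using \<pi>a by (simp add: Y_def X2)
  have runY: "maxrun w (Y m 0) (Y m 1) \<pi>" for m using PY[of m] unfolding P_def Y2 .
  have l1: "0 < l" using ab by (simp add: l_def)
  have K2: "2 \<le> K"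
  proof -
    have "k ^ 1 \<le> k ^ l" using l1 unfolding kpow_le_iff by simp
    then show ?thesis using k2 by (simp add: K_def)
  qed
  \<comment> \<open>The length of the run in units of \<open>k ^ a\<close>. From 4 units on,
    multiplication by \<open>K\<close> outweighs any loss from the inserted digits.\<close>
  define D where "D m = int (X m 1) - int (X m 0)" for m
  have Dstep: "D m + 1 \<le> D (Suc m)" if "4 \<le> D m" for m
  proof -
    have "D (Suc m) = D m * int K + int (f 1) - int (f 0)" unfolding D_def XS by (simp add: algebra_simps)
    moreover have "int (f 0) \<le> int K - 1" using f_less[of 0] unfolding K_def by linarith
    moreover have "1 * 1 \<le> (D m - 1) * (int K - 1)" using that K2 by (intro mult_mono) auto
    ultimately show ?thesis by (simp add: algebra_simps)
  qed
  have D0: "4 \<le> D 0"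
  proof -
    have "k ^ a \<le> k ^ (t + Nrun)" using ab unfolding kpow_le_iff by simp
    then have "4 * k ^ a \<le> e - i" using len by linarith
    then have "i + 4 * k ^ a \<le> e" using kpow_pos[of a] by linarith
    then have "int (i + 4 * k ^ a) \<le> int e" by (simp only: of_nat_le_iff)
    then have 1: "int i + 4 * int (k ^ a) \<le> int e" by simp
    have 2: "int z = int (z div k ^ a) * int (k ^ a) + int (z mod k ^ a)" for z
      by (simp only: div_mult_mod_eq flip: of_nat_add of_nat_mult)
    have "int (e mod k ^ a) < int (k ^ a)" "0 \<le> int (i mod k ^ a)" by simp_all
    then have "3 * int (k ^ a) < (int (e div k ^ a) - int (i div k ^ a)) * int (k ^ a)"
      using 1 2[of e] 2[of i] by (simp only: left_diff_distrib)
    then have "3 < int (e div k ^ a) - int (i div k ^ a)" by (rule mult_right_less_imp_less) simp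
    then show ?thesis by (simp add: D_def X0)
  qed
  have D4: "4 \<le> D m" for m using D0 Dstep by (induction m) fastforce+
  have Dmono: "m < m' \<Longrightarrow> D m < D m'" for m m'
  proof -
    have "D n < D (Suc n)" for n using Dstep[OF D4[of n]] by linarith
    then show "m < m' \<Longrightarrow> D m < D m'" by (rule lift_Suc_mono_less)
  qed
  define c where "c = int (e mod k ^ a) - int (i mod k ^ a)"
  have lenY: "int (Y m 1) - int (Y m 0) = D m * int (k ^ a) + c" for m
    unfolding Y_def D_def c_def by (simp add: algebra_simps)
  have c_gt: "- int (k ^ a) < c"
  proof -
    have "int (i mod k ^ a) < int (k ^ a)" "0 \<le> int (e mod k ^ a)" by simp_all
    then show ?thesis unfolding c_def by linarith
  qed
  have len3: "3 * int (k ^ a) \<le> int (Y m 1) - int (Y m 0)" for m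
  proof -
    have "4 * int (k ^ a) \<le> D m * int (k ^ a)" using D4 by (intro mult_right_mono) auto
    then show ?thesis using c_gt unfolding lenY by linarith
  qed
  have Yle: "Y m 0 \<le> Y m 1" for m using len3[of m] by (smt (verit) kpow_pos of_nat_0_le_iff of_nat_le_iff)
  have X1: "X m 1 < k ^ (e + l * m)" for m
  proof (induction m)
    case 0
    have "e div k ^ a < k ^ e" using less_kpow[of e] div_le_dividend[of e "k ^ a"] by (rule le_less_trans[rotated])
    then show ?case unfolding X0 by simp
  next
    case (Suc m)
    then have "X m 1 * k ^ l + f 1 < k ^ ((e + l * m) + l)" using f_less by (intro mult_add_less_pow)
    then show ?case unfolding XS K_def by (simp add: algebra_simps)
  qed
  show thesis
  proof (rule that[of "\<lambda>m. Y m 0" "\<lambda>m. Y m 1" l "e + a"])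
    fix m
    show "i \<le> Y m 0"
    proof -
      have "X 0 0 \<le> X m 0"
      proof (induction m)
        case (Suc m)
        have "X m 0 * 1 \<le> X m 0 * K" using K2 by (intro mult_left_mono) auto
        then have "X m 0 \<le> X m 0 * K + f 0" by linarith
        then show ?case using Suc unfolding XS by (rule le_trans[rotated])
      qed simp
      then have "Y 0 0 \<le> Y m 0" unfolding Y_def by simp
      then show ?thesis unfolding Y0 by simp
    qed
    show "Y m 1 < k ^ (e + a + l * m)"
    proof -
      have "Y m 1 < k ^ ((e + l * m) + a)" unfolding Y_def by (intro mult_add_less_pow X1) simp
      then show ?thesis by (simp add: algebra_simps)
    qed
    show "3 * \<pi> \<le> Y m 1 - Y m 0" using len3[of m] \<pi>a Yle[of m] by linarith
    show "Y m 0 = 0" if "i = 0"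
    proof -
      have "X m 0 = 0" by (induction m) (simp_all add: X0 XS f_def that)
      then show ?thesis by (simp add: Y_def that)
    qed
  next
    fix m m' :: nat assume "m < m'"
    then have "D m * int (k ^ a) < D m' * int (k ^ a)" using Dmono by (intro mult_strict_right_mono) auto
    then have "int (Y m 1) - int (Y m 0) < int (Y m' 1) - int (Y m' 0)" unfolding lenY by linarith
    then show "Y m 1 - Y m 0 < Y m' 1 - Y m' 0" using Yle[of m] Yle[of m'] by linarith
  qed (use runY l1 Yle in simp_all)
qed

text \<open>The tasks are the pumped runs with one letter added on each side. Their lengths differ,
  so copies of different tasks are different runs, and \<open>maxrun_three\<close> leaves at most
  two per position.\<close>

lemma long_maxrun_log_growth:
  assumes run: "maxrun w i e \<pi>" and \<pi>: "\<pi> < k ^ t" and len: "4 * k ^ (t + Nrun) \<le> e - i"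
  shows "log_growth w"
proof -
  obtain I E A B where R: "\<And>m. maxrun w (I m) (E m) \<pi>" "\<And>m. i \<le> I m" "0 < B"
    "\<And>m. E m < k ^ (A + B * m)" "\<And>m. I m \<le> E m" "\<And>m. 3 * \<pi> \<le> E m - I m"
    "\<And>m m'. m < m' \<Longrightarrow> E m - I m < E m' - I m'" "\<And>m. i = 0 \<Longrightarrow> I m = 0"
    using maxrun_pump[OF assms] by metis
  have \<pi>le: "\<pi> \<le> E m - I m" for m using R(6)[of m] by simp
  have ne: "E m - I m \<noteq> E m' - I m'" if "m \<noteq> m'" for m m'
    using R(7)[of m m'] R(7)[of m' m] that by (cases "m < m'") auto
  \<comment> \<open>A run starting at 0 has no left break, but pumping it would give two runs from 0
    of different lengths.\<close>
  have "i \<noteq> 0"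
  proof
    assume "i = 0"
    then have 0: "I 0 = 0" "I 1 = 0" using R(8) by auto
    have "E 0 = E 1" using maxrun_start_inj[of w 0 "E 0" \<pi> "E 1"] R(1)[of 0] R(1)[of 1] \<pi>le[of 0] \<pi>le[of 1] unfolding 0 by simp
    then show False using R(7)[of 0 1] 0 by simp
  qed
  then have Ipos: "0 < I m" for m using R(2)[of m] by simp
  show ?thesis
  proof (rule log_growth_tasks[where i = "\<lambda>m. I m - 1" and e = "\<lambda>m. E m + 1" and A = "A + 1" and B = B and h = 2])
    fix m
    show "I m - 1 \<le> E m + 1" using R(5)[of m] by simp
    have "E m + 1 \<le> k ^ (A + B * m)" using R(4)[of m] by simp
    also have "\<dots> < k ^ (A + 1 + B * m)" unfolding kpow_less_iff by simp
    finally show "E m + 1 < k ^ (A + 1 + B * m)" .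
  next
    fix p
    define M where "M = {m. cov w p (I m - 1) (E m + 1)}"
    have ex: "\<exists>a b. maxrun w a b \<pi> \<and> b + 1 \<ge> p \<and> a \<le> p + 1 \<and> 2 * \<pi> \<le> b - a \<and> \<pi> \<le> b - a \<and> a \<le> b \<and> b - a = E m - I m" if mM: "m \<in> M" for m
    proof -
      obtain q where q: "q \<le> p" "p \<le> q + (E m + 1 - (I m - 1))" "occ w (I m - 1) (E m + 1) q"
        using mM unfolding M_def cov_def by auto
      have "maxrun w (q + 1) (q + 1 + (E m - I m)) \<pi>"
        by (rule occ_maxrun[OF R(1) Ipos R(5) \<pi>le q(3)])
      then show ?thesis using q Ipos[of m] R(5)[of m] R(6)[of m]
        by (intro exI[of _ "q + 1"] exI[of _ "q + 1 + (E m - I m)"]) auto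
    qed
    have "finite M \<and> card M \<le> 2"
    proof (rule card_le_2I, rule ccontr)
      fix x y z assume "x \<in> M" "y \<in> M" "z \<in> M" and nn: "\<not> (x = y \<or> y = z \<or> x = z)"
      obtain a1 b1 where 1: "maxrun w a1 b1 \<pi> \<and> b1 + 1 \<ge> p \<and> a1 \<le> p + 1 \<and> 2 * \<pi> \<le> b1 - a1 \<and> \<pi> \<le> b1 - a1 \<and> a1 \<le> b1 \<and> b1 - a1 = E x - I x"
        using ex[OF \<open>x \<in> M\<close>] by blast
      obtain a2 b2 where 2: "maxrun w a2 b2 \<pi> \<and> b2 + 1 \<ge> p \<and> a2 \<le> p + 1 \<and> 2 * \<pi> \<le> b2 - a2 \<and> \<pi> \<le> b2 - a2 \<and> a2 \<le> b2 \<and> b2 - a2 = E y - I y"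
        using ex[OF \<open>y \<in> M\<close>] by blast
      obtain a3 b3 where 3: "maxrun w a3 b3 \<pi> \<and> b3 + 1 \<ge> p \<and> a3 \<le> p + 1 \<and> 2 * \<pi> \<le> b3 - a3 \<and> \<pi> \<le> b3 - a3 \<and> a3 \<le> b3 \<and> b3 - a3 = E z - I z"
        using ex[OF \<open>z \<in> M\<close>] by blast
      have "a1 \<noteq> a2" using 1 2 ne[of x y] nn maxrun_start_inj[of w a1 b1 \<pi> b2] by auto
      moreover have "a2 \<noteq> a3" using 2 3 ne[of y z] nn maxrun_start_inj[of w a2 b2 \<pi> b3] by auto
      moreover have "a1 \<noteq> a3" using 1 3 ne[of x z] nn maxrun_start_inj[of w a1 b1 \<pi> b3] by auto
      ultimately show False
        by (intro maxrun_three_distinct[of a1 b1 a2 b2 a3 b3 w \<pi> p]) (use 1 2 3 in auto)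
    qed
    then show "finite {m. cov w p (I m - 1) (E m + 1)}" "card {m. cov w p (I m - 1) (E m + 1)} \<le> 2"
      unfolding M_def by auto
  qed (use R(3) in simp_all)
qed

text \<open>The repetition is extended in both directions as far as its period permits. Either it
  never breaks on the right, or it becomes a maximal run long enough to be pumped.\<close>

lemma high_exponent:
  assumes per: "per w i e \<pi>" and \<pi>: "0 < \<pi>" and long: "k ^ (Nrun + 4) * \<pi> \<le> e - i"
  shows "log_growth w \<or> (\<forall>n. gamma w n \<le> 2 * k ^ Nup)"
proof -
  obtain j where j: "k ^ j \<le> \<pi>" "\<pi> < k ^ Suc j" using klog[OF \<pi>] by blast
  have len: "4 * k ^ (Suc j + Nrun) \<le> e - i"
  proof -
    have "2 ^ 2 \<le> k ^ 2" using k2 by (intro power_mono) auto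
    then have "4 * k ^ (Suc j + Nrun) \<le> k ^ 2 * k ^ (Suc j + Nrun)" by (intro mult_right_mono) auto
    also have "\<dots> = k ^ (Nrun + 3) * k ^ j" by (simp add: power_add algebra_simps eval_nat_numeral)
    also have "\<dots> \<le> k ^ (Nrun + 4) * \<pi>" using j by (intro mult_mono) auto
    finally show ?thesis using long by simp
  qed
  have pe: "\<pi> \<le> e - i"
  proof -
    have "1 * \<pi> \<le> k ^ (Nrun + 4) * \<pi>" by (intro mult_right_mono) (simp_all add: Suc_leI)
    then show ?thesis using long unfolding mult_1 by (rule le_trans)
  qed
  then have ie: "i \<le> e" using \<pi> by linarith
  define i0 where "i0 = (LEAST i. per w i e \<pi>)"
  have i0: "per w i0 e \<pi>" unfolding i0_def using per by (rule LeastI)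
  have i0_le: "i0 \<le> i" unfolding i0_def using per by (rule Least_le)
  have left: "i0 = 0 \<or> (\<exists>x y. Suc x = i0 \<and> x + \<pi> = y \<and> w x \<noteq> w y)"
  proof (rule ccontr)
    assume n: "\<not> (i0 = 0 \<or> (\<exists>x y. Suc x = i0 \<and> x + \<pi> = y \<and> w x \<noteq> w y))"
    then have eq: "w (i0 - 1) = w (i0 - 1 + \<pi>)" "0 < i0" by auto
    have "per w (i0 - 1) e \<pi>" unfolding per_def
    proof (intro allI impI)
      fix x y assume xy: "i0 - 1 \<le> x" "y \<le> e" "x + \<pi> = y"
      show "w x = w y"
      proof (cases "x = i0 - 1")
        case True then show ?thesis using eq xy by simp
      next
        case False
        then have "i0 \<le> x" using xy by simp
        then show ?thesis using i0 xy unfolding per_def by blast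
      qed
    qed
    then have "i0 \<le> i0 - 1" unfolding i0_def by (rule Least_le)
    then show False using eq by simp
  qed
  show ?thesis
  proof (cases "\<forall>e' \<ge> e. per w i0 e' \<pi>")
    case True
    have "\<forall>x y. i0 \<le> x \<longrightarrow> x + \<pi> = y \<longrightarrow> w x = w y"
    proof (intro allI impI)
      fix x y assume xy: "i0 \<le> x" "x + \<pi> = y"
      have "per w i0 (max e y) \<pi>" using True by (rule allE[of _ "max e y"]) (simp only: max.cobounded1)
      moreover have "y \<le> max e y" by simp
      ultimately show "w x = w y" using xy unfolding per_def by blast
    qed
    then show ?thesis using gamma_ultimately_periodic[of \<pi> i0] \<pi> by blast
  next
    case False
    define e2 where "e2 = (LEAST e'. e \<le> e' \<and> \<not> per w i0 e' \<pi>)"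
    have "\<exists>e'. e \<le> e' \<and> \<not> per w i0 e' \<pi>" using False by blast
    then have e2: "e \<le> e2 \<and> \<not> per w i0 e2 \<pi>" unfolding e2_def by (rule LeastI_ex)
    then have "e \<noteq> e2" using i0 by auto
    then obtain e1 where e1: "e2 = Suc e1" "e \<le> e1" using e2 by (cases e2) auto
    have "e1 < (LEAST e'. e \<le> e' \<and> \<not> per w i0 e' \<pi>)" unfolding e2_def[symmetric] e1(1) by (rule lessI)
    then have "\<not> (e \<le> e1 \<and> \<not> per w i0 e1 \<pi>)" by (rule not_less_Least[of e1 "\<lambda>e'. e \<le> e' \<and> \<not> per w i0 e' \<pi>"])
    then have p1: "per w i0 e1 \<pi>" using e1(2) by blast
    have "\<exists>x y. Suc e1 = y \<and> x + \<pi> = y \<and> w x \<noteq> w y"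
    proof (rule ccontr)
      assume n: "\<not> ?thesis"
      have "per w i0 e2 \<pi>" unfolding per_def
      proof (intro allI impI)
        fix x y assume xy: "i0 \<le> x" "y \<le> e2" "x + \<pi> = y"
        show "w x = w y"
        proof (cases "y = e2")
          case True
          have "\<not> (Suc e1 = y \<and> x + \<pi> = y \<and> w x \<noteq> w y)" using n by blast
          then show ?thesis using True xy(3) e1(1) by simp
        next
          case False
          then have "y \<le> e1" using xy e1 by linarith
          then show ?thesis using p1 xy unfolding per_def by blast
        qed
      qed
      then show False using e2 by simp
    qed
    then have "maxrun w i0 e1 \<pi>" unfolding maxrun_def using p1 left by blast
    moreover have "4 * k ^ (Suc j + Nrun) \<le> e1 - i0" using len e1 i0_le ie by linarith
    ultimately show ?thesis using long_maxrun_log_growth[OF _ j(2)] by blast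
  qed
qed

end

subsection \<open>Critical words\<close>

text \<open>Occurrences of \<open>w[a..b-1]\<close> at \<open>y\<close> and of \<open>w[a+1..b]\<close> at \<open>z\<close> that do not extend to \<open>w[a..b]\<close>.
  Subtractions are avoided by sums of equal value, which are recognizable.\<close>

definition crit :: "(nat \<Rightarrow> 'a) \<Rightarrow> nat \<Rightarrow> nat \<Rightarrow> nat \<Rightarrow> nat \<Rightarrow> bool" where
  "crit w a b y z \<longleftrightarrow> a < b \<and>
     (\<forall>x v. a \<le> x \<longrightarrow> x < b \<longrightarrow> x + y = v + a \<longrightarrow> w x = w v) \<and>
     (\<exists>t. b + y = t + a \<and> w b \<noteq> w t) \<and>
     (\<forall>x v. a < x \<longrightarrow> x \<le> b \<longrightarrow> x + z = Suc (v + a) \<longrightarrow> w x = w v) \<and>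
     (z = 0 \<or> (\<exists>t. Suc t = z \<and> w t \<noteq> w a))"

lemma crit_iff:
  "crit w a b y z \<longleftrightarrow> a < b \<and> (\<forall>u < b - a. w (y + u) = w (a + u)) \<and> w (y + (b - a)) \<noteq> w b \<and>
     (\<forall>u < b - a. w (z + u) = w (a + 1 + u)) \<and> (z = 0 \<or> w (z - 1) \<noteq> w a)"
proof (cases "a < b")
  case ab: True
  have 1: "(\<forall>x v. a \<le> x \<longrightarrow> x < b \<longrightarrow> x + y = v + a \<longrightarrow> w x = w v) \<longleftrightarrow> (\<forall>u < b - a. w (y + u) = w (a + u))"
  proof (intro iffI allI impI)
    fix u assume *: "\<forall>x v. a \<le> x \<longrightarrow> x < b \<longrightarrow> x + y = v + a \<longrightarrow> w x = w v" and u: "u < b - a"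
    have "a \<le> a + u" "a + u < b" "a + u + y = (y + u) + a" using u by linarith+
    then show "w (y + u) = w (a + u)" using * by metis
  next
    fix x v assume *: "\<forall>u < b - a. w (y + u) = w (a + u)" and x: "a \<le> x" "x < b" "x + y = v + a"
    have "x - a < b - a" "y + (x - a) = v" "a + (x - a) = x" using x by linarith+
    then show "w x = w v" using * by metis
  qed
  have 2: "(\<exists>t. b + y = t + a \<and> w b \<noteq> w t) \<longleftrightarrow> w (y + (b - a)) \<noteq> w b"
  proof
    assume "\<exists>t. b + y = t + a \<and> w b \<noteq> w t"
    then obtain t where t: "b + y = t + a" "w b \<noteq> w t" by blast
    have "y + (b - a) = t" using t(1) ab by linarith
    then show "w (y + (b - a)) \<noteq> w b" using t(2) by simp
  next
    assume *: "w (y + (b - a)) \<noteq> w b"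
    have "b + y = (y + (b - a)) + a" using ab by linarith
    then show "\<exists>t. b + y = t + a \<and> w b \<noteq> w t" using * by (intro exI[of _ "y + (b - a)"]) simp
  qed
  have 3: "(\<forall>x v. a < x \<longrightarrow> x \<le> b \<longrightarrow> x + z = Suc (v + a) \<longrightarrow> w x = w v) \<longleftrightarrow> (\<forall>u < b - a. w (z + u) = w (a + 1 + u))"
  proof (intro iffI allI impI)
    fix u assume *: "\<forall>x v. a < x \<longrightarrow> x \<le> b \<longrightarrow> x + z = Suc (v + a) \<longrightarrow> w x = w v" and u: "u < b - a"
    have "a < a + 1 + u" "a + 1 + u \<le> b" "a + 1 + u + z = Suc ((z + u) + a)" using u by linarith+
    then show "w (z + u) = w (a + 1 + u)" using * by metis
  next
    fix x v assume *: "\<forall>u < b - a. w (z + u) = w (a + 1 + u)" and x: "a < x" "x \<le> b" "x + z = Suc (v + a)"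
    have "x - a - 1 < b - a" "z + (x - a - 1) = v" "a + 1 + (x - a - 1) = x" using x by linarith+
    then show "w x = w v" using * by metis
  qed
  have 4: "(z = 0 \<or> (\<exists>t. Suc t = z \<and> w t \<noteq> w a)) \<longleftrightarrow> (z = 0 \<or> w (z - 1) \<noteq> w a)"
    by (cases z) auto
  show ?thesis unfolding crit_def 1 2 3 4 by (rule refl)
qed (simp add: crit_def)

lemma occ_alt:
  assumes "a \<le> b"
  shows "occ w a b q \<longleftrightarrow> (\<forall>x v. a \<le> x \<longrightarrow> x \<le> b \<longrightarrow> x + q = v + a \<longrightarrow> w x = w v)"
  unfolding occ_def
proof (intro iffI allI impI)
  fix u assume *: "\<forall>x v. a \<le> x \<longrightarrow> x \<le> b \<longrightarrow> x + q = v + a \<longrightarrow> w x = w v" and u: "u \<le> b - a"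
  have "a \<le> a + u" "a + u \<le> b" "a + u + q = (q + u) + a" using u assms by linarith+
  then show "w (q + u) = w (a + u)" using * by metis
next
  fix x v assume *: "\<forall>u \<le> b - a. w (q + u) = w (a + u)" and x: "a \<le> x" "x \<le> b" "x + q = v + a"
  have "x - a \<le> b - a" "q + (x - a) = v" "a + (x - a) = x" using x by linarith+
  then show "w x = w v" using * by metis
qed

lemma cov_alt:
  assumes "a \<le> b"
  shows "cov w p a b \<longleftrightarrow> (\<exists>q. q \<le> p \<and> p + a \<le> q + b \<and>
     (\<forall>x v. a \<le> x \<longrightarrow> x \<le> b \<longrightarrow> x + q = v + a \<longrightarrow> w x = w v))"
proof -
  have "p \<le> q + (b - a) \<longleftrightarrow> p + a \<le> q + b" for q using assms by linarith
  then show ?thesis unfolding cov_def occ_alt[OF assms] by blast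
qed

text \<open>A shortest subinterval all of whose occurrences extend to the whole factor is a critical word.\<close>

lemma shrink:
  assumes "i \<le> e"
  obtains a b where "i \<le> a" "a \<le> b" "b \<le> e"
    "\<And>q. occ w a b q \<Longrightarrow> a - i \<le> q \<and> occ w i e (q - (a - i))"
    "a < b \<Longrightarrow> \<exists>y z. crit w a b y z"
proof -
  define F where "F a b \<longleftrightarrow> i \<le> a \<and> a \<le> b \<and> b \<le> e \<and>
      (\<forall>q. occ w a b q \<longrightarrow> a - i \<le> q \<and> occ w i e (q - (a - i)))" for a b
  define Q where "Q l \<longleftrightarrow> (\<exists>a b. F a b \<and> b - a = l)" for l
  have "F i e" unfolding F_def using assms by simp
  then have ex: "Q (e - i)" unfolding Q_def by blast
  define l where "l = (LEAST l. Q l)"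
  have "Q l" unfolding l_def by (rule LeastI[of Q, OF ex])
  then obtain a b where ab: "F a b" "b - a = l" unfolding Q_def by blast
  have min: "\<not> F a' b'" if "b' - a' < l" for a' b'
    using not_less_Least[of "b' - a'" Q] that unfolding l_def Q_def by blast
  have force: "a - i \<le> q \<and> occ w i e (q - (a - i))" if "occ w a b q" for q
    using ab(1) that unfolding F_def by blast
  have abi: "i \<le> a" "a \<le> b" "b \<le> e" using ab(1) unfolding F_def by auto
  have "\<exists>y z. crit w a b y z" if lt: "a < b"
  proof -
    \<comment> \<open>By minimality neither of the two subintervals shorter by one letter forces the
      factor; the offending occurrences become \<open>y\<close> and \<open>z\<close>.\<close>
    have "\<not> F a (b - 1)" by (rule min) (use lt ab in linarith)
    then obtain y where y: "occ w a (b - 1) y" "\<not> (a - i \<le> y \<and> occ w i e (y - (a - i)))"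
      unfolding F_def using abi lt by auto
    have y1: "w (y + u) = w (a + u)" if "u < b - a" for u
      using y(1) that unfolding occ_def by simp
    have y2: "w (y + (b - a)) \<noteq> w b"
    proof
      assume *: "w (y + (b - a)) = w b"
      have "occ w a b y" unfolding occ_def
      proof (intro allI impI)
        fix u assume "u \<le> b - a"
        then show "w (y + u) = w (a + u)" using y1[of u] * abi by (cases "u = b - a") auto
      qed
      then show False using force y(2) by blast
    qed
    have "\<not> F (a + 1) b" by (rule min) (use lt ab in linarith)
    then obtain z where z: "occ w (a + 1) b z" "\<not> (a + 1 - i \<le> z \<and> occ w i e (z - (a + 1 - i)))"
      unfolding F_def using abi lt by auto
    have z1: "w (z + u) = w (a + 1 + u)" if "u < b - a" for u
      using z(1) that unfolding occ_def by simp
    have z2: "z = 0 \<or> w (z - 1) \<noteq> w a"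
    proof (rule ccontr)
      assume "\<not> (z = 0 \<or> w (z - 1) \<noteq> w a)"
      then have *: "0 < z" "w (z - 1) = w a" by auto
      have "occ w a b (z - 1)" unfolding occ_def
      proof (intro allI impI)
        fix u assume u: "u \<le> b - a"
        show "w (z - 1 + u) = w (a + u)"
        proof (cases u)
          case 0 then show ?thesis using * by simp
        next
          case (Suc v)
          then have "w (z + v) = w (a + 1 + v)" using u by (intro z1) simp
          then show ?thesis using Suc * by simp
        qed
      qed
      then have "a - i \<le> z - 1 \<and> occ w i e (z - 1 - (a - i))" by (rule force)
      moreover have "z - 1 - (a - i) = z - (a + 1 - i)" using abi by linarith
      moreover have "a + 1 - i \<le> z" if "a - i \<le> z - 1" using that * abi by linarith
      ultimately show False using z(2) by simp
    qed
    show ?thesis unfolding crit_iff using lt y1 y2 z1 z2 by blast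
  qed
  then show thesis using that[of a b] abi force by blast
qed

text \<open>If one stretch is read with two shifts that differ by \<open>\<pi>\<close>, then it has
  period \<open>\<pi>\<close>; with \<open>\<pi> \<le> 2 * c\<close> its length contradicts the
  bound on exponents. The factor 2 arises because a shift is a difference of two coordinates, each
  known up to \<open>c\<close>.\<close>

lemma match_shift_le:
  fixes lo hi :: nat
  assumes noexp: "\<And>i e \<pi>. 0 < \<pi> \<Longrightarrow> per w i e \<pi> \<Longrightarrow> e - i < E * \<pi>"
    and lo: "a1 \<le> lo" "a2 \<le> lo" "lo \<le> hi"
    and eq: "\<And>v. lo \<le> v \<Longrightarrow> v < hi \<Longrightarrow> w (y1 + (v - a1)) = w (y2 + (v - a2))"
    and close: "y2 + a1 \<le> y1 + a2 + 2 * c" and long: "E * (2 * c) \<le> hi - lo"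
  shows "y2 + a1 \<le> y1 + a2"
proof (rule ccontr)
  assume n: "\<not> y2 + a1 \<le> y1 + a2"
  define \<pi> where "\<pi> = y2 + a1 - (y1 + a2)"
  have \<pi>: "0 < \<pi>" "\<pi> \<le> 2 * c" using n close unfolding \<pi>_def by linarith+
  define i where "i = y1 + (lo - a1)"
  define e where "e = i + (hi - lo)"
  have "per w i e \<pi>" unfolding per_def
  proof (intro allI impI)
    fix x y assume xy: "i \<le> x" "y \<le> e" "x + \<pi> = y"
    define v where "v = lo + (x - i)"
    have "lo \<le> v" "v < hi" "y1 + (v - a1) = x" "y2 + (v - a2) = y"
      using xy lo n \<pi>(1) unfolding v_def e_def i_def \<pi>_def by linarith+
    then show "w x = w y" using eq[of v] by simp
  qed
  then have "e - i < E * \<pi>" by (rule noexp[OF \<pi>(1)])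
  also have "\<dots> \<le> E * (2 * c)" using \<pi> by (intro mult_left_mono) auto
  finally show False using long unfolding e_def by simp
qed

text \<open>Equal shifts \<open>y - a\<close> force the order of the right ends: a break at the end
  of the first word cannot be an interior match of the second. The shifts \<open>z - a\<close>
  settle the left ends in the same way.\<close>

lemma crit_unique_le:
  assumes noexp: "\<And>i e \<pi>. 0 < \<pi> \<Longrightarrow> per w i e \<pi> \<Longrightarrow> e - i < E * \<pi>"
    and c1: "crit w a1 b1 y1 z1" and c2: "crit w a2 b2 y2 z2"
    and close: "a1 \<le> a2 + c" "a2 \<le> a1 + c" "b1 \<le> b2 + c" "b2 \<le> b1 + c" "y1 \<le> y2 + c" "y2 \<le> y1 + c"
      "z1 \<le> z2 + c" "z2 \<le> z1 + c"
    and long: "(2 * E + 4) * c + 1 \<le> b1 - a1"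
  shows "a2 \<le> a1 \<and> b2 \<le> b1"
proof -
  note c1 = c1[unfolded crit_iff] and c2 = c2[unfolded crit_iff]
  \<comment> \<open>One more than the larger left end, so that the matches at \<open>y\<close> and
    at \<open>z\<close> are both available on the whole stretch.\<close>
  define lo where "lo = max a1 a2 + 1"
  define hi where "hi = min b1 b2"
  have ll: "(2 * E + 4) * c = E * (2 * c) + 4 * c" by (simp add: algebra_simps)
  have lh: "lo \<le> hi" "E * (2 * c) \<le> hi - lo" using long close unfolding lo_def hi_def ll by linarith+
  have inr: "v - a1 < b1 - a1" "v - a2 < b2 - a2" "a1 + (v - a1) = v" "a2 + (v - a2) = v"
     "v - (a1 + 1) < b1 - a1" "v - (a2 + 1) < b2 - a2" "a1 + 1 + (v - (a1 + 1)) = v" "a2 + 1 + (v - (a2 + 1)) = v"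
    if "lo \<le> v" "v < hi" for v using that unfolding lo_def hi_def by linarith+
  have eqy: "w (y1 + (v - a1)) = w (y2 + (v - a2))" if "lo \<le> v" "v < hi" for v
  proof -
    have "w (y1 + (v - a1)) = w (a1 + (v - a1))" using c1 inr[OF that] by blast
    moreover have "w (y2 + (v - a2)) = w (a2 + (v - a2))" using c2 inr[OF that] by blast
    ultimately show ?thesis unfolding inr[OF that] by simp
  qed
  have eqz: "w (z1 + (v - (a1 + 1))) = w (z2 + (v - (a2 + 1)))" if "lo \<le> v" "v < hi" for v
  proof -
    have "w (z1 + (v - (a1 + 1))) = w (a1 + 1 + (v - (a1 + 1)))" using c1 inr[OF that] by blast
    moreover have "w (z2 + (v - (a2 + 1))) = w (a2 + 1 + (v - (a2 + 1)))" using c2 inr[OF that] by blast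
    ultimately show ?thesis unfolding inr[OF that] by simp
  qed
  have lo': "a1 \<le> lo" "a2 \<le> lo" "a1 + 1 \<le> lo" "a2 + 1 \<le> lo" unfolding lo_def by auto
  have "y2 + a1 \<le> y1 + a2"
    by (rule match_shift_le[where w = w and E = E and c = c and lo = lo and hi = hi])
      (use noexp lo' lh close eqy in \<open>auto\<close>)
  moreover have "y1 + a2 \<le> y2 + a1"
    by (rule match_shift_le[where w = w and E = E and c = c and lo = lo and hi = hi])
      (use noexp lo' lh close eqy[symmetric] in \<open>auto\<close>)
  ultimately have y: "y2 + a1 = y1 + a2" by simp
  have "z2 + (a1 + 1) \<le> z1 + (a2 + 1)"
    by (rule match_shift_le[where w = w and E = E and c = c and lo = lo and hi = hi])
      (use noexp lo' lh close eqz in \<open>auto\<close>)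
  moreover have "z1 + (a2 + 1) \<le> z2 + (a1 + 1)"
    by (rule match_shift_le[where w = w and E = E and c = c and lo = lo and hi = hi])
      (use noexp lo' lh close eqz[symmetric] in \<open>auto\<close>)
  ultimately have z: "z2 + a1 = z1 + a2" by simp
  have "b2 \<le> b1"
  proof (rule ccontr)
    assume n: "\<not> b2 \<le> b1"
    have "a2 \<le> b1" using lh lo' unfolding hi_def by linarith
    then have "b1 - a2 < b2 - a2" "a2 + (b1 - a2) = b1" "y2 + (b1 - a2) = y1 + (b1 - a1)"
      using n y c1 by linarith+
    then have "w (y1 + (b1 - a1)) = w b1" using c2 by metis
    then show False using c1 by blast
  qed
  moreover have "a2 \<le> a1"
  proof (rule ccontr)
    assume n: "\<not> a2 \<le> a1"
    have "a2 \<le> b1" using lh lo' unfolding hi_def by linarith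
    then have "a2 - a1 - 1 < b1 - a1" "a1 + 1 + (a2 - a1 - 1) = a2" "z1 + (a2 - a1 - 1) = z2 - 1" "z2 \<noteq> 0"
      using n z by linarith+
    moreover from this have "w (z1 + (a2 - a1 - 1)) = w (a1 + 1 + (a2 - a1 - 1))" using c1 by blast
    ultimately have "w (z2 - 1) = w a2" "z2 \<noteq> 0" by metis+
    then show False using c2 by blast
  qed
  ultimately show ?thesis by blast
qed

lemma div_eq_close:
  fixes x y c :: nat
  assumes "x div c = y div c" "0 < c" shows "x \<le> y + c"
proof -
  have "x = x div c * c + x mod c" by (rule div_mult_mod_eq[symmetric])
  moreover have "x mod c < c" using assms by simp
  moreover have "x div c * c \<le> y" unfolding assms(1) by simp
  ultimately show ?thesis by linarith
qed

text \<open>The extra \<open>2 * c\<close> compared with \<open>crit_unique_le\<close> allows the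
  two words to exchange roles, since their lengths differ by at most that much.\<close>

lemma crit_unique:
  assumes noexp: "\<And>i e \<pi>. 0 < \<pi> \<Longrightarrow> per w i e \<pi> \<Longrightarrow> e - i < E * \<pi>"
    and c: "crit w a1 b1 y1 z1" "crit w a2 b2 y2 z2"
    and div: "a1 div c = a2 div c" "b1 div c = b2 div c" "y1 div c = y2 div c" "z1 div c = z2 div c"
    and c0: "0 < c" and long: "(2 * E + 6) * c + 1 \<le> b1 - a1"
  shows "a1 = a2 \<and> b1 = b2"
proof -
  note cl = div_eq_close[OF div(1) c0] div_eq_close[OF div(1)[symmetric] c0]
    div_eq_close[OF div(2) c0] div_eq_close[OF div(2)[symmetric] c0]
    div_eq_close[OF div(3) c0] div_eq_close[OF div(3)[symmetric] c0]
    div_eq_close[OF div(4) c0] div_eq_close[OF div(4)[symmetric] c0]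
  have ll: "(2 * E + 6) * c = (2 * E + 4) * c + 2 * c" by (simp add: algebra_simps)
  have "a2 \<le> a1 \<and> b2 \<le> b1"
    by (rule crit_unique_le[OF noexp c(1) c(2), where c = c]) (use cl long ll in linarith)+
  moreover have "a1 \<le> a2 \<and> b1 \<le> b2"
    by (rule crit_unique_le[OF noexp c(2) c(1), where c = c]) (use cl long ll in linarith)+
  ultimately show ?thesis by auto
qed

context autword begin

lemma appear_ex: "\<exists>i'. i' < k ^ (s * s + j) \<and> (\<forall>u \<le> k ^ j. w (i' + u) = w (i + u))"
  by (rule appear[of i j]) (intro exI conjI allI impI, assumption, simp)

text \<open>Brings all coordinates below a fixed multiple of \<open>k ^ j\<close>, so that finitely
  many grid cells are enough.\<close>

lemma crit_relocate:
  assumes c: "crit w a b y z" and j: "b - a < k ^ j"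
  obtains a' y' z' where "crit w a' (a' + (b - a)) y' z'" "a' < k ^ (s * s + j)" "y' < k ^ (s * s + j)"
    "z' \<le> k ^ (s * s + j)" "\<And>u. u \<le> b - a \<Longrightarrow> w (a' + u) = w (a + u)"
proof -
  note c = c[unfolded crit_iff]
  obtain a' where a': "a' < k ^ (s * s + j)" "\<forall>u \<le> k ^ j. w (a' + u) = w (a + u)"
    using appear_ex[of j a] by blast
  obtain y' where y': "y' < k ^ (s * s + j)" "\<forall>u \<le> k ^ j. w (y' + u) = w (y + u)"
    using appear_ex[of j y] by blast
  have wa: "w (a' + u) = w (a + u)" if "u \<le> b - a" for u using a'(2)[rule_format, of u] that j by simp
  have wa0: "w a' = w a" using wa[of 0] by simp
  have "a + (b - a) = b" using c by linarith
  then have wb: "w (a' + (b - a)) = w b" using wa[of "b - a"] by simp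
  have "\<exists>z' \<le> k ^ (s * s + j). (\<forall>u < b - a. w (z' + u) = w (a + 1 + u)) \<and> (z' = 0 \<or> w (z' - 1) \<noteq> w a)"
  proof (cases "z = 0")
    case True
    then show ?thesis using c by (intro exI[of _ 0]) simp
  next
    case False
    \<comment> \<open>The window starts one letter before \<open>z\<close> to carry the mismatch
      along; hence \<open>z'\<close> may attain the bound.\<close>
    obtain x where x: "x < k ^ (s * s + j)" "\<forall>u \<le> k ^ j. w (x + u) = w (z - 1 + u)"
      using appear_ex[of j "z - 1"] by blast
    have "w (x + 1 + u) = w (a + 1 + u)" if "u < b - a" for u
    proof -
      have "w (x + (1 + u)) = w (z - 1 + (1 + u))" by (rule x(2)[rule_format]) (use that j in simp)
      also have "z - 1 + (1 + u) = z + u" using False by simp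
      also have "w (z + u) = w (a + 1 + u)" using c that by blast
      finally show ?thesis by (simp add: add.assoc)
    qed
    moreover have "w (x + 0) = w (z - 1 + 0)" by (rule x(2)[rule_format]) simp
    then have "w x \<noteq> w a" using c False by simp
    ultimately show ?thesis using x(1) by (intro exI[of _ "x + 1"]) simp
  qed
  then obtain z' where z': "z' \<le> k ^ (s * s + j)" "\<forall>u < b - a. w (z' + u) = w (a + 1 + u)" "z' = 0 \<or> w (z' - 1) \<noteq> w a"
    by blast
  have "crit w a' (a' + (b - a)) y' z'"
    unfolding crit_iff add_diff_cancel_left'
  proof (intro conjI allI impI)
    have "a < b" using c by blast
    then show "a' < a' + (b - a)" by linarith
    show "w (y' + u) = w (a' + u)" if u: "u < b - a" for u
    proof -
      have "w (y' + u) = w (y + u)" by (rule y'(2)[rule_format]) (use u j in linarith)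
      also have "\<dots> = w (a + u)" using c u by blast
      also have "\<dots> = w (a' + u)" by (rule wa[symmetric]) (use u in simp)
      finally show ?thesis .
    qed
    show "w (y' + (b - a)) \<noteq> w (a' + (b - a))"
    proof -
      have "w (y' + (b - a)) = w (y + (b - a))" by (rule y'(2)[rule_format]) (use j in linarith)
      moreover have "w (y + (b - a)) \<noteq> w b" using c by blast
      ultimately show ?thesis unfolding wb by argo
    qed
    show "w (z' + u) = w (a' + 1 + u)" if u: "u < b - a" for u
    proof -
      have "w (a' + (1 + u)) = w (a + (1 + u))" by (rule wa) (use u in simp)
      moreover have "w (z' + u) = w (a + 1 + u)" using z'(2) u by blast
      ultimately show ?thesis by (simp only: add.assoc)
    qed
    show "z' = 0 \<or> w (z' - 1) \<noteq> w a'" using z'(3) wa0 by simp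
  qed
  then show thesis using that a'(1) y'(1) z'(1) wa by blast
qed

end

context radix begin

lemma pow_digit_iff:
  assumes "d < k"
  shows "(\<exists>l. k * c + d = k ^ l) \<longleftrightarrow> c = 0 \<and> d = 1 \<or> (\<exists>l. c = k ^ l) \<and> d = 0"
proof
  assume "\<exists>l. k * c + d = k ^ l"
  then obtain l where l: "k * c + d = k ^ l" by blast
  show "c = 0 \<and> d = 1 \<or> (\<exists>l. c = k ^ l) \<and> d = 0"
  proof (cases l)
    case 0
    have "c = 0"
    proof (rule ccontr)
      assume "c \<noteq> 0"
      then have "k \<le> k * c" by (cases c) auto
      moreover have "k * c + d = 1" using l 0 by simp
      ultimately show False using k2 by linarith
    qed
    then show ?thesis using l 0 by simp
  next
    case (Suc m)
    have "d = (k * c + d) mod k" using assms by simp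
    also have "\<dots> = 0" unfolding l Suc by simp
    finally have d: "d = 0" .
    then have "k * c = k * k ^ m" using l Suc by simp
    then have "c = k ^ m" by simp
    then show ?thesis using d by blast
  qed
next
  assume "c = 0 \<and> d = 1 \<or> (\<exists>l. c = k ^ l) \<and> d = 0"
  then show "\<exists>l. k * c + d = k ^ l"
  proof (elim disjE conjE exE)
    assume "c = 0" "d = 1" then show ?thesis by (intro exI[of _ 0]) simp
  next
    fix l assume "c = k ^ l" "d = 0" then show ?thesis by (intro exI[of _ "Suc l"]) simp
  qed
qed

subsection \<open>Coarse positions\<close>

text \<open>Dividing by a power of \<open>k\<close> is truncation of digits, which makes the
  quotient readable by an automaton.\<close>

definition cell :: "nat \<Rightarrow> nat \<Rightarrow> nat \<Rightarrow> bool" where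
  "cell x c \<kappa> \<longleftrightarrow> x div c = \<kappa> \<and> (\<exists>l. c = k ^ l)"

text \<open>Up to the leading digit 1 of \<open>c\<close>, the value of \<open>x\<close> is
  accumulated and cut off at \<open>\<kappa> + 1\<close>; the quotient is frozen while zeros of
  \<open>c\<close> follow, and any other digit of \<open>c\<close> is fatal.\<close>

lemma recog_cell:
  assumes "\<kappa> < M" shows "recog (2 * M + 5) (\<lambda>e. cell (e a) (e c) \<kappa>)"
proof -
  define g :: "nat \<Rightarrow> nat \<Rightarrow> nat \<times> nat" where "g x y = (if y = 0 then (0, min x (\<kappa> + 1)) else if \<exists>l. y = k ^ l then (1, min (x div y) (\<kappa> + 1)) else (2, 0))" for x y
  have mn: "min (k * x + d) (\<kappa> + 1) = min (k * x' + d) (\<kappa> + 1)" if "min x (\<kappa> + 1) = min x' (\<kappa> + 1)" for x x' d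
  proof (cases "x = x'")
    case False
    then have "\<kappa> + 1 \<le> x" "\<kappa> + 1 \<le> x'" using that by linarith+
    moreover have "1 * z \<le> k * z" for z by (intro mult_right_mono) auto
    ultimately have "\<kappa> + 1 \<le> k * x" "\<kappa> + 1 \<le> k * x'" by (metis le_trans mult_1)+
    then show ?thesis by simp
  qed simp
  have np: "\<not> (\<exists>l. (0::nat) = k ^ l)" by (metis kpow_pos less_irrefl)
  have g_step: "g (k * x + d) (k * y + f) = g (k * x' + d) (k * y' + f)" if eq: "g x y = g x' y'" and df: "d < k" "f < k" for x y x' y' d f
  proof -
    note pd = pow_digit_iff[OF df(2)]
    consider "y = 0" "y' = 0" "min x (\<kappa> + 1) = min x' (\<kappa> + 1)"
      | "y \<noteq> 0" "y' \<noteq> 0" "\<exists>l. y = k ^ l" "\<exists>l. y' = k ^ l" "min (x div y) (\<kappa> + 1) = min (x' div y') (\<kappa> + 1)"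
      | "y \<noteq> 0" "y' \<noteq> 0" "\<not> (\<exists>l. y = k ^ l)" "\<not> (\<exists>l. y' = k ^ l)"
      using eq unfolding g_def by (auto split: if_splits)
    then show ?thesis
    proof cases
      case 1
      then show ?thesis unfolding g_def pd using mn[OF 1(3), of d] np by simp
    next
      case 2
      have dd: "(k * x + d) div (k * y) = x div y" for x y
        using df(1) by (simp add: div_mult2_eq)
      show ?thesis
      proof (cases "f = 0")
        case True
        then show ?thesis unfolding g_def pd using 2 dd by simp
      next
        case False
        then show ?thesis unfolding g_def pd using 2(1,2) by simp
      qed
    next
      case 3
      then show ?thesis unfolding g_def pd by simp
    qed
  qed
  show ?thesis
  proof (rule recogI[where T = "\<lambda>e. g (e a) (e c)" and X = "{0, 1} \<times> {..\<kappa> + 1} \<union> {(2, 0)}"])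
    fix e e' d :: "nat \<Rightarrow> nat" assume eq: "g (e a) (e c) = g (e' a) (e' c)" and d: "\<And>v. d v < k"
    show "g (k * e a + d a) (k * e c + d c) = g (k * e' a + d a) (k * e' c + d c)"
      by (rule g_step[OF eq d d])
  next
    fix e show "g (e a) (e c) \<in> {0, 1} \<times> {..\<kappa> + 1} \<union> {(2, 0)}" by (simp add: g_def)
  next
    have "card ({0::nat, 1} \<times> {..\<kappa> + 1} \<union> {(2, 0)}) \<le> card ({0::nat, 1} \<times> {..\<kappa> + 1}) + card {(2::nat, 0::nat)}"
      by (rule card_Un_le)
    also have "\<dots> \<le> 2 * M + 5" using assms by (simp add: card_cartesian_product)
    finally show "card ({0::nat, 1} \<times> {..\<kappa> + 1} \<union> {(2, 0)}) \<le> 2 * M + 5" .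
  next
    fix e e' assume *: "g (e a) (e c) = g (e' a) (e' c)" and **: "cell (e a) (e c) \<kappa>"
    have ne: "\<exists>l. e c = k ^ l" "e a div e c = \<kappa>" using ** unfolding cell_def by blast+
    then have "e c \<noteq> 0" by (elim exE) simp
    then have "g (e a) (e c) = (1, \<kappa>)" unfolding g_def using ne by simp
    then have "g (e' a) (e' c) = (1, \<kappa>)" using * by simp
    then show "cell (e' a) (e' c) \<kappa>" unfolding g_def cell_def by (auto split: if_splits simp: min_def)
  qed simp
qed

text \<open>Reducing the entries makes every list a legal digit string, so the classes below are
  defined on all lists.\<close>

definition kv :: "nat list \<Rightarrow> nat" where "kv ds = kval (map (\<lambda>d. d mod k) ds)"

lemma kv_append: "kv (xs @ ys) = kv xs * k ^ length ys + kv ys"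
  by (simp add: kv_def kval_append)

lemma kv_single[simp]: "kv [d] = d mod k"
  using kval_snoc[of "[]" "d mod k"] by (simp add: kv_def)

lemma kv_less: "kv ds < k ^ length ds"
  using kval_less[of "map (\<lambda>d. d mod k) ds"] unfolding kv_def by (simp add: in_lists_conv_set)

text \<open>The power \<open>k ^ l\<close> marks a cut in the digits of \<open>p\<close>: its digit
  1 faces the last digit of the left part. If one \<open>p\<close> serves many levels, two cuts have
  equal classes, and repeating the loop between them serves a whole progression of levels.\<close>

lemma recog_pump_levels:
  assumes rec: "recog N (\<lambda>e. Th (e 0) (e 1))" and P: "0 < P"
    and J: "card J > N * N * 2 ^ N" "\<And>l. l \<in> J \<Longrightarrow> l mod P = \<rho> \<and> Th p (k ^ l)"
  shows "\<exists>r m. 0 < r \<and> r \<le> N * N * 2 ^ N \<and> m < 2 ^ N * P \<and> m mod P = \<rho> \<and>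
    (\<forall>h. \<exists>p < k ^ (N * N + r * h + m). \<forall>t \<le> h. Th p (k ^ (m + r * t)))"
proof -
  obtain T where T: "cong_fun T" "\<forall>e. T e < N" "\<forall>e e'. T e = T e' \<longrightarrow> Th (e 0) (e 1) = Th (e' 0) (e' 1)"
    using rec unfolding recog_def by (elim exE conjE)
  define en :: "nat \<Rightarrow> nat \<Rightarrow> nat \<Rightarrow> nat" where "en x y v = (if v = 0 then x else y)" for x y v
  define tt where "tt x y = T (en x y)" for x y
  have tt_less: "tt x y < N" for x y using T(2) by (simp add: tt_def)
  have tt_step: "tt (x * k ^ m + f) (y * k ^ m + g) = tt (x' * k ^ m + f) (y' * k ^ m + g)"
    if "tt x y = tt x' y'" "f < k ^ m" "g < k ^ m" for x y x' y' m f g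
  proof -
    have "T (\<lambda>v. en x y v * k ^ m + en f g v) = T (\<lambda>v. en x' y' v * k ^ m + en f g v)"
      by (rule env_step[OF T(1), of "en x y" "en x' y'" "en f g" m]) (use that in \<open>simp_all add: tt_def en_def\<close>)
    moreover have "(\<lambda>v. en x y v * k ^ m + en f g v) = en (x * k ^ m + f) (y * k ^ m + g)" for x y
      by (rule ext) (simp add: en_def)
    ultimately show ?thesis unfolding tt_def by simp
  qed
  have tt_Th: "Th x y = Th x' y'" if "tt x y = tt x' y'" for x y x' y'
    using T(3)[rule_format, of "en x y" "en x' y'"] that unfolding tt_def en_def by simp
  \<comment> \<open>The second component is the state when the 1 of the power has just been read;
    the first is needed to extend the left part by further digits.\<close>
  define A where "A ds = (tt (kv ds) 0, tt (kv ds) 1)" for ds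
  define B where "B ds = {\<sigma>. \<exists>x y. tt x y = \<sigma> \<and> Th (x * k ^ length ds + kv ds) (y * k ^ length ds)}" for ds
  have congA: "A (xs @ us) = A (ys @ us)" if "A xs = A ys" for xs ys us
  proof (induction us rule: rev_induct)
    case Nil then show ?case using that by simp
  next
    case (snoc d us)
    have eq: "tt (kv (xs @ us)) 0 = tt (kv (ys @ us)) 0" using snoc unfolding A_def by simp
    have kv: "kv (zs @ us @ [d]) = kv (zs @ us) * k ^ 1 + d mod k" for zs
      using kv_append[of "zs @ us" "[d]"] by simp
    have "tt (kv (xs @ us) * k ^ 1 + d mod k) (0 * k ^ 1 + 0) = tt (kv (ys @ us) * k ^ 1 + d mod k) (0 * k ^ 1 + 0)"
      by (rule tt_step[OF eq]) simp_all
    moreover have "tt (kv (xs @ us) * k ^ 1 + d mod k) (0 * k ^ 1 + 1) = tt (kv (ys @ us) * k ^ 1 + d mod k) (0 * k ^ 1 + 1)"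
      by (rule tt_step[OF eq]) simp_all
    ultimately show ?case unfolding A_def kv by simp
  qed
  have memB: "tt x y \<in> B ds \<longleftrightarrow> Th (x * k ^ length ds + kv ds) (y * k ^ length ds)" for x y ds
  proof
    assume "tt x y \<in> B ds"
    then obtain x' y' where xy: "tt x' y' = tt x y" "Th (x' * k ^ length ds + kv ds) (y' * k ^ length ds)"
      unfolding B_def by (elim CollectE exE conjE)
    have "tt (x' * k ^ length ds + kv ds) (y' * k ^ length ds + 0) = tt (x * k ^ length ds + kv ds) (y * k ^ length ds + 0)"
      by (rule tt_step[OF xy(1)]) (simp_all add: kv_less)
    then show "Th (x * k ^ length ds + kv ds) (y * k ^ length ds)" using tt_Th xy(2) by (metis add_0_right)
  next
    assume "Th (x * k ^ length ds + kv ds) (y * k ^ length ds)"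
    then show "tt x y \<in> B ds" unfolding B_def by (intro CollectI exI[of _ x] exI[of _ y] conjI refl)
  qed
  have congB: "B (us @ xs) = B (us @ ys)" if "B xs = B ys" for xs ys us
  proof (induction us)
    case Nil then show ?case using that by simp
  next
    case (Cons d us)
    have kvc: "kv ((d # us) @ zs) = (d mod k) * k ^ length (us @ zs) + kv (us @ zs)" for zs
      using kv_append[of "[d]" "us @ zs"] by simp
    have "B ((d # us) @ zs) = {\<sigma>. \<exists>x y. tt x y = \<sigma> \<and> tt (x * k + d mod k) (y * k) \<in> B (us @ zs)}" for zs
    proof -
      have e1: "x * k ^ length ((d # us) @ zs) + kv ((d # us) @ zs) = (x * k + d mod k) * k ^ length (us @ zs) + kv (us @ zs)"
        and e2: "y * k ^ length ((d # us) @ zs) = y * k * k ^ length (us @ zs)" for x y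
        unfolding kvc by (simp_all add: algebra_simps)
      show ?thesis unfolding memB unfolding B_def unfolding e1 unfolding e2 by (rule refl)
    qed
    then show ?case using Cons by simp
  qed
  have rA: "range A \<subseteq> {..<N} \<times> {..<N}" using tt_less by (auto simp: A_def)
  have cA: "card (range A) \<le> N * N" using card_mono[OF _ rA] by (simp add: card_cartesian_product)
  have fA: "finite (range A)" using rA finite_subset by blast
  have rB: "range B \<subseteq> Pow {..<N}" using tt_less by (auto simp: B_def)
  have cB: "card (range B) \<le> 2 ^ N" using card_mono[OF _ rB] by (simp add: card_Pow)
  have fB: "finite (range B)" using rB finite_subset by blast
  define S where "S \<alpha> \<beta> \<longleftrightarrow> snd \<alpha> \<in> \<beta>" for \<alpha> :: "nat \<times> nat" and \<beta> :: "nat set"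
  have S_iff: "S (A xs) (B ys) \<longleftrightarrow> Th (kv (xs @ ys)) (k ^ length ys)" for xs ys
    unfolding S_def A_def snd_conv memB kv_append by simp
  have finJ: "finite J" using J(1) card.infinite by fastforce
  define L where "L = p + Max (insert 0 J)"
  have "p < k ^ L" using less_kpow[of p] kpow_le_iff[of p L] unfolding L_def by linarith
  have JL: "J \<subseteq> {..L}" using finJ unfolding L_def by (auto intro: trans_le_add2)
  obtain z where z: "z \<in> lists {..<k}" "length z = L" "kval z = p" by (rule kval_surj[OF \<open>p < k ^ L\<close>])
  have "map (\<lambda>d. d mod k) z = z" using z(1) by (induction z) auto
  then have kvz: "kv z = p" using z(3) by (simp add: kv_def)
  have Slev: "S (A (take (length z - j) z)) (B (drop (length z - j) z)) \<and> j mod P = \<rho>" if "j \<in> J" for j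
  proof -
    have "j \<le> L" using that JL by auto
    then have "length (drop (length z - j) z) = j" using z(2) by simp
    then show ?thesis unfolding S_iff append_take_drop_id using J(2)[OF that] kvz by simp
  qed
  have cJ: "card (range A) * card (range B) < card J"
    using mult_le_mono[OF cA cB] J(1) by linarith
  obtain x u v where xuv: "u \<noteq> []"
    "A (x @ u) = A x" "B (u @ v) = B v" "S (A x) (B v)" "length v mod P = \<rho>"
    "length x < card (range A)" "length u \<le> card (range A) * card (range B)" "length v < card (range B) * P"
    apply (rule pump_factorization[where A = A and B = B and S = S and D = UNIV and z = z and J = J and P = P and \<rho> = \<rho>])
    apply (erule congA)
    apply (erule congB)
    apply (rule fA)
    apply (rule fB)
    apply (rule P)
    apply simp
    apply (simp only: z(2) JL)
    apply (rule cJ)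
    apply (erule Slev)
    apply (rule that; assumption)
    done
  show ?thesis
  proof (rule exI[of _ "length u"], rule exI[of _ "length v"], intro conjI allI)
    show "0 < length u" using xuv(1) by simp
    show "length u \<le> N * N * 2 ^ N" using xuv(7) mult_le_mono[OF cA cB] by linarith
    show "length v < 2 ^ N * P" using xuv(8) cB by (meson less_le_trans mult_le_mono1)
    show "length v mod P = \<rho>" by (rule xuv(5))
    fix h
    let ?p = "kv (x @ concat (replicate h u) @ v)"
    have len: "length (concat (replicate t u)) = length u * t" for t
      by (induction t) simp_all
    have "?p < k ^ length (x @ concat (replicate h u) @ v)" by (rule kv_less)
    also have "\<dots> \<le> k ^ (N * N + length u * h + length v)"
      unfolding kpow_le_iff using xuv(6) cA by (simp add: len)
    finally have p: "?p < k ^ (N * N + length u * h + length v)" .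
    have "Th ?p (k ^ (length v + length u * t))" if "t \<le> h" for t
    proof -
      have "replicate h u = replicate (h - t) u @ replicate t u" using that by (simp flip: replicate_add)
      then have eq: "x @ concat (replicate h u) @ v = (x @ concat (replicate (h - t) u)) @ (concat (replicate t u) @ v)" by simp
      have "A (x @ concat (replicate (h - t) u)) = A x"
        by (rule pump_iterate(1)[of A B x u v], erule congA, erule congB, rule xuv(2), rule xuv(3))
      moreover have "B (concat (replicate t u) @ v) = B v"
        by (rule pump_iterate(2)[of A B x u v], erule congA, erule congB, rule xuv(2), rule xuv(3))
      ultimately have "S (A (x @ concat (replicate (h - t) u))) (B (concat (replicate t u) @ v))"
        using xuv(4) by (simp only:)
      then have "Th (kv ((x @ concat (replicate (h - t) u)) @ (concat (replicate t u) @ v))) (k ^ length (concat (replicate t u) @ v))"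
        unfolding S_iff .
      moreover have "length (concat (replicate t u) @ v) = length v + length u * t" by (simp add: len)
      ultimately show ?thesis unfolding eq by (simp only:)
    qed
    then show "\<exists>p < k ^ (N * N + length u * h + length v). \<forall>t \<le> h. Th p (k ^ (length v + length u * t))"
      using p by blast
  qed
qed

text \<open>The orbit is on a cycle after at most \<open>N\<close> steps, and the cycle has a length
  at most \<open>N\<close>, which divides \<open>P\<close>.\<close>

lemma orbit_periodic:
  fixes f :: "nat \<Rightarrow> nat"
  assumes "\<And>l. f l < N" "\<And>l m. f l = f m \<Longrightarrow> f (Suc l) = f (Suc m)"
    and P: "\<And>q. 0 < q \<Longrightarrow> q \<le> N \<Longrightarrow> q dvd P" and l: "N \<le> l"
  shows "f (l + P * m) = f l"
proof -
  have "card {..<N} < card {0..N}" by simp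
  then obtain a b where ab: "a \<in> {0..N}" "b \<in> {0..N}" "a < b" "f a = f b"
    using pigeonhole_seq[of "{..<N}" "{0..N}" f] assms(1) by blast
  define q where "q = b - a"
  have q: "0 < q" "q \<le> N" "f (a + q) = f a" using ab by (auto simp: q_def)
  have 1: "f (x + q) = f x" if "a \<le> x" for x
    using that
  proof (induction x rule: dec_induct)
    case base then show ?case by (rule q(3))
  next
    case (step x)
    then show ?case using assms(2)[of "x + q" x] by simp
  qed
  have 2: "f (x + q * t) = f x" if "a \<le> x" for x t
  proof (induction t)
    case (Suc t)
    have "f (x + q * t + q) = f (x + q * t)" by (rule 1) (use that in simp)
    then show ?case using Suc by (simp add: algebra_simps)
  qed simp
  obtain r where r: "P = q * r" using P[OF q(1,2)] by (elim dvdE)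
  have "f (l + q * (r * m)) = f l" by (rule 2) (use l ab in simp)
  then show ?thesis unfolding r by (simp add: mult.assoc)
qed

lemma recog_pow_periodic:
  assumes "recog N (\<lambda>e. X (e 0))" "\<And>q. 0 < q \<Longrightarrow> q \<le> N \<Longrightarrow> q dvd P" "N \<le> l"
  shows "X (k ^ (l + P * m)) = X (k ^ l)"
proof -
  obtain T where T: "cong_fun T" "\<forall>e. T e < N" "\<forall>e e'. T e = T e' \<longrightarrow> X (e 0) = X (e' 0)"
    using assms(1) unfolding recog_def by (elim exE conjE)
  have "T (\<lambda>_. k ^ (l + P * m)) = T (\<lambda>_. k ^ l)"
  proof (rule orbit_periodic[where f = "\<lambda>l. T (\<lambda>_. k ^ l)" and N = N])
    fix l m assume "T (\<lambda>_. k ^ l) = T (\<lambda>_. k ^ m)"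
    from cong_funD[OF T(1), of "\<lambda>_. k ^ l" "\<lambda>_. k ^ m" "\<lambda>_. 0", OF this]
    show "T (\<lambda>_. k ^ Suc l) = T (\<lambda>_. k ^ Suc m)" by simp
  qed (use T(2) assms(2,3) in simp_all)
  then show ?thesis using T(3)[rule_format, of "\<lambda>_. k ^ (l + P * m)" "\<lambda>_. k ^ l"] by simp
qed

end

context autword begin

lemma recog_crit: "recog Ncrit (\<lambda>e. crit w (e 2) (e 3) (e 4) (e 5))"
proof -
  have 2: "recog Nmatch (\<lambda>e. \<forall>x v. e 2 \<le> x \<longrightarrow> x < e 3 \<longrightarrow> x + e 4 = v + e 2 \<longrightarrow> w x = w v)"
    unfolding Nmatch_of_def by (rule recog_all_var[where x = 6], rule recog_all_var[where x = 7],
      intro recog_imp recog_le recog_less recog_sum_eq recog_w_eq) simp_all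
  have 3: "recog Nbreak (\<lambda>e. \<exists>t. e 3 + e 4 = t + e 2 \<and> w (e 3) \<noteq> w t)"
    unfolding Nbreak_of_def by (rule recog_ex_var[where x = 6], intro recog_and recog_not recog_sum_eq recog_w_eq) simp_all
  have 4: "recog Nmatch (\<lambda>e. \<forall>x v. e 2 < x \<longrightarrow> x \<le> e 3 \<longrightarrow> x + e 5 = Suc (v + e 2) \<longrightarrow> w x = w v)"
    unfolding Nmatch_of_def by (rule recog_all_var[where x = 6], rule recog_all_var[where x = 7],
      intro recog_imp recog_le recog_less recog_sum_eq_Suc recog_w_eq) simp_all
  have 5: "recog Nbreak (\<lambda>e. \<exists>t. Suc t = e 5 \<and> w t \<noteq> w (e 2))"
    unfolding Nbreak_of_def by (rule recog_ex_var[where x = 6], intro recog_and recog_not recog_Suc_eq recog_w_eq) simp_all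
  show ?thesis unfolding crit_def Ncrit_of_def
    apply (rule recog_and[OF recog_less])
    apply (rule recog_and[OF 2])
    apply (rule recog_and[OF 3])
    apply (rule recog_and[OF 4])
    apply (rule recog_or[OF recog_eq0])
    apply (rule 5)
    done
qed

subsection \<open>Bounded or logarithmic growth\<close>

text \<open>The relation \<open>cov\<close> without subtraction; by \<open>cov_alt\<close> they
  agree for \<open>a \<le> b\<close>.\<close>

definition hits :: "nat \<Rightarrow> nat \<Rightarrow> nat \<Rightarrow> bool" where
  "hits p a b \<longleftrightarrow> (\<exists>q. q \<le> p \<and> p + a \<le> q + b \<and>
     (\<forall>x v. a \<le> x \<longrightarrow> x \<le> b \<longrightarrow> x + q = v + a \<longrightarrow> w x = w v))"

lemma recog_hits: "recog Ncov (\<lambda>e. hits (e 0) (e 2) (e 3))"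
proof -
  have 1: "recog Nmatch (\<lambda>e. \<forall>x v. e 2 \<le> x \<longrightarrow> x \<le> e 3 \<longrightarrow> x + e 8 = v + e 2 \<longrightarrow> w x = w v)"
    unfolding Nmatch_of_def by (rule recog_all_var[where x = 6], rule recog_all_var[where x = 7],
      intro recog_imp recog_le recog_sum_eq recog_w_eq) simp_all
  have 2: "recog (5 * (5 * Nmatch)) (\<lambda>e. e 8 \<le> e 0 \<and> e 0 + e 2 \<le> e 8 + e 3 \<and>
     (\<forall>x v. e 2 \<le> x \<longrightarrow> x \<le> e 3 \<longrightarrow> x + e 8 = v + e 2 \<longrightarrow> w x = w v))"
    by (rule recog_and[OF recog_le], rule recog_and[OF recog_sum_le], rule 1)
  show ?thesis unfolding hits_def Ncov_of_def
    by (rule recog_ex_var[where x = 8], rule 2) simp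
qed

text \<open>With bounded exponents the cells determine any critical word that is long compared with
  \<open>c\<close>. Service of a particular word thus becomes a predicate of \<open>p\<close> and
  the scale \<open>c\<close> alone, as \<open>Theta_crit\<close> makes precise.\<close>

definition Theta :: "nat \<Rightarrow> nat \<Rightarrow> nat \<Rightarrow> nat \<Rightarrow> nat \<Rightarrow> nat \<Rightarrow> bool" where
  "Theta k1 k2 k3 k4 p c \<longleftrightarrow> (\<exists>a b y z. crit w a b y z \<and> hits p a b \<and>
     cell a c k1 \<and> cell b c k2 \<and> cell y c k3 \<and> cell z c k4)"

lemma recog_Theta:
  assumes "k1 < M" "k2 < M" "k3 < M" "k4 < M"
  shows "recog (NTheta M) (\<lambda>e. Theta k1 k2 k3 k4 (e 0) (e 1))"
proof -
  define C where "C = 2 * M + 5"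
  have rc: "\<kappa> < M \<Longrightarrow> recog C (\<lambda>e. cell (e a) (e c) \<kappa>)" for \<kappa> a c unfolding C_def by (rule recog_cell)
  have 5: "recog (Ncrit * (Ncov * (C * (C * (C * C))))) (\<lambda>e. crit w (e 2) (e 3) (e 4) (e 5) \<and> hits (e 0) (e 2) (e 3) \<and>
      cell (e 2) (e 1) k1 \<and> cell (e 3) (e 1) k2 \<and> cell (e 4) (e 1) k3 \<and> cell (e 5) (e 1) k4)"
    by (rule recog_and[OF recog_crit], rule recog_and[OF recog_hits], rule recog_and[OF rc[OF assms(1)]],
      rule recog_and[OF rc[OF assms(2)]], rule recog_and[OF rc[OF assms(3)]], rule rc[OF assms(4)])
  have 4: "recog (2 ^ (Ncrit * (Ncov * (C * (C * (C * C)))))) (\<lambda>e. \<exists>z. crit w (e 2) (e 3) (e 4) z \<and> hits (e 0) (e 2) (e 3) \<and>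
      cell (e 2) (e 1) k1 \<and> cell (e 3) (e 1) k2 \<and> cell (e 4) (e 1) k3 \<and> cell z (e 1) k4)"
    by (rule recog_ex_var[where x = 5], rule 5) simp
  have 3: "recog (2 ^ (2 ^ (Ncrit * (Ncov * (C * (C * (C * C))))))) (\<lambda>e. \<exists>y z. crit w (e 2) (e 3) y z \<and> hits (e 0) (e 2) (e 3) \<and>
      cell (e 2) (e 1) k1 \<and> cell (e 3) (e 1) k2 \<and> cell y (e 1) k3 \<and> cell z (e 1) k4)"
    by (rule recog_ex_var[where x = 4], rule 4) simp
  have 2: "recog (2 ^ (2 ^ (2 ^ (Ncrit * (Ncov * (C * (C * (C * C)))))))) (\<lambda>e. \<exists>b y z. crit w (e 2) b y z \<and> hits (e 0) (e 2) b \<and>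
      cell (e 2) (e 1) k1 \<and> cell b (e 1) k2 \<and> cell y (e 1) k3 \<and> cell z (e 1) k4)"
    by (rule recog_ex_var[where x = 3], rule 3) simp
  show ?thesis unfolding Theta_def NTheta_of_def C_def[symmetric]
    by (rule recog_ex_var[where x = 2], rule 2) simp
qed

lemma Theta_crit:
  assumes noexp: "\<And>i e \<pi>. 0 < \<pi> \<Longrightarrow> per w i e \<pi> \<Longrightarrow> e - i < E * \<pi>"
    and th: "Theta (a div c) (b div c) (y div c) (z div c) p c" and cr: "crit w a b y z"
    and long: "(2 * E + 6) * c + 1 \<le> b - a"
  shows "cov w p a b"
proof -
  obtain a' b' y' z' where t: "crit w a' b' y' z'" "hits p a' b'"
    "cell a' c (a div c)" "cell b' c (b div c)" "cell y' c (y div c)" "cell z' c (z div c)"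
    using th unfolding Theta_def by (elim exE conjE)
  have c0: "0 < c" using t(3) unfolding cell_def by (elim conjE exE) simp
  have "a = a' \<and> b = b'"
    using crit_unique[OF noexp cr t(1) _ _ _ _ c0 long] t unfolding cell_def by simp
  then have ab: "a' = a" "b' = b" by auto
  have "a \<le> b" using cr unfolding crit_def by simp
  show ?thesis using t(2) unfolding ab hits_def cov_alt[OF \<open>a \<le> b\<close>] .
qed

text \<open>A critical word in these cells at level \<open>l\<close> has counterparts at all levels
  \<open>l + P * m\<close>, by periodicity along powers of \<open>k\<close>. They are tasks with
  geometrically growing ends; in the absence of logarithmic growth some position serves more than
  \<open>N * N * 2 ^ N\<close> levels and can be pumped.\<close>

lemma Theta_persist:
  assumes nolog: "\<not> log_growth w" and kM: "k1 < M" "k2 < M" "k3 < M" "k4 < M"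
    and N: "N = NTheta M" and P: "P = fact (N * N * 2 ^ N)"
    and l: "2 ^ N \<le> l" and ex: "Theta k1 k2 k3 k4 p0 (k ^ l)"
  shows "\<exists>r m. 0 < r \<and> r \<le> N * N * 2 ^ N \<and> m < 2 ^ N * P \<and> m mod P = l mod P \<and>
    (\<forall>h. \<exists>p < k ^ (N * N + r * h + m). \<forall>t \<le> h. Theta k1 k2 k3 k4 p (k ^ (m + r * t)))"
proof -
  let ?Th = "Theta k1 k2 k3 k4"
  note rec = recog_Theta[OF kM, folded N]
  have N1: "1 \<le> N" unfolding N NTheta_of_def by simp
  have N2: "2 ^ N \<le> N * N * 2 ^ N" using N1 by simp
  have Pdvd: "q dvd P" if "0 < q" "q \<le> N * N * 2 ^ N" for q
    unfolding P using that by (intro dvd_fact) auto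
  have P0: "0 < P" unfolding P by simp
  \<comment> \<open>Projecting \<open>p\<close> away costs an exponential, which is the origin of
    the condition \<open>2 ^ N \<le> l\<close>.\<close>
  have recX: "recog (2 ^ N) (\<lambda>e. \<exists>p. ?Th p (e 0))"
  proof -
    have "recog N (\<lambda>e. ?Th (e 1) (e 0))"
      using recog_rename[OF rec, of "\<lambda>v. if v = 0 then 1 else 0"] by simp
    then show ?thesis by (rule recog_ex_var[where x = 1]) simp
  qed
  have exm: "\<exists>p. ?Th p (k ^ (l + P * m))" for m
  proof -
    have "(\<exists>p. ?Th p (k ^ (l + P * m))) = (\<exists>p. ?Th p (k ^ l))"
      by (rule recog_pow_periodic[OF recX _ l], rule Pdvd, assumption, erule le_trans[OF _ N2])
    then show ?thesis using ex by blast
  qed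
  then have "\<forall>m. \<exists>a b. a \<le> b \<and> b < k ^ (M + l + P * m) \<and> (\<forall>p. cov w p a b \<longrightarrow> ?Th p (k ^ (l + P * m)))"
  proof (intro allI)
    fix m
    obtain p where "?Th p (k ^ (l + P * m))" using exm by blast
    then obtain a b y z where t: "crit w a b y z" "cell a (k ^ (l + P * m)) k1" "cell b (k ^ (l + P * m)) k2"
      "cell y (k ^ (l + P * m)) k3" "cell z (k ^ (l + P * m)) k4" unfolding Theta_def by (elim exE conjE)
    have ab: "a \<le> b" using t(1) unfolding crit_def by simp
    have "b div k ^ (l + P * m) < k ^ M" using t(3) kM(2) less_kpow[of M] unfolding cell_def by linarith
    then have "b div k ^ (l + P * m) * k ^ (l + P * m) + b mod k ^ (l + P * m) < k ^ (M + (l + P * m))"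
      by (intro mult_add_less_pow) simp_all
    then have "b < k ^ (M + l + P * m)" unfolding div_mult_mod_eq by (simp add: add.assoc)
    moreover have "?Th p (k ^ (l + P * m))" if "cov w p a b" for p
      using that t unfolding Theta_def hits_def cov_alt[OF ab] by blast
    ultimately show "\<exists>a b. a \<le> b \<and> b < k ^ (M + l + P * m) \<and> (\<forall>p. cov w p a b \<longrightarrow> ?Th p (k ^ (l + P * m)))"
      using ab by blast
  qed
  then obtain a b where ab: "\<And>m. a m \<le> b m" "\<And>m. b m < k ^ (M + l + P * m)"
    "\<And>m p. cov w p (a m) (b m) \<Longrightarrow> ?Th p (k ^ (l + P * m))" by metis
  define H where "H = N * N * 2 ^ N"
  have H0: "0 < H" unfolding H_def using N1 by simp
  have "\<exists>p. \<not> (finite {m. ?Th p (k ^ (l + P * m))} \<and> card {m. ?Th p (k ^ (l + P * m))} \<le> H)"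
  proof (rule ccontr)
    assume "\<not> ?thesis"
    then have fin: "finite {m. ?Th p (k ^ (l + P * m))}" "card {m. ?Th p (k ^ (l + P * m))} \<le> H" for p by blast+
    have sub: "{m. cov w p (a m) (b m)} \<subseteq> {m. ?Th p (k ^ (l + P * m))}" for p using ab(3) by blast
    have "log_growth w"
    proof (rule log_growth_tasks[OF ab(1,2) P0 H0])
      fix p
      show "finite {m. cov w p (a m) (b m)}" using sub fin(1) finite_subset by blast
      show "card {m. cov w p (a m) (b m)} \<le> H" using card_mono[OF fin(1) sub] fin(2) by (rule le_trans)
    qed
    then show False using nolog by simp
  qed
  then obtain p where p: "\<not> (finite {m. ?Th p (k ^ (l + P * m))} \<and> card {m. ?Th p (k ^ (l + P * m))} \<le> H)" by blast
  obtain I where I: "I \<subseteq> {m. ?Th p (k ^ (l + P * m))}" "card I = Suc H"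
  proof (cases "finite {m. ?Th p (k ^ (l + P * m))}")
    case True
    then have "Suc H \<le> card {m. ?Th p (k ^ (l + P * m))}" using p by simp
    then show thesis using obtain_subset_with_card_n that by metis
  next
    case False
    then show thesis using infinite_arbitrarily_large that by metis
  qed
  have "card ((\<lambda>m. l + P * m) ` I) = Suc H" using I(2) P0 by (subst card_image) (auto simp: inj_on_def)
  then show ?thesis
    by (intro recog_pump_levels[OF rec P0, of "(\<lambda>m. l + P * m) ` I" "l mod P" p])
      (use I(1) in \<open>auto simp: H_def\<close>)
qed

text \<open>The number of loops is adjusted to \<open>n\<close>. The levels concerned are congruent
  modulo \<open>Pser\<close>, hence modulo the loop length \<open>r\<close>, and so belong to the
  progression that is served.\<close>

lemma persistent_position:
  assumes nolog: "\<not> log_growth w" and kM: "k1 < Mcell" "k2 < Mcell" "k3 < Mcell" "k4 < Mcell"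
  shows "\<exists>p. 2 * p \<le> n \<and> (\<forall>l p0. Lser \<le> l \<longrightarrow> l mod Pser = \<rho> \<longrightarrow> Theta k1 k2 k3 k4 p0 (k ^ l) \<longrightarrow>
     k ^ (l + Qser) \<le> n \<longrightarrow> Theta k1 k2 k3 k4 p (k ^ l))"
proof (cases "\<exists>l p0. Lser \<le> l \<and> l mod Pser = \<rho> \<and> Theta k1 k2 k3 k4 p0 (k ^ l)")
  case False
  then show ?thesis by (intro exI[of _ 0]) auto
next
  case True
  then obtain l1 p1 where l1: "Lser \<le> l1" "l1 mod Pser = \<rho>" "Theta k1 k2 k3 k4 p1 (k ^ l1)" by blast
  have P0: "0 < Pser" by (simp add: Pser_of_def)
  have "2 ^ Nser * 1 \<le> Lser" unfolding Lser_of_def by (intro mult_left_mono) (use P0 in auto)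
  then have l1N: "2 ^ Nser \<le> l1" using l1 by simp
  obtain r m where rm: "0 < r" "r \<le> Rser" "m < Lser" "m mod Pser = \<rho>"
    "\<forall>h. \<exists>p < k ^ (Nser * Nser + r * h + m). \<forall>t \<le> h. Theta k1 k2 k3 k4 p (k ^ (m + r * t))"
    using Theta_persist[OF nolog kM Nser_of_def _ l1N l1(3), of Pser] l1(2)
    unfolding Rser_of_def[symmetric] Pser_of_def[symmetric] Lser_of_def[symmetric] by blast
  show ?thesis
  proof (cases "\<exists>J. k ^ J \<le> n \<and> n < k ^ Suc J \<and> Nser * Nser + m + 1 \<le> J")
    \<comment> \<open>For such \<open>n\<close> no level satisfies
      \<open>k ^ (l + Qser) \<le> n\<close>, so any position will do.\<close>
    case False
    have "\<not> k ^ (l + Qser) \<le> n" if "Lser \<le> l" for l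
    proof
      assume le: "k ^ (l + Qser) \<le> n"
      then have "0 < n" using kpow_pos[of "l + Qser"] by linarith
      then obtain J where J: "k ^ J \<le> n" "n < k ^ Suc J" by (rule klog)
      have "l + Qser < Suc J" using le_less_trans[OF le J(2)] unfolding kpow_less_iff .
      then have "Nser * Nser + m + 1 \<le> J" using that rm(3) unfolding Qser_of_def by linarith
      then show False using False J by blast
    qed
    then show ?thesis by (intro exI[of _ 0]) auto
  next
    case True
    then obtain J where J: "k ^ J \<le> n" "n < k ^ Suc J" "Nser * Nser + m + 1 \<le> J" by blast
    define h where "h = (J - (Nser * Nser + m + 1)) div r"
    obtain p where p: "p < k ^ (Nser * Nser + r * h + m)" "\<forall>t \<le> h. Theta k1 k2 k3 k4 p (k ^ (m + r * t))"
      using rm(5) by blast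
    have "r * h \<le> J - (Nser * Nser + m + 1)" unfolding h_def by simp
    then have "Nser * Nser + r * h + m \<le> J - 1" using J(3) by linarith
    then have "k ^ (Nser * Nser + r * h + m) \<le> k ^ (J - 1)" unfolding kpow_le_iff .
    then have "2 * p \<le> 2 * k ^ (J - 1)" using p(1) by linarith
    also have "\<dots> \<le> k * k ^ (J - 1)" using k2 by (rule mult_right_mono) simp
    also have "\<dots> = k ^ J" using J(3) by (simp flip: power_Suc)
    finally have p2: "2 * p \<le> n" using J(1) by linarith
    have "Theta k1 k2 k3 k4 p (k ^ l)" if l: "Lser \<le> l" "l mod Pser = \<rho>" "k ^ (l + Qser) \<le> n" for l
    proof -
      have "l + Qser < Suc J" using le_less_trans[OF l(3) J(2)] unfolding kpow_less_iff .
      have ml: "m \<le> l" using l rm(3) by linarith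
      have "l mod Pser = m mod Pser" using l(2) rm(4) by simp
      then have "Pser dvd l - m" using mod_eq_dvd_iff_nat[OF ml, of Pser] by blast
      moreover have "r dvd Pser" unfolding Pser_of_def using rm(1,2) by (intro dvd_fact) auto
      ultimately have "r dvd l - m" by (rule dvd_trans[rotated])
      then obtain t where t: "l - m = r * t" by (elim dvdE)
      have "r * t \<le> J - (Nser * Nser + m + 1)" using t \<open>l + Qser < Suc J\<close> ml unfolding Qser_of_def by linarith
      then have "t \<le> h" unfolding h_def using rm(1) by (simp add: less_eq_div_iff_mult_less_eq mult.commute)
      then have "Theta k1 k2 k3 k4 p (k ^ (m + r * t))" using p(2) by blast
      moreover have "m + r * t = l" using t ml by linarith
      ultimately show ?thesis by simp
    qed
    then show ?thesis using p2 by (intro exI[of _ p]) blast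
  qed
qed

text \<open>Multiples of \<open>G\<close> serve the factors of length at least \<open>G\<close>, an
  initial segment serves those with a short critical word or a single forcing letter, and persistent
  positions serve the rest. Each of the three counts is independent of \<open>n\<close>.\<close>

lemma gamma_bound_no_powers:
  assumes nolog: "\<not> log_growth w"
    and noexp: "\<And>i e \<pi>. 0 < \<pi> \<Longrightarrow> per w i e \<pi> \<Longrightarrow> e - i < Eexp * \<pi>"
  shows "gamma w n \<le> 2 * k ^ (Qser + 1) + k ^ (s * s + (gcell + Lser)) + Mcell ^ 4 * Pser"
proof (cases "n < k ^ (Qser + 1)")
  case True
  then show ?thesis using gamma_le[of w n] by linarith
next
  case False
  define K where "K = k ^ (Qser + 1)"
  define B where "B = gcell + Lser"
  define G where "G = n div K"
  have K0: "0 < K" "2 \<le> K"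
  proof -
    show "0 < K" by (simp add: K_def)
    have "k ^ 1 \<le> K" unfolding K_def kpow_le_iff by simp
    then show "2 \<le> K" using k2 by simp
  qed
  have Kn: "K \<le> n" using False unfolding K_def by simp
  then have n0: "0 < n" using K0 by linarith
  have G0: "0 < G" using Kn K0 by (simp add: G_def div_greater_zero_iff)
  have GK: "G * K \<le> n" unfolding G_def by simp
  have nGK: "n < G * (2 * K)"
  proof -
    have "n < G * K + K" using mod_less_divisor[OF K0(1), of n] div_mult_mod_eq[of n K] unfolding G_def by linarith
    moreover have "1 * K \<le> G * K" using G0 by (intro mult_right_mono) auto
    moreover have "G * (2 * K) = G * K + G * K" by (simp add: algebra_simps)
    ultimately show ?thesis by linarith
  qed
  have P0: "0 < Pser" by (simp add: Pser_of_def)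
  define ok where "ok k1 k2 k3 k4 \<rho> p \<longleftrightarrow> 2 * p \<le> n \<and> (\<forall>l p0. Lser \<le> l \<longrightarrow> l mod Pser = \<rho> \<longrightarrow>
     Theta k1 k2 k3 k4 p0 (k ^ l) \<longrightarrow> k ^ (l + Qser) \<le> n \<longrightarrow> Theta k1 k2 k3 k4 p (k ^ l))" for k1 k2 k3 k4 \<rho> p
  define pp where "pp k1 k2 k3 k4 \<rho> = (SOME p. ok k1 k2 k3 k4 \<rho> p)" for k1 k2 k3 k4 \<rho>
  have pp: "ok k1 k2 k3 k4 \<rho> (pp k1 k2 k3 k4 \<rho>)" if "k1 < Mcell" "k2 < Mcell" "k3 < Mcell" "k4 < Mcell" for k1 k2 k3 k4 \<rho>
    unfolding pp_def by (rule someI_ex) (unfold ok_def, rule persistent_position[OF nolog that])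
  define S1 where "S1 = (\<lambda>t. t * G) ` {..<2 * K}"
  define S2 where "S2 = {..<k ^ (s * s + B)}"
  define S3 where "S3 = (\<lambda>(k1, k2, k3, k4, \<rho>). pp k1 k2 k3 k4 \<rho>) `
      ({..<Mcell} \<times> {..<Mcell} \<times> {..<Mcell} \<times> {..<Mcell} \<times> {..<Pser})"
  define S where "S = (S1 \<union> S2 \<union> S3) \<inter> {..<n}"
  have "attr w n S" unfolding attr_def
  proof (intro conjI allI impI)
    show "S \<subseteq> {..<n}" by (auto simp: S_def)
    fix i e assume ie: "i \<le> e" "e < n"
    show "\<exists>q p. p \<in> S \<and> q \<le> p \<and> p \<le> q + (e - i) \<and> q + (e - i) < n \<and> occ w i e q"
    proof (cases "G \<le> e - i + 1")
      case True
      define t where "t = (i + G - 1) div G"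
      have t1: "t * G \<le> i + G - 1" unfolding t_def by simp
      have "i + G - 1 < t * G + G" using mod_less_divisor[OF G0, of "i + G - 1"] div_mult_mod_eq[of "i + G - 1" G] unfolding t_def by linarith
      then have t2: "i \<le> t * G" using G0 by linarith
      have t3: "t * G \<le> e" using t1 True ie G0 by linarith
      have "t * G < 2 * K * G" using t3 ie nGK by (simp only: mult.commute[of G])
      then have "t < 2 * K" by simp
      then have "t * G \<in> S" unfolding S_def S1_def using t3 ie by auto
      then show ?thesis using t2 t3 ie by (intro exI[of _ i] exI[of _ "t * G"]) (simp add: occ_def)
    next
      case False
      then have eiG: "e - i < G" by linarith
      obtain a b where ab: "i \<le> a" "a \<le> b" "b \<le> e"
        "\<And>q. occ w a b q \<Longrightarrow> a - i \<le> q \<and> occ w i e (q - (a - i))"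
        "a < b \<Longrightarrow> \<exists>y z. crit w a b y z"
        using shrink[OF ie(1), of w] by blast
      \<comment> \<open>It suffices to serve the critical word, provided that the copy of the factor
        forced by it ends inside the prefix.\<close>
      have fin: ?thesis if q: "occ w a b q" "q \<le> p" "p \<le> q + (b - a)" and p: "p \<in> S" and b: "q - (a - i) + (e - i) < n" for q p
      proof -
        have o: "a - i \<le> q" "occ w i e (q - (a - i))" using ab(4)[OF q(1)] by auto
        show ?thesis using p o b q(2,3) ab(1-3)
          by (intro exI[of _ "q - (a - i)"] exI[of _ p]) auto
      qed
      show ?thesis
      proof (cases "b - a < k ^ B")
        case True
        \<comment> \<open>The copy is not to the right of \<open>a\<close>, so the factor around it
          ends no later than \<open>e\<close>.\<close>
        obtain a' where a': "a' \<le> a" "a' < k ^ (s * s + B)" and "\<And>u. u \<le> k ^ B \<Longrightarrow> w (a' + u) = w (a + u)"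
          using appear[of a B] by blast
        then have o: "occ w a b a'" unfolding occ_def using True by simp
        have "a' \<in> S" unfolding S_def S2_def using a' ab ie by simp
        moreover have "a' - (a - i) + (e - i) < n" using a'(1) ab(1) ie ab(4)[OF o] by linarith
        ultimately show ?thesis by (intro fin[OF o]) simp_all
      next
        case False
        then have kB: "k ^ B \<le> b - a" by simp
        then have lt: "a < b" using kpow_pos[of B] by linarith
        then obtain j where j: "k ^ j \<le> b - a" "b - a < k ^ Suc j" using klog[of "b - a"] by auto
        have "B < Suc j" using le_less_trans[OF kB j(2)] unfolding kpow_less_iff .
        then have jB: "gcell + Lser \<le> j" unfolding B_def by simp
        define l where "l = j - gcell"
        have jl: "j = gcell + l" "Lser \<le> l" using jB unfolding l_def by linarith+
        obtain y z where cr: "crit w a b y z" using ab(5)[OF lt] by blast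
        obtain a' y' z' where r: "crit w a' (a' + (b - a)) y' z'" "a' < k ^ (s * s + Suc j)" "y' < k ^ (s * s + Suc j)"
          "z' \<le> k ^ (s * s + Suc j)" "\<And>u. u \<le> b - a \<Longrightarrow> w (a' + u) = w (a + u)"
          by (rule crit_relocate[OF cr j(2)], rule that, assumption+)
        define c where "c = k ^ l"
        have c0: "0 < c" by (simp add: c_def)
        have "k ^ (s * s + Suc j) * 2 \<le> k ^ (s * s + Suc j) * k" using k2 by (rule mult_left_mono) simp
        moreover have "k ^ Suc j \<le> k ^ (s * s + Suc j)" unfolding kpow_le_iff by simp
        moreover have Mc: "Mcell * c = k ^ (s * s + Suc j) * k" unfolding Mcell_of_def c_def jl(1) by (simp add: power_add algebra_simps)
        ultimately have bd: "a' < Mcell * c" "a' + (b - a) < Mcell * c" "y' < Mcell * c" "z' < Mcell * c"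
          using r(2,3,4) j(2) kpow_pos[of "s * s + Suc j"] by linarith+
        have dv: "a' div c < Mcell" "(a' + (b - a)) div c < Mcell" "y' div c < Mcell" "z' div c < Mcell"
          using bd by (auto intro: less_mult_imp_div_less)
        define k1 k2 k3 k4 where "k1 = a' div c" and "k2 = (a' + (b - a)) div c" and "k3 = y' div c" and "k4 = z' div c"
        note kd = k1_def k2_def k3_def k4_def
        have cells: "cell a' c k1" "cell (a' + (b - a)) c k2" "cell y' c k3" "cell z' c k4"
          unfolding cell_def kd c_def by blast+
        have "hits a' a' (a' + (b - a))" unfolding hits_def by (intro exI[of _ a']) auto
        then have "Theta k1 k2 k3 k4 a' (k ^ l)" unfolding Theta_def c_def[symmetric] using r(1) cells by blast
        moreover have "k ^ (l + Qser) \<le> n"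
        proof -
          have "k ^ (l + Qser) \<le> k ^ j * K" unfolding K_def power_add[symmetric] kpow_le_iff jl(1) by simp
          also have "\<dots> \<le> G * K" using j(1) ab eiG by (intro mult_right_mono) linarith+
          finally show ?thesis using GK by linarith
        qed
        ultimately have ok: "2 * pp k1 k2 k3 k4 (l mod Pser) \<le> n" "Theta k1 k2 k3 k4 (pp k1 k2 k3 k4 (l mod Pser)) c"
          using pp[of k1 k2 k3 k4 "l mod Pser"] dv jl(2) unfolding ok_def kd c_def by blast+
        define p where "p = pp k1 k2 k3 k4 (l mod Pser)"
        have long: "(2 * Eexp + 6) * c + 1 \<le> a' + (b - a) - a'"
        proof -
          have "16 \<le> Eexp"
          proof -
            have "(2::nat) ^ 4 \<le> k ^ 4" by (rule power_mono[OF radix.k2]) (unfold_locales, simp)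
            also have "k ^ 4 \<le> Eexp" unfolding Eexp_of_def kpow_le_iff by simp
            finally show ?thesis by simp
          qed
          then have "2 * Eexp + 7 \<le> 2 ^ 2 * Eexp" by simp
          also have "\<dots> \<le> k ^ 2 * Eexp" by (intro mult_right_mono power_mono) (use radix.k2[OF radix_axioms] in auto)
          also have "\<dots> = k ^ gcell" unfolding Eexp_of_def gcell_of_def power_add[symmetric] by (rule arg_cong) simp
          finally have "(2 * Eexp + 7) * c \<le> k ^ gcell * c" by (rule mult_right_mono) simp
          also have "\<dots> = k ^ j" unfolding c_def jl(1) power_add ..
          also have "(2 * Eexp + 7) * c = (2 * Eexp + 6) * c + c" by (simp add: algebra_simps)
          finally show ?thesis using j(1) c0 by linarith
        qed
        have "cov w p a' (a' + (b - a))"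
          by (rule Theta_crit[OF noexp _ r(1) long]) (use ok(2) in \<open>simp_all add: p_def kd\<close>)
        then obtain q where q: "q \<le> p" "p \<le> q + (b - a)" "occ w a' (a' + (b - a)) q" unfolding cov_def by auto
        have o: "occ w a b q" using q(3) r(5) unfolding occ_def by simp
        \<comment> \<open>Both \<open>p\<close> and \<open>G\<close> are at most half of
          \<open>n\<close>, so the forced copy cannot overrun the prefix.\<close>
        have "e - i < n - p"
        proof -
          have "G * 2 \<le> G * K" using K0 by (intro mult_left_mono) auto
          then have "2 * G \<le> n" using GK by linarith
          then show ?thesis using eiG ok(1) unfolding p_def by linarith
        qed
        then have "q - (a - i) + (e - i) < n" using q(1) by linarith
        moreover have "p \<in> S"
        proof -
          have "p < n" using ok(1) n0 unfolding p_def by linarith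
          moreover have "p \<in> S3" unfolding S3_def p_def
            by (rule image_eqI[of _ _ "(k1, k2, k3, k4, l mod Pser)"]) (use dv P0 in \<open>simp_all add: kd\<close>)
          ultimately show ?thesis unfolding S_def by blast
        qed
        ultimately show ?thesis using fin[OF o q(1,2)] by blast
      qed
    qed
  qed
  then have "gamma w n \<le> card S" by (rule gamma_le_card)
  also have "\<dots> \<le> card (S1 \<union> S2 \<union> S3)"
    unfolding S_def by (intro card_mono) (auto simp: S1_def S2_def S3_def)
  also have "\<dots> \<le> card S1 + card S2 + card S3"
    using card_Un_le[of "S1 \<union> S2" S3] card_Un_le[of S1 S2] by linarith
  also have "card S1 \<le> 2 * K" unfolding S1_def using card_image_le[of "{..<2 * K}"] by simp
  also have "card S2 = k ^ (s * s + B)" unfolding S2_def by simp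
  also have "card S3 \<le> Mcell ^ 4 * Pser"
  proof -
    have "card S3 \<le> card ({..<Mcell} \<times> {..<Mcell} \<times> {..<Mcell} \<times> {..<Mcell} \<times> {..<Pser})"
      unfolding S3_def by (rule card_image_le) simp
    also have "\<dots> = Mcell ^ 4 * Pser" by (simp add: card_cartesian_product power4_eq_xxxx)
    finally show ?thesis .
  qed
  finally show ?thesis unfolding K_def B_def by simp
qed

text \<open>The bound is a number computable from \<open>k\<close> and \<open>s\<close> rather than
  some constant; decidability depends on this.\<close>

theorem gamma_dichotomy: "log_growth w \<or> (\<forall>n. gamma w n \<le> gamma_cap)"
proof (cases "\<exists>i e \<pi>. 0 < \<pi> \<and> per w i e \<pi> \<and> Eexp * \<pi> \<le> e - i")
  case True
  then obtain i e \<pi> where "0 < \<pi>" "per w i e \<pi>" "k ^ (Nrun + 4) * \<pi> \<le> e - i" unfolding Eexp_of_def by blast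
  then have "log_growth w \<or> (\<forall>n. gamma w n \<le> 2 * k ^ Nup)" by (intro high_exponent)
  then show ?thesis unfolding gamma_cap_of_def by (meson le_add2 le_trans)
next
  case False
  then have noexp: "\<And>i e \<pi>. 0 < \<pi> \<Longrightarrow> per w i e \<pi> \<Longrightarrow> e - i < Eexp * \<pi>" by (meson linorder_not_less)
  show ?thesis
  proof (cases "log_growth w")
    case False
    then show ?thesis using gamma_bound_no_powers[OF False noexp] unfolding gamma_cap_of_def by (meson le_add1 le_trans)
  qed simp
qed

end

section \<open>Recognizability of bounds on \<open>gamma\<close> and finite checks\<close>

context autword begin

text \<open>The attractor becomes \<open>c\<close> variables; repeated or irrelevant values do no
  harm, since only an upper bound on its size is claimed. With length \<open>Suc n\<close> the last
  index is \<open>n\<close>.\<close>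

lemma gamma_Suc_le_iff:
  "gamma w (Suc n) \<le> c \<longleftrightarrow> (\<exists>x. \<forall>i e. i \<le> e \<longrightarrow> e \<le> n \<longrightarrow>
     (\<exists>q. q + e \<le> n + i \<and> (\<exists>t < c. q \<le> x t \<and> x t + i \<le> q + e) \<and>
        (\<forall>x v. i \<le> x \<longrightarrow> x \<le> e \<longrightarrow> x + q = v + i \<longrightarrow> w x = w v)))" (is "?L \<longleftrightarrow> ?R")
proof
  assume ?L
  obtain S where S: "attr w (Suc n) S" "card S = gamma w (Suc n)" using gamma_attained by blast
  have "finite S" using S(1) by (rule attr_finite)
  then obtain h where h: "bij_betw h {0..<card S} S" using ex_bij_betw_nat_finite by blast
  have "\<exists>q. q + e \<le> n + i \<and> (\<exists>t < c. q \<le> h t \<and> h t + i \<le> q + e) \<and>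
        (\<forall>x v. i \<le> x \<longrightarrow> x \<le> e \<longrightarrow> x + q = v + i \<longrightarrow> w x = w v)" if ie: "i \<le> e" "e \<le> n" for i e
  proof -
    obtain q p where q: "p \<in> S" "q \<le> p" "p \<le> q + (e - i)" "q + (e - i) < Suc n" "occ w i e q"
      using S(1) ie unfolding attr_def by (metis le_imp_less_Suc)
    have "p \<in> h ` {0..<card S}" using q(1) h unfolding bij_betw_def by blast
    then obtain t where "t < card S" "p = h t" by auto
    then have "\<exists>t < c. q \<le> h t \<and> h t + i \<le> q + e"
      using \<open>?L\<close> S(2) q(2,3) ie by (intro exI[of _ t]) auto
    moreover have "q + e \<le> n + i" using q(4) ie by linarith
    ultimately show ?thesis using q(5) unfolding occ_alt[OF ie(1)] by blast
  qed
  then show ?R by blast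
next
  assume ?R
  then obtain x where x: "\<forall>i e. i \<le> e \<longrightarrow> e \<le> n \<longrightarrow>
     (\<exists>q. q + e \<le> n + i \<and> (\<exists>t < c. q \<le> x t \<and> x t + i \<le> q + e) \<and>
        (\<forall>x v. i \<le> x \<longrightarrow> x \<le> e \<longrightarrow> x + q = v + i \<longrightarrow> w x = w v))" by blast
  define S where "S = x ` {..<c} \<inter> {..<Suc n}"
  have "attr w (Suc n) S" unfolding attr_def
  proof (intro conjI allI impI)
    show "S \<subseteq> {..<Suc n}" by (simp add: S_def)
    fix i e assume ie: "i \<le> e" "e < Suc n"
    then have "e \<le> n" by simp
    from x[rule_format, OF ie(1) this] obtain q where q0: "q + e \<le> n + i \<and>
      (\<exists>t < c. q \<le> x t \<and> x t + i \<le> q + e) \<and>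
      (\<forall>x v. i \<le> x \<longrightarrow> x \<le> e \<longrightarrow> x + q = v + i \<longrightarrow> w x = w v)" by (elim exE)
    note q' = q0[THEN conjunct1] q0[THEN conjunct2, THEN conjunct1] q0[THEN conjunct2, THEN conjunct2]
    obtain t where "t < c" "q \<le> x t" "x t + i \<le> q + e" using q'(2) by blast
    moreover have "occ w i e q" using q'(3) unfolding occ_alt[OF ie(1)] .
    ultimately have q: "q + e \<le> n + i" "t < c" "q \<le> x t" "x t + i \<le> q + e" "occ w i e q" using q'(1) by blast+
    have "x t \<in> S" unfolding S_def using q ie by auto
    moreover have "x t \<le> q + (e - i)" "q + (e - i) < Suc n" using q ie by linarith+
    ultimately show "\<exists>q p. p \<in> S \<and> q \<le> p \<and> p \<le> q + (e - i) \<and> q + (e - i) < Suc n \<and> occ w i e q"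
      using q(3,5) by blast
  qed
  then have "gamma w (Suc n) \<le> card S" by (rule gamma_le_card)
  also have "\<dots> \<le> card (x ` {..<c})" unfolding S_def by (intro card_mono) auto
  also have "\<dots> \<le> c" using card_image_le[of "{..<c}" x] by simp
  finally show ?L .
qed

text \<open>Variable \<open>10 + t\<close> holds the position \<open>x t\<close>, and all of these
  are projected away in one application of \<open>recog_exists_set\<close>. The state count involves
  \<open>C\<close> instead of \<open>c\<close>, so that one number works for all
  \<open>c \<le> C\<close>.\<close>

lemma recog_gamma_le:
  assumes "c \<le> C" shows "recog (Ngam C) (\<lambda>e. gamma w (Suc (e 0)) \<le> c)"
proof -
  have 1: "recog Nmatch (\<lambda>e. \<forall>x v. e 1 \<le> x \<longrightarrow> x \<le> e 2 \<longrightarrow> x + e 3 = v + e 1 \<longrightarrow> w x = w v)"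
    unfolding Nmatch_of_def by (rule recog_all_var[where x = 4], rule recog_all_var[where x = 5],
      intro recog_imp recog_le recog_sum_eq recog_w_eq) simp_all
  have 2: "recog ((5 * 5) ^ C) (\<lambda>e. \<exists>t < c. e 3 \<le> e (10 + t) \<and> e (10 + t) + e 1 \<le> e 3 + e 2)"
  proof (rule recog_mono)
    show "recog ((5 * 5) ^ c) (\<lambda>e. \<exists>t < c. e 3 \<le> e (10 + t) \<and> e (10 + t) + e 1 \<le> e 3 + e 2)"
      by (intro recog_Bex_less recog_and recog_le recog_sum_le)
    show "(5 * 5) ^ c \<le> (5 * 5 :: nat) ^ C" using assms by (intro power_increasing) auto
  qed
  have 3: "recog (5 * ((5 * 5) ^ C * Nmatch)) (\<lambda>e. e 3 + e 2 \<le> e 0 + e 1 \<and>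
      (\<exists>t < c. e 3 \<le> e (10 + t) \<and> e (10 + t) + e 1 \<le> e 3 + e 2) \<and>
      (\<forall>x v. e 1 \<le> x \<longrightarrow> x \<le> e 2 \<longrightarrow> x + e 3 = v + e 1 \<longrightarrow> w x = w v))"
    by (rule recog_and[OF recog_sum_le], rule recog_and[OF 2], rule 1)
  have 4: "recog (2 ^ (5 * ((5 * 5) ^ C * Nmatch))) (\<lambda>e. \<exists>q. q + e 2 \<le> e 0 + e 1 \<and>
      (\<exists>t < c. q \<le> e (10 + t) \<and> e (10 + t) + e 1 \<le> q + e 2) \<and>
      (\<forall>x v. e 1 \<le> x \<longrightarrow> x \<le> e 2 \<longrightarrow> x + q = v + e 1 \<longrightarrow> w x = w v))"
    by (rule recog_ex_var[where x = 3], rule 3) simp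
  have 5: "recog (5 * (5 * 2 ^ (5 * ((5 * 5) ^ C * Nmatch)))) (\<lambda>e. e 1 \<le> e 2 \<longrightarrow> e 2 \<le> e 0 \<longrightarrow> (\<exists>q. q + e 2 \<le> e 0 + e 1 \<and>
      (\<exists>t < c. q \<le> e (10 + t) \<and> e (10 + t) + e 1 \<le> q + e 2) \<and>
      (\<forall>x v. e 1 \<le> x \<longrightarrow> x \<le> e 2 \<longrightarrow> x + q = v + e 1 \<longrightarrow> w x = w v)))"
    by (rule recog_imp[OF recog_le], rule recog_imp[OF recog_le], rule 4)
  define Q where "Q n x \<longleftrightarrow> (\<forall>i e. i \<le> e \<longrightarrow> e \<le> n \<longrightarrow> (\<exists>q. q + e \<le> n + i \<and>
      (\<exists>t < c. q \<le> x t \<and> x t + i \<le> q + e) \<and>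
      (\<forall>x v. i \<le> x \<longrightarrow> x \<le> e \<longrightarrow> x + q = v + i \<longrightarrow> w x = w v)))" for n and x :: "nat \<Rightarrow> nat"
  have 6: "recog (2 ^ (2 ^ (5 * (5 * 2 ^ (5 * ((5 * 5) ^ C * Nmatch)))))) (\<lambda>e. Q (e 0) (\<lambda>t. e (10 + t)))"
    unfolding Q_def by (rule recog_all_var[where x = 1], rule recog_all_var[where x = 2], rule 5) simp_all
  have "recog (Ngam C) (\<lambda>e. \<exists>e'. (\<forall>v. v \<notin> {10..} \<longrightarrow> e' v = e v) \<and> Q (e' 0) (\<lambda>t. e' (10 + t)))"
    unfolding Ngam_of_def by (rule recog_exists_set[OF 6])
  moreover have "(\<exists>e'. (\<forall>v. v \<notin> {10..} \<longrightarrow> e' v = e v) \<and> Q (e' 0) (\<lambda>t. e' (10 + t))) \<longleftrightarrow> (\<exists>x. Q (e 0) x)" for e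
  proof
    assume "\<exists>e'. (\<forall>v. v \<notin> {10..} \<longrightarrow> e' v = e v) \<and> Q (e' 0) (\<lambda>t. e' (10 + t))"
    then obtain e' where e': "\<forall>v. v \<notin> {10..} \<longrightarrow> e' v = e v" "Q (e' 0) (\<lambda>t. e' (10 + t))" by (elim exE conjE)
    have "e' 0 = e 0" using e'(1) by simp
    then show "\<exists>x. Q (e 0) x" using e'(2) by (intro exI[of _ "\<lambda>t. e' (10 + t)"]) simp
  next
    assume "\<exists>x. Q (e 0) x"
    then obtain x where "Q (e 0) x" by (elim exE)
    then show "\<exists>e'. (\<forall>v. v \<notin> {10..} \<longrightarrow> e' v = e v) \<and> Q (e' 0) (\<lambda>t. e' (10 + t))"
      by (intro exI[of _ "\<lambda>v. if 10 \<le> v then x (v - 10) else e v"]) simp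
  qed
  ultimately have "recog (Ngam C) (\<lambda>e. \<exists>x. Q (e 0) x)" by simp
  then show ?thesis unfolding gamma_Suc_le_iff Q_def .
qed

text \<open>The product of the automata for \<open>gamma \<le> b\<close> with
  \<open>b \<le> C\<close> separates all values of a sequence bounded by \<open>C\<close>.\<close>

lemma gamma_classes:
  assumes bd: "\<And>n. gamma w n \<le> C"
  shows "\<exists>t :: nat \<Rightarrow> nat. (\<forall>n. t n < Nall C) \<and>
    (\<forall>m n d. t m = t n \<longrightarrow> d < k \<longrightarrow> t (k * m + d) = t (k * n + d)) \<and>
    (\<forall>m n. t m = t n \<longrightarrow> gamma w (Suc m) = gamma w (Suc n))"
proof -
  have "\<exists>t :: nat \<Rightarrow> nat. (\<forall>n. t n < Ngam C ^ c) \<and>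
    (\<forall>m n d. t m = t n \<longrightarrow> d < k \<longrightarrow> t (k * m + d) = t (k * n + d)) \<and>
    (\<forall>m n. t m = t n \<longrightarrow> (\<forall>b < c. gamma w (Suc m) \<le> b \<longleftrightarrow> gamma w (Suc n) \<le> b))" if "c \<le> Suc C" for c
    using that
  proof (induction c)
    case 0
    then show ?case by (intro exI[of _ "\<lambda>_. 0"]) simp
  next
    case (Suc c)
    then obtain t :: "nat \<Rightarrow> nat" where t: "\<forall>n. t n < Ngam C ^ c"
      "\<forall>m n d. t m = t n \<longrightarrow> d < k \<longrightarrow> t (k * m + d) = t (k * n + d)"
      "\<forall>m n. t m = t n \<longrightarrow> (\<forall>b < c. gamma w (Suc m) \<le> b \<longleftrightarrow> gamma w (Suc n) \<le> b)"
      using Suc.IH[OF Suc_leD[OF Suc.prems]] by (elim exE conjE)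
    have "c \<le> C" using Suc.prems by simp
    then obtain T where T: "cong_fun T" "\<forall>e. T e < Ngam C"
      "\<forall>e e'. T e = T e' \<longrightarrow> (gamma w (Suc (e 0)) \<le> c) = (gamma w (Suc (e' 0)) \<le> c)"
      using recog_gamma_le[OF \<open>c \<le> C\<close>] unfolding recog_def by (elim exE conjE)
    define u where "u n = T (\<lambda>_. n)" for n
    define r where "r n = t n * Ngam C + u n" for n
    have ul: "u n < Ngam C" for n using T(2) by (simp add: u_def)
    have rd: "r n div Ngam C = t n" "r n mod Ngam C = u n" for n
      using ul[of n] by (simp_all add: r_def)
    have r_eq: "t m = t n \<and> u m = u n" if "r m = r n" for m n using rd[of m] rd[of n] that by simp
    have u_step: "u (k * m + d) = u (k * n + d)" if "u m = u n" "d < k" for m n d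
      using cong_funD[OF T(1), of "\<lambda>_. m" "\<lambda>_. n" "\<lambda>_. d"] that unfolding u_def by simp
    show ?case
    proof (intro exI[of _ r] conjI allI impI)
      fix n
      have "t n * Ngam C + u n < (t n + 1) * Ngam C" using ul[of n] by simp
      also have "\<dots> \<le> Ngam C ^ c * Ngam C" using t(1) by (intro mult_right_mono) (simp_all add: Suc_leI)
      finally show "r n < Ngam C ^ Suc c" by (simp add: r_def mult.commute)
    next
      fix m n d assume "r m = r n" "d < k"
      then have "t (k * m + d) = t (k * n + d)" "u (k * m + d) = u (k * n + d)"
        using t(2) r_eq[of m n] u_step[of m n d] by blast+
      then show "r (k * m + d) = r (k * n + d)" by (simp only: r_def)
    next
      fix m n b assume r: "r m = r n" and b: "b < Suc c"
      have tu: "t m = t n" "u m = u n" using r_eq[OF r] by auto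
      show "gamma w (Suc m) \<le> b \<longleftrightarrow> gamma w (Suc n) \<le> b"
      proof (cases "b = c")
        case True
        then show ?thesis using T(3)[rule_format, of "\<lambda>_. m" "\<lambda>_. n"] tu(2) unfolding u_def by simp
      next
        case False
        then show ?thesis using t(3) tu(1) b by (metis less_SucE)
      qed
    qed
  qed
  from this[OF order_refl] obtain t :: "nat \<Rightarrow> nat" where t: "\<forall>n. t n < Ngam C ^ Suc C"
    "\<forall>m n d. t m = t n \<longrightarrow> d < k \<longrightarrow> t (k * m + d) = t (k * n + d)"
    "\<forall>m n. t m = t n \<longrightarrow> (\<forall>b < Suc C. gamma w (Suc m) \<le> b \<longleftrightarrow> gamma w (Suc n) \<le> b)" by (elim exE conjE)
  have "gamma w (Suc m) = gamma w (Suc n)" if "t m = t n" for m n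
  proof -
    have "gamma w (Suc m) \<le> b \<longleftrightarrow> gamma w (Suc n) \<le> b" if "b \<le> C" for b
      using t(3) \<open>t m = t n\<close> that by (metis less_Suc_eq_le)
    then show ?thesis using bd by (metis le_antisym order_refl)
  qed
  then have 3: "\<forall>m n. t m = t n \<longrightarrow> gamma w (Suc m) = gamma w (Suc n)" by (intro allI impI)
  show ?thesis unfolding Nall_of_def by (rule exI[of _ t], rule conjI[OF t(1) conjI[OF t(2) 3]])
qed

text \<open>Each class has a representative below \<open>k ^ Ngam C\<close>, so a finite check
  proves the bound everywhere.\<close>

lemma gamma_bounded_check:
  assumes "\<And>n. n < k ^ Ngam C \<Longrightarrow> gamma w (Suc n) \<le> C"
  shows "gamma w n \<le> C"
proof (cases n)
  case 0
  then show ?thesis using gamma_le[of w 0] by simp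
next
  case (Suc m)
  obtain T where T: "cong_fun T" "\<forall>e. T e < Ngam C"
      "\<forall>e e'. T e = T e' \<longrightarrow> (gamma w (Suc (e 0)) \<le> C) = (gamma w (Suc (e' 0)) \<le> C)"
    using recog_gamma_le[OF order_refl[of C]] unfolding recog_def by (elim exE conjE)
  have "\<exists>m' < k ^ Ngam C. m' \<le> m \<and> T (\<lambda>_. m') = T (\<lambda>_. m)"
  proof (rule finite_rep[where t = "\<lambda>m. T (\<lambda>_. m)" and X = "{..<Ngam C}"])
    fix x y d assume "T (\<lambda>_. x) = T (\<lambda>_. y)" "d < k"
    then show "T (\<lambda>_. k * x + d) = T (\<lambda>_. k * y + d)"
      using cong_funD[OF T(1), of "\<lambda>_. x" "\<lambda>_. y" "\<lambda>_. d"] by simp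
  qed (use T(2) in simp_all)
  then obtain m' where m': "m' < k ^ Ngam C" "T (\<lambda>_. m') = T (\<lambda>_. m)" by blast
  have "gamma w (Suc m) \<le> C" using T(3)[rule_format, OF m'(2)] assms[OF m'(1)] by simp
  then show ?thesis using Suc by simp
qed

end

section \<open>Automata and digitwise congruences\<close>

context radix begin

lemma base_digits_step: "0 < n \<Longrightarrow> base_digits k n = base_digits k (n div k) @ [n mod k]"
  using k2 by (subst base_digits.simps) simp

lemma base_digits_0[simp]: "base_digits k 0 = []"
  by (subst base_digits.simps) simp

definition run_state :: "dfao \<Rightarrow> nat \<Rightarrow> nat" where
  "run_state A n = foldl (\<lambda>s d. fst A ! s ! d) 0 (base_digits k n)"

lemma run_state_0[simp]: "run_state A 0 = 0" by (simp add: run_state_def)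

lemma run_state_step:
  assumes "d < k" "0 < k * m + d"
  shows "run_state A (k * m + d) = fst A ! run_state A m ! d"
  using base_digits_step[OF assms(2)] assms(1) by (simp add: run_state_def)

lemma dfao_word_eq: "dfao_word k A n = snd A ! run_state A n"
  by (simp add: dfao_word_def dfao_run_def run_state_def split: prod.split)

lemma digit_induct[case_names zero step]:
  assumes "P 0" "\<And>m d. P m \<Longrightarrow> d < k \<Longrightarrow> 0 < k * m + d \<Longrightarrow> P (k * m + d)"
  shows "P (n :: nat)"
proof (induction n rule: less_induct)
  case (less n)
  show ?case
  proof (cases "n = 0")
    case False
    then have "n div k < n" using k2 by simp
    then have "P (k * (n div k) + n mod k)" using False by (intro assms(2) less) simp_all
    then show ?thesis by simp
  qed (use assms(1) in simp)
qed

lemma run_state_less: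
  assumes "wf_dfao k A" shows "run_state A n < length (snd A)"
proof (induction n rule: digit_induct)
  case zero then show ?case using assms by (auto simp: wf_dfao_def)
next
  case (step m d)
  then show ?case using assms unfolding run_state_step[OF step(2,3)] by (auto simp: wf_dfao_def)
qed

text \<open>The state after reading nothing may differ from the state after reading zeros; the extra state
  for the empty word makes the successor of the state of \<open>n\<close> on \<open>d\<close> depend on that state alone,
  also for \<open>n = 0\<close>.\<close>

definition pad_state :: "dfao \<Rightarrow> nat \<Rightarrow> nat" where
  "pad_state A n = (if n = 0 then length (snd A) else run_state A n)"

lemma autword_dfao:
  assumes "wf_dfao k A" shows "autword k (pad_state A) (Suc (length (snd A))) (dfao_word k A)"
proof
  fix n show "pad_state A n < Suc (length (snd A))"
    using run_state_less[OF assms, of n] by (simp add: pad_state_def)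
next
  fix m n d assume eq: "pad_state A m = pad_state A n" and d: "d < k"
  have z: "m = 0 \<longleftrightarrow> n = 0"
    using eq run_state_less[OF assms, of m] run_state_less[OF assms, of n] by (auto simp: pad_state_def split: if_splits)
  show "pad_state A (k * m + d) = pad_state A (k * n + d)"
  proof (cases "m = 0")
    case True then show ?thesis using z by simp
  next
    case False
    then have "run_state A m = run_state A n" using eq z by (simp add: pad_state_def)
    moreover have "0 < k * m + d" "0 < k * n + d" using False z by simp_all
    ultimately show ?thesis using run_state_step[OF d, of m A] run_state_step[OF d, of n A] False z by (simp add: pad_state_def)
  qed
next
  fix m n assume eq: "pad_state A m = pad_state A n"
  have z: "m = 0 \<longleftrightarrow> n = 0"
    using eq run_state_less[OF assms, of m] run_state_less[OF assms, of n] by (auto simp: pad_state_def split: if_splits)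
  then have "run_state A m = run_state A n" using eq by (auto simp: pad_state_def split: if_splits)
  then show "dfao_word k A m = dfao_word k A n" by (simp add: dfao_word_eq)
qed

text \<open>As in the Myhill-Nerode theorem, classes become states and transitions are read off
  representatives.\<close>

lemma dfao_of_classes:
  fixes t g :: "nat \<Rightarrow> nat"
  assumes t: "\<And>n. t n < N" "\<And>m n d. t m = t n \<Longrightarrow> d < k \<Longrightarrow> t (k * m + d) = t (k * n + d)"
    and g: "\<And>m n. t m = t n \<Longrightarrow> g m = g n"
  obtains B where "wf_dfao k B" "\<And>m. dfao_word k B m = g m"
proof -
  \<comment> \<open>Transposes 0 and \<open>t 0\<close>, because the initial state of a DFAO is
    0.\<close>
  define u where "u n = (if t n = t 0 then 0 else if t n = 0 then t 0 else t n)" for n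
  have N0: "0 < N" using t(1)[of 0] by simp
  have u0: "u 0 = 0" by (simp add: u_def)
  have ul: "u n < N" for n using t(1)[of n] t(1)[of 0] N0 by (simp add: u_def)
  have ut: "t m = t n" if "u m = u n" for m n using that by (auto simp: u_def split: if_splits)
  have tu: "u m = u n" if "t m = t n" for m n using that by (simp add: u_def)
  define rep where "rep \<sigma> = (SOME x. u x = \<sigma>)" for \<sigma>
  have rep: "t (rep (u n)) = t n" for n
  proof -
    have "u (rep (u n)) = u n" unfolding rep_def by (rule someI[of _ n]) (rule refl)
    then show ?thesis by (rule ut)
  qed
  define B where "B = (map (\<lambda>\<sigma>. map (\<lambda>d. u (k * rep \<sigma> + d)) [0..<k]) [0..<N], map (\<lambda>\<sigma>. g (rep \<sigma>)) [0..<N])"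
  have wf: "wf_dfao k B" using N0 ul by (simp add: wf_dfao_def B_def)
  have run: "run_state B n = u n" for n
  proof (induction n rule: digit_induct)
    case zero then show ?case using u0 by simp
  next
    case (step m d)
    have "fst B ! u m ! d = u (k * rep (u m) + d)" using ul[of m] step(2) by (simp add: B_def)
    also have "\<dots> = u (k * m + d)" by (intro tu t(2) rep step(2))
    finally show ?case unfolding run_state_step[OF step(2,3)] step(1) .
  qed
  have "dfao_word k B m = g m" for m
    unfolding dfao_word_eq run using ul[of m] g[OF rep[of m]] by (simp add: B_def)
  then show thesis using that wf by blast
qed

end

context autword begin

lemma gamma_dfao_exists:
  assumes "\<And>n. gamma w n \<le> C"
  obtains B where "wf_dfao k B" "\<And>m. dfao_word k B m = gamma w (Suc m)"
proof -
  obtain t :: "nat \<Rightarrow> nat" where t: "\<forall>n. t n < Nall C"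
    "\<forall>m n d. t m = t n \<longrightarrow> d < k \<longrightarrow> t (k * m + d) = t (k * n + d)"
    "\<forall>m n. t m = t n \<longrightarrow> gamma w (Suc m) = gamma w (Suc n)" using gamma_classes[OF assms] by (elim exE conjE)
  show thesis
  proof (rule dfao_of_classes[of t "Nall C" "\<lambda>m. gamma w (Suc m)"])
    show "t n < Nall C" for n using t(1) by blast
    show "t (k * m + d) = t (k * n + d)" if "t m = t n" "d < k" for m n d using t(2)[rule_format, OF that] .
    show "gamma w (Suc m) = gamma w (Suc n)" if "t m = t n" for m n using t(3)[rule_format, OF that] .
  next
    fix B assume "wf_dfao k B" "\<And>m. dfao_word k B m = gamma w (Suc m)"
    then show thesis by (rule that)
  qed
qed

text \<open>Both sides depend only on the pair of classes, and every pair has a representative in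
  the range checked.\<close>

lemma gamma_dfao_check:
  assumes bd: "\<And>n. gamma w n \<le> C" and B: "wf_dfao k B"
    and chk: "\<And>m. m < k ^ (Nall C * Suc (length (snd B))) \<Longrightarrow> dfao_word k B m = gamma w (Suc m)"
  shows "dfao_word k B m = gamma w (Suc m)"
proof -
  obtain t :: "nat \<Rightarrow> nat" where t: "\<forall>n. t n < Nall C"
    "\<forall>m n d. t m = t n \<longrightarrow> d < k \<longrightarrow> t (k * m + d) = t (k * n + d)"
    "\<forall>m n. t m = t n \<longrightarrow> gamma w (Suc m) = gamma w (Suc n)" using gamma_classes[OF bd] by (elim exE conjE)
  interpret B: autword k "pad_state B" "Suc (length (snd B))" "dfao_word k B" by (rule autword_dfao[OF B])
  have "\<exists>m' < k ^ (Nall C * Suc (length (snd B))). m' \<le> m \<and> (t m', pad_state B m') = (t m, pad_state B m)"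
  proof (rule finite_rep[where t = "\<lambda>m. (t m, pad_state B m)" and X = "{..<Nall C} \<times> {..<Suc (length (snd B))}"])
    fix x y d assume "(t x, pad_state B x) = (t y, pad_state B y)" "d < k"
    then show "(t (k * x + d), pad_state B (k * x + d)) = (t (k * y + d), pad_state B (k * y + d))"
      using t(2)[rule_format, of x y d] B.st_cong[of x y d] by simp
  next
    fix n show "(t n, pad_state B n) \<in> {..<Nall C} \<times> {..<Suc (length (snd B))}"
      using t(1)[rule_format, of n] B.st_less[of n] by blast
  qed (simp_all add: card_cartesian_product)
  then obtain m' where m': "m' < k ^ (Nall C * Suc (length (snd B)))" "t m' = t m" "pad_state B m' = pad_state B m" by blast
  show ?thesis using chk[OF m'(1)] t(3)[rule_format, OF m'(2)] B.w_st[OF m'(3)] by simp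
qed

end

subsection \<open>Computable functions\<close>

text \<open>The arguments of an \<open>n\<close>-ary computable function are passed as an environment of which only
  the first \<open>n\<close> entries matter.\<close>

definition cp :: "nat \<Rightarrow> ((nat \<Rightarrow> nat) \<Rightarrow> nat) \<Rightarrow> bool" where
  "cp n F \<longleftrightarrow> (\<exists>r. \<forall>xs. length xs = n \<longrightarrow> eval r xs (F ((!) xs)))"

definition dec :: "nat \<Rightarrow> ((nat \<Rightarrow> nat) \<Rightarrow> bool) \<Rightarrow> bool" where
  "dec n P \<longleftrightarrow> cp n (\<lambda>e. of_bool (P e))"

lemma cp_proj: "i < n \<Longrightarrow> cp n (\<lambda>e. e i)"
  unfolding cp_def by (intro exI[of _ "Proj i"]) (auto intro: eval.proj)

lemma cp_zero: "cp n (\<lambda>e. 0)"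
  unfolding cp_def by (intro exI[of _ Z]) (auto intro: eval.zero)

lemma cp_comp:
  assumes F: "cp m F" and G: "\<And>j. j < m \<Longrightarrow> cp n (G j)"
  shows "cp n (\<lambda>e. F ((!) (map (\<lambda>j. G j e) [0..<m])))"
proof -
  obtain f where f: "\<And>xs. length xs = m \<Longrightarrow> eval f xs (F ((!) xs))" using F unfolding cp_def by blast
  have "\<forall>j. \<exists>r. j < m \<longrightarrow> (\<forall>xs. length xs = n \<longrightarrow> eval r xs (G j ((!) xs)))"
    using G unfolding cp_def by blast
  then obtain r where r: "\<And>j xs. j < m \<Longrightarrow> length xs = n \<Longrightarrow> eval (r j) xs (G j ((!) xs))" by metis
  have "eval (Cn f (map r [0..<m])) xs (F ((!) (map (\<lambda>j. G j ((!) xs)) [0..<m])))" if "length xs = n" for xs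
    by (rule eval.comp[of "map (\<lambda>j. G j ((!) xs)) [0..<m]"]) (use that r f in auto)
  then show ?thesis unfolding cp_def by blast
qed

lemma cp_app1:
  assumes "cp 1 (\<lambda>e. f (e 0))" "cp n g" shows "cp n (\<lambda>e. f (g e))"
  using cp_comp[OF assms(1), of n "\<lambda>_. g"] assms(2) by (simp add: One_nat_def)

lemma cp_app2:
  assumes "cp 2 (\<lambda>e. f (e 0) (e 1))" "cp n g" "cp n h" shows "cp n (\<lambda>e. f (g e) (h e))"
  using cp_comp[OF assms(1), of n "\<lambda>j. if j = 0 then g else h"] assms(2,3) by (simp add: upt_rec)

lemma cp_app3:
  assumes "cp 3 (\<lambda>e. f (e 0) (e 1) (e 2))" "cp n g" "cp n h" "cp n l" shows "cp n (\<lambda>e. f (g e) (h e) (l e))"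
  using cp_comp[OF assms(1), of n "\<lambda>j. if j = 0 then g else if j = 1 then h else l"] assms(2-) by (simp add: upt_rec)

lemma cp_Suc: "cp n g \<Longrightarrow> cp n (\<lambda>e. Suc (g e))"
proof (rule cp_app1[of Suc])
  have "eval Sc xs (Suc (xs ! 0))" if "length xs = 1" for xs
    using that eval.suc[of "xs ! 0" "tl xs"] by (cases xs) auto
  then show "cp 1 (\<lambda>e. Suc (e 0))" unfolding cp_def by blast
qed

lemma cp_rec:
  assumes a: "cp n a" and b: "cp (Suc (Suc n)) (\<lambda>e. b (e 0) (e (Suc 0)) (\<lambda>j. e (Suc (Suc j))))" and t: "cp n t"
  shows "cp n (\<lambda>e. rec_nat (a e) (\<lambda>m y. b m y e) (t e))"
proof -
  obtain f where f: "\<And>xs. length xs = n \<Longrightarrow> eval f xs (a ((!) xs))" using a unfolding cp_def by blast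
  obtain g where g: "\<And>xs. length xs = Suc (Suc n) \<Longrightarrow> eval g xs (b (xs ! 0) (xs ! Suc 0) (\<lambda>j. xs ! Suc (Suc j)))"
    using b unfolding cp_def by blast
  have pr: "eval (Pr f g) (m # xs) (rec_nat (a ((!) xs)) (\<lambda>m y. b m y ((!) xs)) m)" if "length xs = n" for m xs
  proof (induction m)
    case 0
    then show ?case using f[OF that] by (auto intro: eval.pr0)
  next
    case (Suc m)
    let ?y = "rec_nat (a ((!) xs)) (\<lambda>m y. b m y ((!) xs)) m"
    have "eval g (m # ?y # xs) (b m ?y ((!) xs))" using g[of "m # ?y # xs"] that by simp
    then show ?case using eval.prS[OF Suc] by simp
  qed
  obtain u where u: "\<And>xs. length xs = n \<Longrightarrow> eval u xs (t ((!) xs))" using t unfolding cp_def by blast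
  have "eval (Cn (Pr f g) (u # map Proj [0..<n])) xs (rec_nat (a ((!) xs)) (\<lambda>m y. b m y ((!) xs)) (t ((!) xs)))"
    if "length xs = n" for xs
  proof (rule eval.comp[of "t ((!) xs) # xs"])
    show "eval (Pr f g) (t ((!) xs) # xs) (rec_nat (a ((!) xs)) (\<lambda>m y. b m y ((!) xs)) (t ((!) xs)))"
      by (rule pr[OF that])
    show "\<forall>i < length (u # map Proj [0..<n]). eval ((u # map Proj [0..<n]) ! i) xs ((t ((!) xs) # xs) ! i)"
    proof (intro allI impI)
      fix i assume "i < length (u # map Proj [0..<n])"
      then show "eval ((u # map Proj [0..<n]) ! i) xs ((t ((!) xs) # xs) ! i)"
        using u[OF that] that by (cases i) (auto intro: eval.proj)
    qed
  qed (use that in simp)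
  then show ?thesis unfolding cp_def by blast
qed

text \<open>Unbounded search looks for a zero, hence \<open>1 - of_bool\<close>; the second premise
  makes it stop on every environment.\<close>

lemma cp_Least:
  assumes "dec (Suc n) (\<lambda>e. P (e 0) (\<lambda>j. e (Suc j)))" "\<And>e. \<exists>y. P y e"
  shows "cp n (\<lambda>e. LEAST y. P y e)"
proof -
  have "cp (Suc n) (\<lambda>e. 1 - of_bool (P (e 0) (\<lambda>j. e (Suc j))))"
  proof -
    have "cp 1 (\<lambda>e. rec_nat 1 (\<lambda>m y. 0) (e 0))"
      by (rule cp_rec) (auto intro!: cp_proj cp_zero cp_Suc simp: One_nat_def)
    from cp_app1[OF this assms(1)[unfolded dec_def]]
    have "cp (Suc n) (\<lambda>e. rec_nat 1 (\<lambda>m y. 0) (of_bool (P (e 0) (\<lambda>j. e (Suc j)))))" .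
    moreover have "rec_nat (1::nat) (\<lambda>m y. 0) (of_bool b) = 1 - of_bool b" for b by (cases b) simp_all
    ultimately show ?thesis by simp
  qed
  then obtain f where f: "\<And>xs. length xs = Suc n \<Longrightarrow> eval f xs (1 - of_bool (P (xs ! 0) (\<lambda>j. xs ! Suc j)))"
    unfolding cp_def by blast
  have "eval (Mn f) xs (LEAST y. P y ((!) xs))" if "length xs = n" for xs
  proof (rule eval.mn)
    have fx: "eval f (y # xs) (1 - of_bool (P y ((!) xs)))" for y using f[of "y # xs"] that by simp
    have "P (LEAST y. P y ((!) xs)) ((!) xs)" by (rule LeastI_ex[OF assms(2)])
    then show "eval f ((LEAST y. P y ((!) xs)) # xs) 0" using fx[of "LEAST y. P y ((!) xs)"] by simp
    show "\<forall>m < (LEAST y. P y ((!) xs)). \<exists>y. eval f (m # xs) (Suc y)"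
    proof (intro allI impI)
      fix m assume "m < (LEAST y. P y ((!) xs))"
      then have "\<not> P m ((!) xs)" by (rule not_less_Least)
      then show "\<exists>y. eval f (m # xs) (Suc y)" using fx[of m] by (intro exI[of _ 0]) simp
    qed
  qed
  then show ?thesis unfolding cp_def by blast
qed

lemma cp_const: "cp n (\<lambda>e. c)"
  by (induction c) (auto intro: cp_zero cp_Suc)

text \<open>In the step function of \<open>cp_rec\<close>, slots 0 and 1 hold the counter and the
  previous value, so parameters move up by two.\<close>

lemma cp_shift2: "cp n g \<Longrightarrow> cp (Suc (Suc n)) (\<lambda>e. g (\<lambda>j. e (Suc (Suc j))))"
proof -
  assume "cp n g"
  then obtain f where f: "\<And>xs. length xs = n \<Longrightarrow> eval f xs (g ((!) xs))" unfolding cp_def by blast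
  have "eval (Cn f (map (\<lambda>j. Proj (Suc (Suc j))) [0..<n])) xs (g (\<lambda>j. xs ! Suc (Suc j)))" if "length xs = Suc (Suc n)" for xs
  proof (rule eval.comp[of "tl (tl xs)"])
    have nth: "(!) (tl (tl xs)) = (\<lambda>j. xs ! Suc (Suc j))"
      using that by (cases xs; cases "tl xs") auto
    show "eval f (tl (tl xs)) (g (\<lambda>j. xs ! Suc (Suc j)))" using f[of "tl (tl xs)"] that unfolding nth by simp
    show "\<forall>i < length (map (\<lambda>j. Proj (Suc (Suc j))) [0..<n]). eval (map (\<lambda>j. Proj (Suc (Suc j))) [0..<n] ! i) xs (tl (tl xs) ! i)"
      unfolding nth using that by (auto intro: eval.proj)
  qed (use that in simp)
  then show ?thesis unfolding cp_def by blast
qed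

lemma cp_add: assumes "cp n g" "cp n h" shows "cp n (\<lambda>e. g e + h e)"
proof -
  have "cp n (\<lambda>e. rec_nat (g e) (\<lambda>m y. Suc y) (h e))" by (intro cp_rec assms cp_Suc cp_proj) simp
  moreover have "rec_nat x (\<lambda>m y. Suc y) t = x + t" for x t by (induction t) auto
  ultimately show ?thesis by simp
qed

lemma cp_diff: assumes "cp n g" "cp n h" shows "cp n (\<lambda>e. g e - h e)"
proof -
  have "cp 1 (\<lambda>e. rec_nat 0 (\<lambda>m y. m) (e 0))" by (intro cp_rec cp_zero cp_proj) simp_all
  moreover have "rec_nat (0::nat) (\<lambda>m y. m) t = t - 1" for t by (cases t) auto
  ultimately have pred: "cp 1 (\<lambda>e. e 0 - 1)" by simp
  have "cp n (\<lambda>e. rec_nat (g e) (\<lambda>m y. y - 1) (h e))"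
    by (intro cp_rec assms cp_app1[OF pred] cp_proj) simp
  moreover have "rec_nat x (\<lambda>m y. y - 1) t = x - t" for x t :: nat by (induction t) auto
  ultimately show ?thesis by simp
qed

lemma cp_mult: assumes "cp n g" "cp n h" shows "cp n (\<lambda>e. g e * h e)"
proof -
  have "cp n (\<lambda>e. rec_nat 0 (\<lambda>m y. y + g e) (h e))" by (intro cp_rec assms cp_zero cp_add cp_proj cp_shift2) simp
  moreover have "rec_nat 0 (\<lambda>m y. y + x) t = x * t" for x t :: nat by (induction t) auto
  ultimately show ?thesis by simp
qed

lemma cp_power: assumes "cp n g" "cp n h" shows "cp n (\<lambda>e. g e ^ h e)"
proof -
  have "cp n (\<lambda>e. rec_nat 1 (\<lambda>m y. y * g e) (h e))"
    by (intro cp_rec assms cp_const cp_mult cp_proj cp_shift2) simp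
  moreover have "rec_nat 1 (\<lambda>m y. y * x) t = x ^ t" for x t :: nat by (induction t) auto
  ultimately show ?thesis by simp
qed

lemma cp_fact: assumes "cp n g" shows "cp n (\<lambda>e. fact (g e))"
proof -
  have "cp n (\<lambda>e. rec_nat 1 (\<lambda>m y. y * Suc m) (g e))"
    by (intro cp_rec assms cp_const cp_mult cp_proj cp_Suc) simp_all
  moreover have "rec_nat 1 (\<lambda>m y. y * Suc m) t = fact t" for t by (induction t) auto
  ultimately show ?thesis by simp
qed

lemma dec_le: assumes "cp n g" "cp n h" shows "dec n (\<lambda>e. g e \<le> h e)"
proof -
  have "cp n (\<lambda>e. 1 - (g e - h e))" by (intro cp_diff cp_const assms)
  moreover have "1 - (x - y) = of_bool (x \<le> y)" for x y :: nat by auto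
  ultimately show ?thesis unfolding dec_def by simp
qed

lemma dec_not: assumes "dec n P" shows "dec n (\<lambda>e. \<not> P e)"
proof -
  have "cp n (\<lambda>e. 1 - of_bool (P e))" by (intro cp_diff cp_const assms[unfolded dec_def])
  moreover have "1 - of_bool b = (of_bool (\<not> b) :: nat)" for b by (cases b) simp_all
  ultimately show ?thesis unfolding dec_def by (simp only:)
qed

lemma dec_and: assumes "dec n P" "dec n Q" shows "dec n (\<lambda>e. P e \<and> Q e)"
proof -
  have "cp n (\<lambda>e. of_bool (P e) * of_bool (Q e))" by (intro cp_mult assms[unfolded dec_def])
  then show ?thesis unfolding dec_def by (simp add: of_bool_conj)
qed

lemma dec_or: assumes "dec n P" "dec n Q" shows "dec n (\<lambda>e. P e \<or> Q e)"
  using dec_not[OF dec_and[OF dec_not[OF assms(1)] dec_not[OF assms(2)]]] by simp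

lemma dec_imp: assumes "dec n P" "dec n Q" shows "dec n (\<lambda>e. P e \<longrightarrow> Q e)"
  unfolding imp_conv_disj by (intro dec_or dec_not assms)

lemma dec_less: assumes "cp n g" "cp n h" shows "dec n (\<lambda>e. g e < h e)"
  using dec_not[OF dec_le[OF assms(2,1)]] by (simp add: not_le)

lemma dec_eq: assumes "cp n g" "cp n h" shows "dec n (\<lambda>e. g e = h e)"
  using dec_and[OF dec_le[OF assms] dec_le[OF assms(2,1)]] by (simp add: eq_iff)

lemma cp_if: assumes "dec n P" "cp n g" "cp n h" shows "cp n (\<lambda>e. if P e then g e else h e)"
proof -
  have "cp n (\<lambda>e. of_bool (P e) * g e + of_bool (\<not> P e) * h e)"
    by (intro cp_add cp_mult assms(2,3) assms(1)[unfolded dec_def] dec_not[OF assms(1), unfolded dec_def])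
  moreover have "of_bool b * x + of_bool (\<not> b) * y = (if b then x else y)" for b and x y :: nat by simp
  ultimately show ?thesis by simp
qed

lemma dec_Ex_less:
  assumes "dec (Suc n) (\<lambda>e. P (e 0) (\<lambda>j. e (Suc j)))" "cp n t"
  shows "dec n (\<lambda>e. \<exists>i < t e. P i e)"
proof -
  obtain f where f: "\<And>xs. length xs = Suc n \<Longrightarrow> eval f xs (of_bool (P (xs ! 0) (\<lambda>j. xs ! Suc j)))"
    using assms(1) unfolding dec_def cp_def by blast
  \<comment> \<open>Slot 1 is skipped; in the recursion below it holds the accumulator.\<close>
  have "eval (Cn f (Proj 0 # map (\<lambda>j. Proj (Suc (Suc j))) [0..<n])) xs (of_bool (P (xs ! 0) (\<lambda>j. xs ! Suc (Suc j))))"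
    if "length xs = Suc (Suc n)" for xs
  proof (rule eval.comp[of "hd xs # tl (tl xs)"])
    have nth: "(hd xs # tl (tl xs)) ! i = (case i of 0 \<Rightarrow> xs ! 0 | Suc j \<Rightarrow> xs ! Suc (Suc j))" for i
      using that by (cases xs; cases "tl xs"; cases i) auto
    show "eval f (hd xs # tl (tl xs)) (of_bool (P (xs ! 0) (\<lambda>j. xs ! Suc (Suc j))))"
      using f[of "hd xs # tl (tl xs)"] that unfolding nth by simp
    show "\<forall>i < length (Proj 0 # map (\<lambda>j. Proj (Suc (Suc j))) [0..<n]).
      eval ((Proj 0 # map (\<lambda>j. Proj (Suc (Suc j))) [0..<n]) ! i) xs ((hd xs # tl (tl xs)) ! i)"
    proof (intro allI impI)
      fix i assume "i < length (Proj 0 # map (\<lambda>j. Proj (Suc (Suc j))) [0..<n])"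
      then show "eval ((Proj 0 # map (\<lambda>j. Proj (Suc (Suc j))) [0..<n]) ! i) xs ((hd xs # tl (tl xs)) ! i)"
        unfolding nth using that by (cases i) (auto intro: eval.proj)
    qed
  qed (use that in simp)
  then have P: "cp (Suc (Suc n)) (\<lambda>e. of_bool (P (e 0) (\<lambda>j. e (Suc (Suc j)))))" unfolding cp_def by blast
  have "cp n (\<lambda>e. rec_nat 0 (\<lambda>m y. if P m e then 1 else y) (t e))"
    by (intro cp_rec cp_zero assms(2) cp_if cp_const cp_proj) (use P in \<open>simp_all add: dec_def\<close>)
  moreover have "rec_nat (0 :: nat) (\<lambda>m y. if Q m then 1 else y) u = of_bool (\<exists>i < u. Q i)" for Q :: "nat \<Rightarrow> bool" and u
    by (induction u) (auto simp: less_Suc_eq)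
  ultimately show ?thesis unfolding dec_def by simp
qed

lemma dec_All_less:
  assumes "dec (Suc n) (\<lambda>e. P (e 0) (\<lambda>j. e (Suc j)))" "cp n t"
  shows "dec n (\<lambda>e. \<forall>i < t e. P i e)"
  using dec_not[OF dec_Ex_less[OF dec_not[OF assms(1)] assms(2)]] by simp

lemma cp_sum_bool:
  assumes "dec (Suc (Suc n)) (\<lambda>e. P (e 0) (\<lambda>j. e (Suc (Suc j))))" "cp n t"
  shows "cp n (\<lambda>e. card {i. i < t e \<and> P i e})"
proof -
  have "cp n (\<lambda>e. rec_nat 0 (\<lambda>m y. if P m e then Suc y else y) (t e))"
    by (intro cp_rec cp_zero assms cp_if cp_Suc cp_proj) simp_all
  moreover have "rec_nat 0 (\<lambda>m y. if Q m then Suc y else y) u = card {i. i < u \<and> Q i}" for Q :: "nat \<Rightarrow> bool" and u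
  proof (induction u)
    case (Suc u)
    have "{i. i < Suc u \<and> Q i} = (if Q u then insert u {i. i < u \<and> Q i} else {i. i < u \<and> Q i})"
      by (auto simp: less_Suc_eq)
    then show ?case using Suc by simp
  qed simp
  ultimately show ?thesis by simp
qed

text \<open>The quotient is found by search; the disjunct \<open>e 1 = 0\<close> stops it at 0, in
  agreement with \<open>x div 0 = 0\<close>.\<close>

lemma cp_div: assumes "cp n g" "cp n h" shows "cp n (\<lambda>e. g e div h e)"
proof (rule cp_app2[of "(div)", OF _ assms])
  have "cp 2 (\<lambda>e. LEAST q. e 1 = 0 \<or> e 0 < Suc q * e 1)"
  proof (rule cp_Least)
    show "\<exists>q. e 1 = 0 \<or> e 0 < Suc q * e 1" for e :: "nat \<Rightarrow> nat"
      by (rule exI[of _ "e 0"], cases "e 1") simp_all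
  qed (intro dec_or dec_eq dec_less cp_mult cp_Suc cp_proj cp_const; simp)
  moreover have "(LEAST q. y = 0 \<or> x < Suc q * y) = x div y" for x y :: nat
  proof (rule Least_equality)
    show "y = 0 \<or> x < Suc (x div y) * y" using dividend_less_div_times[of y x] by auto
    fix q assume "y = 0 \<or> x < Suc q * y"
    then show "x div y \<le> q" by (metis div_by_0 le0 less_Suc_eq_le less_mult_imp_div_less)
  qed
  ultimately show "cp 2 (\<lambda>e. e 0 div e 1)" by simp
qed

lemma cp_mod: assumes "cp n g" "cp n h" shows "cp n (\<lambda>e. g e mod h e)"
  using cp_diff[OF assms(1) cp_mult[OF assms(2) cp_div[OF assms]]] by (simp add: minus_mult_div_eq_mod)

lemma cp_prod_encode: assumes "cp n g" "cp n h" shows "cp n (\<lambda>e. prod_encode (g e, h e))"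
proof -
  have "cp n (\<lambda>e. (g e + h e) * Suc (g e + h e) div 2 + g e)" by (intro cp_add cp_div cp_mult cp_Suc cp_const assms)
  then show ?thesis by (simp add: prod_encode_def triangle_def)
qed

definition pfst :: "nat \<Rightarrow> nat" where "pfst z = fst (prod_decode z)"
definition psnd :: "nat \<Rightarrow> nat" where "psnd z = snd (prod_decode z)"

lemma pfst_prod_encode[simp]: "pfst (prod_encode (a, b)) = a" by (simp add: pfst_def)
lemma psnd_prod_encode[simp]: "psnd (prod_encode (a, b)) = b" by (simp add: psnd_def)
lemma prod_encode_pfst_psnd[simp]: "prod_encode (pfst z, psnd z) = z" by (simp add: pfst_def psnd_def)

text \<open>A code bounds both of its components, so in the search for one of them the other ranges
  over a bounded set.\<close>

lemma cp_pfst: assumes "cp n g" shows "cp n (\<lambda>e. pfst (g e))"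
proof (rule cp_app1[of pfst, OF _ assms])
  have ex: "\<exists>b < Suc z. prod_encode (pfst z, b) = z" for z
    using le_prod_encode_2[of "psnd z" "pfst z"] by (intro exI[of _ "psnd z"]) simp
  have "cp 1 (\<lambda>e. LEAST a. \<exists>b < Suc (e 0). prod_encode (a, b) = e 0)"
  proof (rule cp_Least)
    show "\<exists>a. \<exists>b < Suc (e 0). prod_encode (a, b) = e 0" for e :: "nat \<Rightarrow> nat" using ex by blast
  qed (intro dec_Ex_less dec_eq cp_prod_encode cp_Suc cp_proj; simp)
  moreover have "(LEAST a. \<exists>b < Suc z. prod_encode (a, b) = z) = pfst z" for z
    by (rule Least_equality) (use ex in auto)
  ultimately show "cp 1 (\<lambda>e. pfst (e 0))" by simp
qed

lemma cp_psnd: assumes "cp n g" shows "cp n (\<lambda>e. psnd (g e))"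
proof (rule cp_app1[of psnd, OF _ assms])
  have ex: "\<exists>a < Suc z. prod_encode (a, psnd z) = z" for z
    using le_prod_encode_1[of "pfst z" "psnd z"] by (intro exI[of _ "pfst z"]) simp
  have "cp 1 (\<lambda>e. LEAST b. \<exists>a < Suc (e 0). prod_encode (a, b) = e 0)"
  proof (rule cp_Least)
    show "\<exists>b. \<exists>a < Suc (e 0). prod_encode (a, b) = e 0" for e :: "nat \<Rightarrow> nat" using ex by blast
  qed (intro dec_Ex_less dec_eq cp_prod_encode cp_Suc cp_proj; simp)
  moreover have "(LEAST b. \<exists>a < Suc z. prod_encode (a, b) = z) = psnd z" for z
    by (rule Least_equality) (use ex in auto)
  ultimately show "cp 1 (\<lambda>e. psnd (e 0))" by simp
qed

text \<open>A nonempty list is coded as the successor of a pair of head and coded tail, whence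
  \<open>y - 1\<close>. The empty list has code 0, which is kept because
  \<open>psnd 0 = 0\<close>.\<close>

definition ldrop :: "nat \<Rightarrow> nat \<Rightarrow> nat" where "ldrop c i = rec_nat c (\<lambda>_ y. psnd (y - 1)) i"
definition lnth :: "nat \<Rightarrow> nat \<Rightarrow> nat" where "lnth c i = pfst (ldrop c i - 1)"
definition llen :: "nat \<Rightarrow> nat" where "llen c = (LEAST l. ldrop c l = 0)"

lemma ldrop_list_encode: "ldrop (list_encode xs) i = list_encode (drop i xs)"
proof (induction i)
  case 0 then show ?case by (simp add: ldrop_def)
next
  case (Suc i)
  have "ldrop (list_encode xs) (Suc i) = psnd (list_encode (drop i xs) - 1)"
    using Suc by (simp add: ldrop_def)
  also have "\<dots> = list_encode (tl (drop i xs))"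
  proof (cases "drop i xs")
    case Nil
    have "prod_encode (0, 0) = 0" by (simp add: prod_encode_def)
    then have "psnd 0 = 0" by (metis psnd_prod_encode)
    then show ?thesis using Nil by simp
  qed simp
  finally show ?case by (simp add: tl_drop drop_Suc)
qed

lemma lnth_list_encode: "i < length xs \<Longrightarrow> lnth (list_encode xs) i = xs ! i"
  unfolding lnth_def ldrop_list_encode by (simp add: Cons_nth_drop_Suc[symmetric])

lemma list_encode_eq_0: "list_encode xs = 0 \<longleftrightarrow> xs = []" by (cases xs) auto

lemma llen_list_encode: "llen (list_encode xs) = length xs"
  unfolding llen_def ldrop_list_encode list_encode_eq_0 by (rule Least_equality) auto

lemma cp_ldrop: assumes "cp n g" "cp n h" shows "cp n (\<lambda>e. ldrop (g e) (h e))"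
  unfolding ldrop_def by (intro cp_rec assms cp_psnd cp_diff cp_proj cp_const) simp

lemma cp_lnth: assumes "cp n g" "cp n h" shows "cp n (\<lambda>e. lnth (g e) (h e))"
  unfolding lnth_def by (intro cp_pfst cp_diff cp_ldrop cp_const assms)

lemma cp_llen: assumes "cp n g" shows "cp n (\<lambda>e. llen (g e))"
proof (rule cp_app1[of llen, OF _ assms])
  show "cp 1 (\<lambda>e. llen (e 0))" unfolding llen_def
  proof (rule cp_Least)
    show "\<exists>l. ldrop (e 0) l = 0" for e :: "nat \<Rightarrow> nat"
      using ldrop_list_encode[of "list_decode (e 0)" "length (list_decode (e 0))"] by auto
  qed (intro dec_eq cp_ldrop cp_proj cp_const; simp)
qed

lemma computable_cp:
  assumes "cp 1 (\<lambda>e. F (e 0))" shows "computable F"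
proof -
  obtain r where r: "\<And>xs. length xs = 1 \<Longrightarrow> eval r xs (F (xs ! 0))" using assms unfolding cp_def by blast
  have "eval r [x] (F x)" for x using r[of "[x]"] by simp
  then show ?thesis unfolding computable_def by blast
qed

subsection \<open>The decision procedures\<close>

text \<open>Digits are read from the most significant end in \<open>n\<close> steps, enough since
  \<open>n < k ^ n\<close>. As \<open>base_digits\<close> has no leading zeros, the state is held at
  0 until the first nonzero digit.\<close>

definition rs_code :: "nat \<Rightarrow> nat \<Rightarrow> nat \<Rightarrow> nat" where
  "rs_code k a n = rec_nat 0 (\<lambda>t y. if n div k ^ (n - Suc t) = 0 then 0
     else lnth (lnth (pfst a) y) (n div k ^ (n - Suc t) mod k)) n"

definition word_code :: "nat \<Rightarrow> nat \<Rightarrow> nat \<Rightarrow> nat" where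
  "word_code k a n = lnth (psnd a) (rs_code k a n)"

definition wf_code :: "nat \<Rightarrow> nat \<Rightarrow> bool" where
  "wf_code k b \<longleftrightarrow> 0 < llen (psnd b) \<and> llen (pfst b) = llen (psnd b) \<and>
     (\<forall>s < llen (psnd b). llen (lnth (pfst b) s) = k \<and> (\<forall>d < k. lnth (lnth (pfst b) s) d < llen (psnd b)))"

text \<open>Sets of positions are the binary numbers \<open>m\<close> below \<open>2 ^ n\<close>, so
  the search for an attractor is a bounded quantifier.\<close>

definition gamma_le_code :: "nat \<Rightarrow> nat \<Rightarrow> nat \<Rightarrow> nat \<Rightarrow> bool" where
  "gamma_le_code k a n c \<longleftrightarrow> (\<exists>m < (2 :: nat) ^ n. card {t. t < n \<and> (m div 2 ^ t) mod 2 = 1} \<le> c \<and>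
     (\<forall>i < n. \<forall>e < n. i \<le> e \<longrightarrow> (\<exists>q < n. \<exists>p < n. (m div 2 ^ p) mod 2 = 1 \<and> q \<le> p \<and> p \<le> q + (e - i) \<and>
        q + (e - i) < n \<and> (\<forall>u < Suc (e - i). word_code k a (q + u) = word_code k a (i + u)))))"

lemma pfst_enc_dfao: "pfst (enc_dfao A) = list_encode (map list_encode (fst A))"
  by (simp add: enc_dfao_def split: prod.split)

lemma psnd_enc_dfao: "psnd (enc_dfao A) = list_encode (snd A)"
  by (simp add: enc_dfao_def split: prod.split)

text \<open>Hence a search over numbers is a search over automata, and its result can be
  decoded.\<close>

lemma enc_dfao_surj: "\<exists>A. enc_dfao A = b"
proof (intro exI)
  have "map (list_encode \<circ> list_decode) xs = xs" for xs by (induction xs) simp_all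
  then show "enc_dfao (map list_decode (list_decode (pfst b)), list_decode (psnd b)) = b"
    by (simp add: enc_dfao_def)
qed

lemma wf_code_enc: "wf_code k (enc_dfao A) \<longleftrightarrow> wf_dfao k A"
proof -
  obtain D Out where A: "A = (D, Out)" by (cases A)
  have "wf_code k (enc_dfao A) \<longleftrightarrow> 0 < length Out \<and> length D = length Out \<and>
    (\<forall>s < length Out. llen (lnth (list_encode (map list_encode D)) s) = k \<and>
      (\<forall>d < k. lnth (lnth (list_encode (map list_encode D)) s) d < length Out))"
    unfolding wf_code_def pfst_enc_dfao psnd_enc_dfao llen_list_encode A by simp
  also have "\<dots> \<longleftrightarrow> wf_dfao k A"
  proof (cases "length D = length Out")
    case True
    have "llen (lnth (list_encode (map list_encode D)) s) = k \<and>
        (\<forall>d < k. lnth (lnth (list_encode (map list_encode D)) s) d < length Out) \<longleftrightarrow>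
        length (D ! s) = k \<and> (\<forall>d < k. D ! s ! d < length Out)" if "s < length Out" for s
    proof -
      have "lnth (list_encode (map list_encode D)) s = list_encode (D ! s)"
        using that True by (simp add: lnth_list_encode)
      then show ?thesis by (auto simp: llen_list_encode lnth_list_encode)
    qed
    then show ?thesis unfolding wf_dfao_def A by auto
  qed (simp add: wf_dfao_def A)
  finally show ?thesis .
qed

lemma cp_word_code:
  assumes "cp n g" "cp n h" shows "cp n (\<lambda>e. word_code k (g e) (h e))"
proof (rule cp_app2[of "word_code k", OF _ assms])
  show "cp 2 (\<lambda>e. word_code k (e 0) (e 1))"
    unfolding word_code_def rs_code_def
    by (intro cp_lnth cp_psnd cp_rec cp_if dec_eq cp_div cp_power cp_diff cp_mod cp_pfst cp_Suc cp_proj cp_const; simp)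
qed

lemma dec_wf_code:
  assumes "cp n g" shows "dec n (\<lambda>e. wf_code k (g e))"
proof -
  have "dec 1 (\<lambda>e. wf_code k (e 0))"
    unfolding wf_code_def
    by (intro dec_and dec_less dec_eq dec_All_less cp_llen cp_lnth cp_pfst cp_psnd cp_proj cp_const; simp)
  then show ?thesis unfolding dec_def by (rule cp_app1[where f = "\<lambda>x. of_bool (wf_code k x)", OF _ assms])
qed

lemma dec_gamma_le_code:
  assumes "cp n g" "cp n h" "cp n l" shows "dec n (\<lambda>e. gamma_le_code k (g e) (h e) (l e))"
proof -
  have "dec 3 (\<lambda>e. gamma_le_code k (e 0) (e 1) (e 2))"
    unfolding gamma_le_code_def
    by (intro dec_Ex_less dec_All_less dec_and dec_imp dec_le dec_less dec_eq; (intro cp_sum_bool dec_eq)?;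
        (intro cp_word_code cp_div cp_mod cp_power cp_add cp_diff cp_Suc cp_proj cp_const)?; simp)
  then have "cp 3 (\<lambda>e. of_bool (gamma_le_code k (e 0) (e 1) (e 2)))" unfolding dec_def .
  from cp_app3[of "\<lambda>x y z. of_bool (gamma_le_code k x y z)", OF this assms] show ?thesis unfolding dec_def .
qed

lemma gamma_le_code_iff: "gamma_le_code k a n c \<longleftrightarrow> gamma (word_code k a) n \<le> c"
proof
  assume "gamma_le_code k a n c"
  then have "\<exists>m < (2 :: nat) ^ n. card {t. t < n \<and> (m div 2 ^ t) mod 2 = 1} \<le> c \<and>
     (\<forall>i < n. \<forall>e < n. i \<le> e \<longrightarrow> (\<exists>q < n. \<exists>p < n. (m div 2 ^ p) mod 2 = 1 \<and> q \<le> p \<and> p \<le> q + (e - i) \<and>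
        q + (e - i) < n \<and> (\<forall>u < Suc (e - i). word_code k a (q + u) = word_code k a (i + u))))"
    unfolding gamma_le_code_def .
  then obtain m :: nat where m: "card {t. t < n \<and> (m div 2 ^ t) mod 2 = 1} \<le> c"
    "\<forall>i < n. \<forall>e < n. i \<le> e \<longrightarrow> (\<exists>q < n. \<exists>p < n. (m div 2 ^ p) mod 2 = 1 \<and> q \<le> p \<and> p \<le> q + (e - i) \<and>
        q + (e - i) < n \<and> (\<forall>u < Suc (e - i). word_code k a (q + u) = word_code k a (i + u)))"
    by (elim exE conjE)
  define S where "S = {t. t < n \<and> (m div 2 ^ t) mod 2 = 1}"
  have "attr (word_code k a) n S" unfolding attr_def
  proof (intro conjI allI impI)
    show "S \<subseteq> {..<n}" by (auto simp: S_def)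
    fix i e assume ie: "i \<le> e" "e < n"
    then have "i < n" by simp
    from m(2)[rule_format, OF this ie(2,1)] obtain q p where q: "q < n" "p < n" "(m div 2 ^ p) mod 2 = 1" "q \<le> p" "p \<le> q + (e - i)"
      "q + (e - i) < n" "\<forall>u < Suc (e - i). word_code k a (q + u) = word_code k a (i + u)" by (elim exE conjE)
    have "p \<in> S" using q(2,3) unfolding S_def by simp
    moreover have "occ (word_code k a) i e q" using q(7) unfolding occ_def by simp
    ultimately show "\<exists>q p. p \<in> S \<and> q \<le> p \<and> p \<le> q + (e - i) \<and> q + (e - i) < n \<and> occ (word_code k a) i e q"
      using q(4-6) by blast
  qed
  then have "gamma (word_code k a) n \<le> card S" by (rule gamma_le_card)
  then show "gamma (word_code k a) n \<le> c" using m(1) unfolding S_def by simp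
next
  assume le: "gamma (word_code k a) n \<le> c"
  obtain S where S: "attr (word_code k a) n S" "card S = gamma (word_code k a) n" using gamma_attained by blast
  have fin: "finite S" using S(1) by (rule attr_finite)
  have sub: "S \<subseteq> {..<n}" using S(1) unfolding attr_def by blast
  define m where "m = set_encode S"
  have bit: "(m div 2 ^ t) mod 2 = 1 \<longleftrightarrow> t \<in> S" for t
  proof -
    have "t \<in> set_decode m \<longleftrightarrow> odd (m div 2 ^ t)" by (simp add: set_decode_def)
    then show ?thesis using fin unfolding m_def by (simp add: odd_iff_mod_2_eq_one set_encode_inverse)
  qed
  have "m \<le> (\<Sum>t\<in>{..<n}. 2 ^ t)" unfolding m_def set_encode_def by (rule sum_mono2) (use sub in auto)
  also have "\<dots> = 2 ^ n - 1" using sum_power2[of n] by (simp add: lessThan_atLeast0)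
  finally have mn: "m < 2 ^ n" by (metis One_nat_def Suc_pred le_imp_less_Suc zero_less_numeral zero_less_power)
  have "{t. t < n \<and> t \<in> S} = S" using sub by auto
  then have "card {t. t < n \<and> t \<in> S} \<le> c" using S(2) le by simp
  moreover have "\<exists>q < n. \<exists>p < n. p \<in> S \<and> q \<le> p \<and> p \<le> q + (e - i) \<and>
        q + (e - i) < n \<and> (\<forall>u < Suc (e - i). word_code k a (q + u) = word_code k a (i + u))"
    if ie: "i < n" "e < n" "i \<le> e" for i e
  proof -
    obtain q p where q: "p \<in> S" "q \<le> p" "p \<le> q + (e - i)" "q + (e - i) < n" "occ (word_code k a) i e q"
      using S(1) ie unfolding attr_def by blast
    have "q < n" "p < n" using q sub by auto
    moreover have "\<forall>u < Suc (e - i). word_code k a (q + u) = word_code k a (i + u)"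
      using q(5) unfolding occ_def less_Suc_eq_le .
    ultimately show ?thesis using q(1-4) by blast
  qed
  ultimately have "card {t. t < n \<and> (m div 2 ^ t) mod 2 = 1} \<le> c \<and>
     (\<forall>i < n. \<forall>e < n. i \<le> e \<longrightarrow> (\<exists>q < n. \<exists>p < n. (m div 2 ^ p) mod 2 = 1 \<and> q \<le> p \<and> p \<le> q + (e - i) \<and>
        q + (e - i) < n \<and> (\<forall>u < Suc (e - i). word_code k a (q + u) = word_code k a (i + u))))"
    unfolding bit by (intro conjI allI impI)
  then show "gamma_le_code k a n c" unfolding gamma_le_code_def by (intro exI[of _ m] conjI[OF mn])
qed

text \<open>The successor accounts for the extra state of \<open>pad_state\<close>.\<close>

definition num_states :: "nat \<Rightarrow> nat" where "num_states a = Suc (llen (psnd a))"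
definition cap_code :: "nat \<Rightarrow> nat \<Rightarrow> nat" where "cap_code k a = gamma_cap_of k (num_states a)"

definition bounded_code :: "nat \<Rightarrow> nat \<Rightarrow> bool" where
  "bounded_code k a \<longleftrightarrow> (\<forall>n < k ^ Ngam_of (num_states a) (cap_code k a). gamma_le_code k a (Suc n) (cap_code k a))"

text \<open>Two comparisons pin the output to the value of \<open>gamma\<close> by means of the
  decidable relation \<open>gamma \<le> c\<close>; the disjunct for 0 is due to truncated
  subtraction.\<close>

definition gamma_dfao_code :: "nat \<Rightarrow> nat \<Rightarrow> nat \<Rightarrow> bool" where
  "gamma_dfao_code k a b \<longleftrightarrow> wf_code k b \<and>
     (\<forall>m < k ^ (Nall_of (num_states a) (cap_code k a) * Suc (llen (psnd b))).
        gamma_le_code k a (Suc m) (word_code k b m) \<and>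
        (word_code k b m = 0 \<or> \<not> gamma_le_code k a (Suc m) (word_code k b m - 1)))"

lemma cp_num_states: "cp n g \<Longrightarrow> cp n (\<lambda>e. num_states (g e))"
  unfolding num_states_def by (intro cp_Suc cp_llen cp_psnd)

lemma cp_Ngam_of: "cp n g \<Longrightarrow> cp n h \<Longrightarrow> cp n (\<lambda>e. Ngam_of (g e) (h e))"
  unfolding Ngam_of_def Nmatch_of_def by (intro cp_power cp_mult cp_const)

lemma cp_Nall_of: "cp n g \<Longrightarrow> cp n h \<Longrightarrow> cp n (\<lambda>e. Nall_of (g e) (h e))"
  unfolding Nall_of_def by (intro cp_power cp_Suc cp_Ngam_of)

lemma cp_NTheta_of: "cp n g \<Longrightarrow> cp n h \<Longrightarrow> cp n (\<lambda>e. NTheta_of (g e) (h e))"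
  unfolding NTheta_of_def Ncrit_of_def Ncov_of_def Nmatch_of_def Nbreak_of_def
  by (intro cp_power cp_mult cp_add cp_const)

lemma cp_Nrun_of: "cp n g \<Longrightarrow> cp n (\<lambda>e. Nrun_of (g e))"
  unfolding Nrun_of_def Nper_of_def by (intro cp_power cp_mult cp_const)

lemma cp_Nser_of: "cp n g \<Longrightarrow> cp n (\<lambda>e. Nser_of k (g e))"
  unfolding Nser_of_def Mcell_of_def gcell_of_def
  by (intro cp_NTheta_of cp_power cp_mult cp_add cp_Nrun_of cp_const)

lemma cp_Rser_of: "cp n g \<Longrightarrow> cp n (\<lambda>e. Rser_of k (g e))"
  unfolding Rser_of_def by (intro cp_Nser_of cp_power cp_mult cp_const)

lemma cp_gamma_cap_of: "cp n g \<Longrightarrow> cp n (\<lambda>e. gamma_cap_of k (g e))"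
  unfolding gamma_cap_of_def Qser_of_def Lser_of_def Pser_of_def Mcell_of_def gcell_of_def Nup_of_def
  by (intro cp_add cp_mult cp_power cp_fact cp_Rser_of cp_Nser_of cp_Nrun_of cp_const)

lemma cp_cap_code: "cp n g \<Longrightarrow> cp n (\<lambda>e. cap_code k (g e))"
  unfolding cap_code_def by (intro cp_gamma_cap_of cp_num_states)

lemma dec_bounded_code: assumes "cp n g" shows "dec n (\<lambda>e. bounded_code k (g e))"
proof -
  have "dec 1 (\<lambda>e. bounded_code k (e 0))"
    unfolding bounded_code_def
    by (intro dec_All_less dec_gamma_le_code cp_power cp_Ngam_of cp_num_states cp_cap_code cp_Suc cp_proj cp_const; simp)
  then show ?thesis unfolding dec_def by (rule cp_app1[where f = "\<lambda>x. of_bool (bounded_code k x)", OF _ assms])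
qed

lemma dec_gamma_dfao_code: assumes "cp n g" "cp n h" shows "dec n (\<lambda>e. gamma_dfao_code k (g e) (h e))"
proof -
  have "dec 2 (\<lambda>e. gamma_dfao_code k (e 0) (e 1))"
    unfolding gamma_dfao_code_def
    by (intro dec_All_less dec_and dec_or dec_not dec_eq dec_wf_code dec_gamma_le_code cp_power cp_mult cp_Nall_of cp_num_states cp_cap_code
        cp_word_code cp_llen cp_psnd cp_diff cp_Suc cp_proj cp_const; simp)
  then show ?thesis unfolding dec_def by (rule cp_app2[where f = "\<lambda>x y. of_bool (gamma_dfao_code k x y)", OF _ assms])
qed

section \<open>Asymptotic classes of \<open>gamma\<close>\<close>

lemma theta_1_if_bounded:
  assumes "\<And>n. gamma w n \<le> C"
  shows "(\<lambda>n. real (gamma w n)) \<in> \<Theta>(\<lambda>n. 1)"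
proof (rule bigthetaI)
  show "(\<lambda>n. real (gamma w n)) \<in> O(\<lambda>n. 1)"
    by (rule bigoI[of _ "real C"]) (simp add: assms)
  show "(\<lambda>n. real (gamma w n)) \<in> \<Omega>(\<lambda>n. 1)"
  proof (rule landau_omega.bigI[of 1])
    show "eventually (\<lambda>n. norm (real (gamma w n)) \<ge> 1 * norm (1 :: real)) at_top"
      using eventually_gt_at_top[of 0]
    proof eventually_elim
      case (elim n)
      then show ?case using gamma_pos[of n w] by simp
    qed
  qed simp
qed

lemma not_log_growth_if_theta_1:
  assumes "(\<lambda>n. real (gamma w n)) \<in> \<Theta>(\<lambda>n. 1)" shows "\<not> log_growth w"
proof
  assume "log_growth w"
  then obtain c n0 where c: "0 < c" "\<forall>n \<ge> n0. c * ln (real n) \<le> real (gamma w n)" unfolding log_growth_def by blast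
  have "(\<lambda>n. real (gamma w n)) \<in> O(\<lambda>n. 1)" using assms by (rule bigthetaD1)
  then obtain C where C: "eventually (\<lambda>n. norm (real (gamma w n)) \<le> C * norm (1 :: real)) at_top"
    by (elim landau_o.bigE)
  have "filterlim (\<lambda>n. ln (real n)) at_top sequentially"
    by (rule filterlim_compose[OF ln_at_top filterlim_real_sequentially])
  then have "eventually (\<lambda>n. C / c < ln (real n)) sequentially" unfolding filterlim_at_top_dense by blast
  then have "eventually (\<lambda>n. False) sequentially"
    using C eventually_ge_at_top[of n0]
  proof eventually_elim
    case (elim n)
    then have "C < c * ln (real n)" using c(1) by (simp add: field_simps)
    then show ?case using elim(2,3) c(2) by fastforce
  qed
  then show False by simp
qed

context autword begin

lemma theta_ln_if_log_growth:
  assumes "log_growth w" shows "(\<lambda>n. real (gamma w n)) \<in> \<Theta>(\<lambda>n. ln (real n))"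
proof (rule bigthetaI)
  obtain c n0 where c: "0 < c" "\<forall>n \<ge> n0. c * ln (real n) \<le> real (gamma w n)" using assms unfolding log_growth_def by blast
  show "(\<lambda>n. real (gamma w n)) \<in> \<Omega>(\<lambda>n. ln (real n))"
  proof (rule landau_omega.bigI[of c])
    show "eventually (\<lambda>n. norm (real (gamma w n)) \<ge> c * norm (ln (real n))) at_top"
      using eventually_ge_at_top[of n0] eventually_ge_at_top[of 1]
    proof eventually_elim
      case (elim n)
      then have "0 \<le> ln (real n)" by simp
      moreover have "c * ln (real n) \<le> real (gamma w n)" using c(2) elim by blast
      ultimately show ?case by simp
    qed
  qed (rule c(1))
  define A where "A = real ((s + 1) * k)"
  have lnk: "0 < ln (real k)" using k2 by simp
  have A0: "0 \<le> A" by (simp add: A_def)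
  show "(\<lambda>n. real (gamma w n)) \<in> O(\<lambda>n. ln (real n))"
  proof (rule bigoI[of _ "1 + (1 / ln (real k) + 1) * A"])
    show "eventually (\<lambda>n. norm (real (gamma w n)) \<le> (1 + (1 / ln (real k) + 1) * A) * norm (ln (real n))) at_top"
      \<comment> \<open>From 3 on, \<open>ln n \<ge> 1\<close> absorbs the additive
        constants.\<close>
      using eventually_ge_at_top[of 3]
    proof eventually_elim
      case (elim n)
      have "exp 1 \<le> real n" using exp_le elim by linarith
      then have ln1: "1 \<le> ln (real n)" using elim by (subst ln_ge_iff) auto
      obtain J where J: "k ^ J \<le> n" "n < k ^ Suc J" using klog[of n] elim by auto
      have "real k ^ J \<le> real n" using J(1) by (metis of_nat_le_iff of_nat_power)
      then have "ln (real k ^ J) \<le> ln (real n)" using k2 elim by (subst ln_le_cancel_iff) auto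
      then have "real J * ln (real k) \<le> ln (real n)" using ln_realpow[of "real k" J] k2 by simp
      then have JL: "real J \<le> ln (real n) / ln (real k)" using lnk by (simp add: field_simps)
      have "gamma w n \<le> 1 + Suc J * ((s + 1) * k)" using J elim by (intro gamma_log_upper) auto
      then have "real (gamma w n) \<le> real (1 + Suc J * ((s + 1) * k))" by (simp only: of_nat_le_iff)
      also have "\<dots> = 1 + (real J + 1) * A" unfolding A_def of_nat_add of_nat_mult of_nat_Suc of_nat_1 by simp
      also have "\<dots> \<le> ln (real n) + (ln (real n) / ln (real k) + ln (real n)) * A"
        using JL ln1 A0 by (intro add_mono mult_right_mono) auto
      also have "\<dots> = (1 + (1 / ln (real k) + 1) * A) * ln (real n)" by (simp add: algebra_simps)
      finally show ?case using ln1 by simp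
    qed
  qed
qed

text \<open>Replaces an asymptotic statement by inequalities with one computable constant, which a
  finite check can settle.\<close>

lemma theta_1_iff: "(\<lambda>n. real (gamma w n)) \<in> \<Theta>(\<lambda>n. 1) \<longleftrightarrow> (\<forall>n. gamma w n \<le> gamma_cap)"
  using gamma_dichotomy not_log_growth_if_theta_1[of w] theta_1_if_bounded[of w gamma_cap] by blast

end

section \<open>Correctness of the coded procedures\<close>

context radix begin

lemma rs_code_enc:
  assumes wf: "wf_dfao k A" shows "rs_code k (enc_dfao A) n = run_state A n"
proof -
  define R where "R t = rec_nat 0 (\<lambda>t y. if n div k ^ (n - Suc t) = 0 then 0
     else lnth (lnth (pfst (enc_dfao A)) y) (n div k ^ (n - Suc t) mod k)) t" for t
  have step: "lnth (lnth (pfst (enc_dfao A)) (run_state A x)) d = fst A ! run_state A x ! d" if "d < k" for x d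
  proof -
    have st: "run_state A x < length (fst A)" "length (fst A ! run_state A x) = k"
      using run_state_less[OF wf, of x] wf by (auto simp: wf_dfao_def)
    then show ?thesis unfolding pfst_enc_dfao using that by (simp add: lnth_list_encode)
  qed
  have "R t = run_state A (n div k ^ (n - t))" if "t \<le> n" for t
    using that
  proof (induction t)
    case 0
    then show ?case using less_kpow[of n] by (simp add: R_def)
  next
    case (Suc t)
    define m where "m = n div k ^ (n - Suc t)"
    have nt: "n - t = Suc (n - Suc t)" using Suc.prems by simp
    have md: "n div k ^ (n - t) = m div k" unfolding m_def nt power_Suc2 by (rule div_mult2_eq)
    have RS: "R (Suc t) = (if m = 0 then 0 else lnth (lnth (pfst (enc_dfao A)) (R t)) (m mod k))"
      by (simp add: R_def m_def)
    have IH: "R t = run_state A (m div k)" using Suc md by simp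
    show ?case
    proof (cases "m = 0")
      case True
      then show ?thesis unfolding RS m_def[symmetric] by simp
    next
      case False
      have "run_state A (k * (m div k) + m mod k) = fst A ! run_state A (m div k) ! (m mod k)"
        using False by (intro run_state_step) simp_all
      then show ?thesis unfolding RS IH m_def[symmetric] using False step[of "m mod k" "m div k"] by simp
    qed
  qed
  from this[of n] show ?thesis by (simp add: R_def rs_code_def)
qed

lemma word_code_enc:
  assumes "wf_dfao k A" shows "word_code k (enc_dfao A) = dfao_word k A"
proof
  fix n
  show "word_code k (enc_dfao A) n = dfao_word k A n"
    unfolding word_code_def rs_code_enc[OF assms] psnd_enc_dfao dfao_word_eq
    using run_state_less[OF assms] by (rule lnth_list_encode)
qed

lemma bounded_code_enc:
  assumes wf: "wf_dfao k A"
  shows "bounded_code k (enc_dfao A) \<longleftrightarrow> (\<lambda>n. real (gamma (dfao_word k A) n)) \<in> \<Theta>(\<lambda>n. 1)"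
proof -
  interpret autword k "pad_state A" "Suc (length (snd A))" "dfao_word k A" by (rule autword_dfao[OF wf])
  have ns: "num_states (enc_dfao A) = Suc (length (snd A))"
    by (simp add: num_states_def psnd_enc_dfao llen_list_encode)
  show ?thesis
    unfolding theta_1_iff bounded_code_def cap_code_def ns gamma_le_code_iff word_code_enc[OF wf]
    using gamma_bounded_check[of "gamma_cap_of k (Suc (length (snd A)))"] by blast
qed

lemma gamma_dfao_code_enc:
  assumes wf: "wf_dfao k A" and th: "(\<lambda>n. real (gamma (dfao_word k A) n)) \<in> \<Theta>(\<lambda>n. 1)"
  shows "gamma_dfao_code k (enc_dfao A) (enc_dfao B) \<longleftrightarrow>
    wf_dfao k B \<and> (\<forall>m. dfao_word k B m = gamma (dfao_word k A) (Suc m))"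
proof -
  interpret autword k "pad_state A" "Suc (length (snd A))" "dfao_word k A" by (rule autword_dfao[OF wf])
  let ?C = "gamma_cap_of k (Suc (length (snd A)))"
  have bd: "\<And>n. gamma (dfao_word k A) n \<le> ?C" using th theta_1_iff by blast
  have ns: "num_states (enc_dfao A) = Suc (length (snd A))"
    by (simp add: num_states_def psnd_enc_dfao llen_list_encode)
  have val: "x \<le> v \<and> (v = 0 \<or> \<not> x \<le> v - 1) \<longleftrightarrow> v = x" for x v :: nat by auto
  show ?thesis
  proof (cases "wf_dfao k B")
    case True
    have "gamma_dfao_code k (enc_dfao A) (enc_dfao B) \<longleftrightarrow>
      (\<forall>m < k ^ (Nall_of (Suc (length (snd A))) ?C * Suc (length (snd B))). dfao_word k B m = gamma (dfao_word k A) (Suc m))"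
      unfolding gamma_dfao_code_def cap_code_def ns gamma_le_code_iff word_code_enc[OF wf] word_code_enc[OF True]
        wf_code_enc psnd_enc_dfao llen_list_encode val using True by blast
    then show ?thesis using gamma_dfao_check[of ?C B, OF bd True] True by blast
  qed (simp add: gamma_dfao_code_def wf_code_enc)
qed

end

theorem theorem18:
  fixes k :: nat
  assumes "k \<ge> 2"
  shows "(\<forall>w. k_automatic k w \<longrightarrow>
            (\<lambda>n. real (gamma w n)) \<in> \<Theta>(\<lambda>n. 1) \<or>
            (\<lambda>n. real (gamma w n)) \<in> \<Theta>(\<lambda>n. ln (real n)))
       \<and> (\<exists>f. computable f \<and>
            (\<forall>A. wf_dfao k A \<longrightarrow>
               (f (enc_dfao A) = 0 \<longleftrightarrow> (\<lambda>n. real (gamma (dfao_word k A) n)) \<in> \<Theta>(\<lambda>n. 1))))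
       \<and> (\<exists>g. computable g \<and>
            (\<forall>A. wf_dfao k A \<and> (\<lambda>n. real (gamma (dfao_word k A) n)) \<in> \<Theta>(\<lambda>n. 1) \<longrightarrow>
               (\<exists>B. g (enc_dfao A) = enc_dfao B \<and> wf_dfao k B \<and>
                    (\<forall>m. dfao_word k B m = gamma (dfao_word k A) (Suc m)))))"
proof -
  interpret radix k by unfold_locales (rule assms)
  show ?thesis
  proof (intro conjI allI impI)
    fix w assume "k_automatic k w"
    then obtain A where A: "wf_dfao k A" "w = dfao_word k A" unfolding k_automatic_def by blast
    interpret autword k "pad_state A" "Suc (length (snd A))" "dfao_word k A" by (rule autword_dfao[OF A(1)])
    show "(\<lambda>n. real (gamma w n)) \<in> \<Theta>(\<lambda>n. 1) \<or> (\<lambda>n. real (gamma w n)) \<in> \<Theta>(\<lambda>n. ln (real n))"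
      using gamma_dichotomy theta_ln_if_log_growth unfolding theta_1_iff A(2) by blast
  next
    define f :: "nat \<Rightarrow> nat" where "f a = of_bool (\<not> bounded_code k a)" for a
    have "cp 1 (\<lambda>e. f (e 0))"
      unfolding f_def dec_def[symmetric] by (intro dec_not dec_bounded_code cp_proj) simp
    then have "computable f" by (rule computable_cp)
    then show "\<exists>f. computable f \<and> (\<forall>A. wf_dfao k A \<longrightarrow>
        (f (enc_dfao A) = 0 \<longleftrightarrow> (\<lambda>n. real (gamma (dfao_word k A) n)) \<in> \<Theta>(\<lambda>n. 1)))"
      using bounded_code_enc by (intro exI[of _ f]) (simp add: f_def)
  next
    \<comment> \<open>The first two disjuncts make the search total: on codes that are ill-formed or
      fail the boundedness test it stops at 0.\<close>
    define g where "g a = (LEAST b. \<not> wf_code k a \<or> \<not> bounded_code k a \<or> gamma_dfao_code k a b)" for a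
    have dfao: "\<exists>B. gamma_dfao_code k (enc_dfao A) (enc_dfao B)"
      if A: "wf_dfao k A" "(\<lambda>n. real (gamma (dfao_word k A) n)) \<in> \<Theta>(\<lambda>n. 1)" for A
    proof -
      interpret autword k "pad_state A" "Suc (length (snd A))" "dfao_word k A" by (rule autword_dfao[OF A(1)])
      have bd: "\<And>n. gamma (dfao_word k A) n \<le> gamma_cap_of k (Suc (length (snd A)))" using A(2) theta_1_iff by blast
      obtain B where "wf_dfao k B" "\<forall>m. dfao_word k B m = gamma (dfao_word k A) (Suc m)"
        using gamma_dfao_exists[OF bd] by blast
      then show ?thesis unfolding gamma_dfao_code_enc[OF A] by blast
    qed
    have total: "\<exists>b. \<not> wf_code k a \<or> \<not> bounded_code k a \<or> gamma_dfao_code k a b" for a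
    proof -
      obtain A where a: "enc_dfao A = a" using enc_dfao_surj by blast
      show ?thesis using dfao[of A] unfolding a[symmetric] wf_code_enc
        by (cases "wf_dfao k A") (use bounded_code_enc in blast)+
    qed
    have "cp 1 (\<lambda>e. g (e 0))" unfolding g_def
    proof (rule cp_Least)
      show "\<exists>b. \<not> wf_code k (e 0) \<or> \<not> bounded_code k (e 0) \<or> gamma_dfao_code k (e 0) b" for e :: "nat \<Rightarrow> nat"
        by (rule total)
    qed (intro dec_or dec_not dec_wf_code dec_bounded_code dec_gamma_dfao_code cp_proj; simp)
    then have "computable g" by (rule computable_cp)
    moreover have "\<exists>B. g (enc_dfao A) = enc_dfao B \<and> wf_dfao k B \<and>
        (\<forall>m. dfao_word k B m = gamma (dfao_word k A) (Suc m))"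
      if A: "wf_dfao k A" "(\<lambda>n. real (gamma (dfao_word k A) n)) \<in> \<Theta>(\<lambda>n. 1)" for A
    proof -
      obtain B where B: "enc_dfao B = g (enc_dfao A)" using enc_dfao_surj by blast
      have "\<not> wf_code k (enc_dfao A) \<or> \<not> bounded_code k (enc_dfao A) \<or> gamma_dfao_code k (enc_dfao A) (g (enc_dfao A))"
        unfolding g_def by (rule LeastI_ex) (rule total)
      then have "gamma_dfao_code k (enc_dfao A) (enc_dfao B)"
        unfolding B using A by (simp add: wf_code_enc bounded_code_enc)
      then show ?thesis unfolding gamma_dfao_code_enc[OF A] using B by metis
    qed
    ultimately show "\<exists>g. computable g \<and>
            (\<forall>A. wf_dfao k A \<and> (\<lambda>n. real (gamma (dfao_word k A) n)) \<in> \<Theta>(\<lambda>n. 1) \<longrightarrow>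
               (\<exists>B. g (enc_dfao A) = enc_dfao B \<and> wf_dfao k B \<and>
                    (\<forall>m. dfao_word k B m = gamma (dfao_word k A) (Suc m))))"
      by blast
  qed
qed

end
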